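(* Let $\Omega=\{(s,t)\in\mathbb{R}^2\colon 0<s,t\le 1,\ s+t>1\}$, let $m$ be the normalized (probability) restriction of Lebesgue area measure to $\Omega$, and let $\Phi\colon\Omega\to\Omega$ be the BCZ map $$\Phi(s,t)=\left(t,\,-s+\left\lfloor \frac{1+s}{t}\right\rfloor t\right).$$ Then $\Phi$, as a measure-preserving transformation of $(\Omega,m)$, is weak-mixing.
   Context: The map $\Phi$ preserves the measure $m$. Weak-mixing has its usual ergodic-theoretic meaning for a measure-preserving transformation of a probability space: equivalently, the only measurable eigenfunctions $f\in L^2(\Omega,m;\mathbb{C})$, $f\circ\Phi=\alpha f$ a.e. with $f\neq 0$, are the a.e. constant ones (with $\alpha=1$). *)

theory Defs
  imports "HOL-Probability.Probability"
begin

definition measure_preserving :: "'a measure \<Rightarrow> ('a \<Rightarrow> 'a) \<Rightarrow> bool" where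
  "measure_preserving M T \<longleftrightarrow> T \<in> M \<rightarrow>\<^sub>M M \<and> distr M M T = M"

definition eigenfunction :: "'a measure \<Rightarrow> ('a \<Rightarrow> 'a) \<Rightarrow> complex \<Rightarrow> ('a \<Rightarrow> complex) \<Rightarrow> bool" where
  "eigenfunction M T \<alpha> f \<longleftrightarrow>
     f \<in> borel_measurable M \<and> integrable M (\<lambda>x. (cmod (f x))\<^sup>2) \<and>
     \<not> (AE x in M. f x = 0) \<and> (AE x in M. f (T x) = \<alpha> * f x)"

text \<open>The clause for \<open>\<alpha> = 1\<close> contains ergodicity. No condition \<open>\<bar>\<alpha>\<bar> = 1\<close> is imposed; it holds
  automatically, because composition with \<open>T\<close> is an isometry of \<open>L\<^sup>2\<close>.\<close>

definition weak_mixing :: "'a measure \<Rightarrow> ('a \<Rightarrow> 'a) \<Rightarrow> bool" where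
  "weak_mixing M T \<longleftrightarrow> prob_space M \<and> measure_preserving M T \<and>
     (\<forall>\<alpha> f. eigenfunction M T \<alpha> f \<longrightarrow> \<alpha> = 1 \<and> (\<exists>c. AE x in M. f x = c))"

definition bcz_domain :: "(real \<times> real) set" where
  "bcz_domain = {(s, t). 0 < s \<and> s \<le> 1 \<and> 0 < t \<and> t \<le> 1 \<and> s + t > 1}"

text \<open>The underlying space is \<open>bcz_domain\<close>, not the whole plane.\<close>

definition bcz_measure :: "(real \<times> real) measure" where
  "bcz_measure = uniform_measure (restrict_space lborel bcz_domain) bcz_domain"

text \<open>Only the values on \<open>bcz_domain\<close>, which is mapped into itself, are relevant.\<close>

definition bcz_map :: "real \<times> real \<Rightarrow> real \<times> real" where
  "bcz_map = (\<lambda>(s, t). (t, - s + real_of_int \<lfloor>(1 + s) / t\<rfloor> * t))"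

end

theory Submission
  imports Defs
begin

text \<open>
  A point \<open>(s, t)\<close> of the domain encodes a unimodular lattice with the horizontal vector \<open>(s, 0)\<close> and a second basis
  vector of abscissa \<open>t\<close>, modulo vertical shears; the BCZ map is the first return map of the horocycle flow, with
  return time \<open>1 / (s t)\<close>, and an invariant set is an \<open>SL(2,\<int>)\<close>-invariant set of the plane.

  Ergodicity: by the Mautner argument an \<open>SL(2,\<int>)\<close>-invariant set is invariant under scalings, since \<open>\<lambda> p\<close> and \<open>p\<close>
  have perturbations by \<open>O(1/n)\<close> in the same orbit. Hence it comes from an invariant set of slopes, which is trivial by
  bounded distortion of the Moebius maps on balanced Farey intervals and Vitali's covering theorem.

  Weak mixing: let \<open>f \<circ> \<Phi> = \<alpha> f\<close> with \<open>\<bar>f\<bar> = 1\<close>, and let \<open>f\<^sub>l\<close> be \<open>f\<close> transported by the self-similarity \<open>p \<mapsto> l p\<close>. Then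
  \<open>f\<^sub>l / f\<close> tends to 1 in measure as \<open>l \<rightarrow> 1\<close>, but along an orbit it is multiplied by \<open>\<alpha>\<close> at every visit to the
  thin strip \<open>1 < s + t \<le> 1 / l\<close>. If the strip has width \<open>h\<close>, a second moment estimate shows that an orbit piece of length
  \<open>1 / (1000 h)\<close> visits it exactly once with probability bounded below, so \<open>\<alpha> = 1\<close>.
\<close>

section \<open>The map and its invariant measure\<close>

text \<open>The suspension is there because Mautner's comparison needs a common clock: after
  \<open>n\<close> time units every lattice has undergone the same shear, while the number of map
  iterations performed by then differs from point to point. Integer times suffice, since a return
  takes at least one time unit. The self-similarity breaks down in the corners of the strip, where a
  rescaled point can make more than two steps for one step of the original point. The corners are
  therefore cut off and paid for by their area, which is smaller than that of the remaining core by
  a fixed factor. In the second moment estimate, let \<open>x\<close> be the number of time steps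
  times the width \<open>h\<close>: expected visits to the core and to the corners are linear in
  \<open>x\<close>, pairs of visits quadratic, so a small fixed \<open>x\<close> leaves a positive
  measure of points with exactly one core visit and no corner visit. Eigenfunctions satisfy their
  equation only almost everywhere, but all dynamics is by countably many integer matrices. A null
  set saturated under SL(2,Z) is again null, and discarding it makes the equation hold along every
  orbit.\<close>

lemma nn_integral_lborel_pair:
  fixes f :: "'a::euclidean_space \<times> 'b::euclidean_space \<Rightarrow> ennreal"
  assumes [measurable]: "f \<in> borel_measurable borel"
  shows "(\<integral>\<^sup>+p. f p \<partial>lborel) = (\<integral>\<^sup>+x. \<integral>\<^sup>+y. f (x, y) \<partial>lborel \<partial>lborel)"
  unfolding lborel_prod[symmetric]
  by (subst lborel.nn_integral_fst[symmetric]) (simp_all add: lborel_prod)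

lemma nn_integral_lborel_pair_swap:
  fixes f :: "'a::euclidean_space \<times> 'b::euclidean_space \<Rightarrow> ennreal"
  assumes [measurable]: "f \<in> borel_measurable borel"
  shows "(\<integral>\<^sup>+p. f p \<partial>lborel) = (\<integral>\<^sup>+y. \<integral>\<^sup>+x. f (x, y) \<partial>lborel \<partial>lborel)"
  unfolding lborel_prod[symmetric]
  by (subst lborel_pair.nn_integral_snd[symmetric]) (simp_all add: lborel_prod)

lemma borel_measurable_fst_snd [measurable]:
  "(fst :: 'a::topological_space \<times> 'b::topological_space \<Rightarrow> 'a) \<in> borel_measurable borel"
  "(snd :: 'a::topological_space \<times> 'b::topological_space \<Rightarrow> 'b) \<in> borel_measurable borel"
  by (intro borel_measurable_continuous_onI continuous_intros)+

lemma ennreal_real_between_0: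
  assumes "(0 :: ennreal) < e"
  obtains r where "0 < r" "ennreal r < e"
proof -
  obtain e' where e': "0 < e'" "e' < e" using assms dense by blast
  then show ?thesis
    using that by (cases e' rule: ennreal_cases) (auto simp: top.extremum_strict)
qed

lemma bcz_domain_iff: "(s, t) \<in> bcz_domain \<longleftrightarrow> 0 < s \<and> s \<le> 1 \<and> 0 < t \<and> t \<le> 1 \<and> s + t > 1"
  by (simp add: bcz_domain_def)

lemma bcz_map_eq: "bcz_map (s, t) = (t, - s + real_of_int \<lfloor>(1 + s) / t\<rfloor> * t)"
  by (simp add: bcz_map_def)

lemma borel_prod_eq: "(borel :: (real \<times> real) measure) = borel \<Otimes>\<^sub>M borel"
  by (simp add: borel_prod)

lemma bcz_domain_measurable [measurable]: "bcz_domain \<in> sets borel"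
proof -
  have "bcz_domain = {p \<in> space (borel \<Otimes>\<^sub>M borel). 0 < fst p \<and> fst p \<le> 1 \<and> 0 < snd p \<and> snd p \<le> 1 \<and> fst p + snd p > 1}"
    by (auto simp: bcz_domain_def space_pair_measure)
  also have "\<dots> \<in> sets (borel \<Otimes>\<^sub>M borel)" by measurable
  finally show ?thesis by (simp only: borel_prod)
qed

lemma bcz_domain_measurable' [measurable]: "bcz_domain \<in> sets (borel \<Otimes>\<^sub>M borel)"
  using bcz_domain_measurable by (simp only: borel_prod)

lemma bcz_map_measurable [measurable]: "bcz_map \<in> borel_measurable borel"
  unfolding bcz_map_def borel_prod_eq by measurable

lemma bcz_map_in:
  assumes "p \<in> bcz_domain" shows "bcz_map p \<in> bcz_domain"
proof -
  obtain s t where p: "p = (s, t)" by force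
  have st: "0 < s" "s \<le> 1" "0 < t" "t \<le> 1" "s + t > 1"
    using assms by (auto simp: p bcz_domain_iff)
  define k where "k = \<lfloor>(1 + s) / t\<rfloor>"
  have "of_int k \<le> (1 + s) / t" "(1 + s) / t < of_int k + 1"
    by (auto simp: k_def)
  then have "of_int k * t \<le> 1 + s" "1 + s < of_int k * t + t"
    using st by (auto simp: field_simps)
  then show ?thesis
    using st by (auto simp: p bcz_map_eq bcz_domain_iff k_def[symmetric])
qed

text \<open>For \<open>s\<close> in \<open>{1 - t<..1}\<close> the quotient
  \<open>(1 + s) / t\<close> runs over a half-open interval of length 1 ending at
  \<open>2 / t\<close>, so its floor takes only the values \<open>K\<close> and
  \<open>K - 1\<close>, with break point \<open>K * t - 1\<close>. Each of the two pieces is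
  reflected onto itself.\<close>

lemma nn_integral_bcz_fibre:
  fixes g :: "real \<Rightarrow> ennreal"
  assumes [measurable]: "g \<in> borel_measurable borel" and t: "0 < t"
  shows "(\<integral>\<^sup>+s. g (- s + real_of_int \<lfloor>(1 + s) / t\<rfloor> * t) * indicator {1 - t<..1} s \<partial>lborel)
       = (\<integral>\<^sup>+s. g s * indicator {1 - t<..1} s \<partial>lborel)"
proof -
  define K where "K = \<lfloor>2 / t\<rfloor>"
  have "of_int K \<le> 2 / t" "2 / t < of_int K + 1"
    by (auto simp: K_def)
  then have K: "of_int K * t \<le> 2" "2 < of_int K * t + t"
    using t by (auto simp: field_simps)
  have fl1: "\<lfloor>(1 + s) / t\<rfloor> = K" if "of_int K * t - 1 \<le> s" "s \<le> 1" for s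
    using that K t by (intro floor_unique) (auto simp: field_simps)
  have fl2: "\<lfloor>(1 + s) / t\<rfloor> = K - 1" if "1 - t < s" "s < of_int K * t - 1" for s
    using that K t by (intro floor_unique) (auto simp: field_simps)
  have reflect: "(\<integral>\<^sup>+s. h s \<partial>lborel) = (\<integral>\<^sup>+s. h (c - s) \<partial>lborel)"
    if [measurable]: "h \<in> borel_measurable borel" for h :: "real \<Rightarrow> ennreal" and c
    using nn_integral_real_affine[of h "-1" c] by simp
  let ?u = "of_int K * t"
  have "(\<integral>\<^sup>+s. g (- s + real_of_int \<lfloor>(1 + s) / t\<rfloor> * t) * indicator {1 - t<..1} s \<partial>lborel)
      = (\<integral>\<^sup>+s. g (?u - s) * indicator {?u - 1..1} s + g (?u - t - s) * indicator {1 - t<..<?u - 1} s \<partial>lborel)"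
  proof (rule nn_integral_cong)
    fix s
    show "g (- s + real_of_int \<lfloor>(1 + s) / t\<rfloor> * t) * indicator {1 - t<..1} s
       = g (?u - s) * indicator {?u - 1..1} s + g (?u - t - s) * indicator {1 - t<..<?u - 1} s"
      using K t fl1[of s] fl2[of s]
      by (cases "?u - 1 \<le> s") (auto simp: indicator_def algebra_simps)
  qed
  also have "\<dots> = (\<integral>\<^sup>+s. g (?u - s) * indicator {?u - 1..1} s \<partial>lborel)
      + (\<integral>\<^sup>+s. g (?u - t - s) * indicator {1 - t<..<?u - 1} s \<partial>lborel)"
    by (rule nn_integral_add) auto
  also have "\<dots> = (\<integral>\<^sup>+s. g s * indicator {?u - 1..1} (?u - s) \<partial>lborel)
      + (\<integral>\<^sup>+s. g s * indicator {1 - t<..<?u - 1} (?u - t - s) \<partial>lborel)"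
    by (subst (1) reflect[of _ ?u], simp, subst (2) reflect[of _ "?u - t"], simp, simp)
  also have "\<dots> = (\<integral>\<^sup>+s. g s * indicator {?u - 1..1} (?u - s) + g s * indicator {1 - t<..<?u - 1} (?u - t - s) \<partial>lborel)"
    by (rule nn_integral_add[symmetric]) auto
  also have "\<dots> = (\<integral>\<^sup>+s. g s * indicator {1 - t<..1} s \<partial>lborel)"
    using K t by (intro nn_integral_cong) (auto simp: indicator_def)
  finally show ?thesis .
qed

text \<open>The sections of the domain obtained by fixing either coordinate at \<open>t\<close> are
  both \<open>{1 - t<..1}\<close>. Integrating in opposite orders on the two sides therefore reduces
  the claim to the fibre map.\<close>

lemma nn_integral_bcz_map:
  fixes g :: "real \<times> real \<Rightarrow> ennreal"
  assumes [measurable]: "g \<in> borel_measurable borel"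
  shows "(\<integral>\<^sup>+p. g (bcz_map p) * indicator bcz_domain p \<partial>lborel)
       = (\<integral>\<^sup>+p. g p * indicator bcz_domain p \<partial>lborel)"
proof -
  have [measurable]: "g \<in> borel_measurable (borel \<Otimes>\<^sub>M borel)"
    by (simp add: borel_prod)
  have ind: "indicator bcz_domain (s, t) = (indicator {0<..1} t * indicator {1 - t<..1} s :: ennreal)" for s t
    by (auto simp: indicator_def bcz_domain_iff)
  have ind': "indicator bcz_domain (s, t) = (indicator {0<..1} s * indicator {1 - s<..1} t :: ennreal)" for s t
    by (auto simp: indicator_def bcz_domain_iff)
  have "(\<integral>\<^sup>+p. g (bcz_map p) * indicator bcz_domain p \<partial>lborel)
     = (\<integral>\<^sup>+t. \<integral>\<^sup>+s. g (bcz_map (s, t)) * indicator bcz_domain (s, t) \<partial>lborel \<partial>lborel)"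
    by (rule nn_integral_lborel_pair_swap) measurable
  also have "\<dots> = (\<integral>\<^sup>+t. \<integral>\<^sup>+s. g (t, s) * indicator bcz_domain (t, s) \<partial>lborel \<partial>lborel)"
  proof (rule nn_integral_cong)
    fix t :: real
    show "(\<integral>\<^sup>+s. g (bcz_map (s, t)) * indicator bcz_domain (s, t) \<partial>lborel)
        = (\<integral>\<^sup>+s. g (t, s) * indicator bcz_domain (t, s) \<partial>lborel)"
    proof (cases "0 < t \<and> t \<le> 1")
      case True
      then show ?thesis
        using nn_integral_bcz_fibre[of "\<lambda>s. g (t, s)" t]
        unfolding bcz_map_eq ind[of _ t] ind'[of t] by simp
    next
      case False
      then show ?thesis unfolding ind[of _ t] ind'[of t] by auto
    qed
  qed
  also have "\<dots> = (\<integral>\<^sup>+p. g p * indicator bcz_domain p \<partial>lborel)"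
    by (rule nn_integral_lborel_pair[symmetric]) measurable
  finally show ?thesis .
qed

lemma emeasure_bcz_domain: "emeasure lborel bcz_domain = ennreal (1 / 2)"
proof -
  have ind: "indicator bcz_domain (s, t) = (indicator {0<..1} s * indicator {1 - s<..1} t :: ennreal)" for s t
    by (auto simp: indicator_def bcz_domain_iff)
  have "emeasure lborel bcz_domain = (\<integral>\<^sup>+p. indicator bcz_domain p \<partial>lborel)"
    by simp
  also have "\<dots> = (\<integral>\<^sup>+s. \<integral>\<^sup>+t. indicator bcz_domain (s, t) \<partial>lborel \<partial>lborel)"
    by (rule nn_integral_lborel_pair) measurable
  also have "\<dots> = (\<integral>\<^sup>+s. ennreal s * indicator {0..1} s \<partial>lborel)"
    unfolding ind by (intro nn_integral_cong) (simp add: nn_integral_cmult_indicator mult.commute, simp add: indicator_def)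
  also have "\<dots> = ennreal (1 ^ 2 / 2 - 0 ^ 2 / 2)"
    by (rule nn_integral_FTC_Icc[where F = "\<lambda>x. x ^ 2 / 2"]) (auto intro!: derivative_eq_intros)
  finally show ?thesis by simp
qed

section \<open>The suspension flow\<close>

definition return_time :: "real \<times> real \<Rightarrow> real" where
  "return_time p = 1 / (fst p * snd p)"

definition suspension :: "((real \<times> real) \<times> real) set" where
  "suspension = {(p, u). p \<in> bcz_domain \<and> 0 \<le> u \<and> u < return_time p}"

definition suspension_measure :: "((real \<times> real) \<times> real) measure" where
  "suspension_measure = density lborel (indicator suspension)"

text \<open>The time-one map. One crossing of the section is enough: afterwards the height is below
  1, hence below the next return time.\<close>

definition unit_flow :: "(real \<times> real) \<times> real \<Rightarrow> (real \<times> real) \<times> real" where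
  "unit_flow = (\<lambda>(p, u). if u + 1 < return_time p then (p, u + 1) else (bcz_map p, u + 1 - return_time p))"

text \<open>The basis \<open>(s, 0)\<close>, \<open>(t, 1 / s)\<close> sheared by
  \<open>(x, y) \<mapsto> (x, y - u x)\<close>, with \<open>u\<close> the height in the suspension,
  keeps the abscissae \<open>s\<close>, \<open>t\<close> and gets these ordinates.\<close>

definition transversal :: "(real \<times> real) \<times> real \<Rightarrow> real \<times> real" where
  "transversal x = (- snd x * fst (fst x), 1 / fst (fst x) - snd x * snd (fst x))"

lemma return_time_ge_1: "p \<in> bcz_domain \<Longrightarrow> 1 \<le> return_time p"
  by (cases p) (auto simp: return_time_def bcz_domain_iff mult_le_one)

lemma return_time_measurable [measurable]: "return_time \<in> borel_measurable borel"
  unfolding return_time_def borel_prod_eq by measurable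

lemma suspension_measurable [measurable]: "suspension \<in> sets borel"
proof -
  have "suspension = {x \<in> space (borel \<Otimes>\<^sub>M borel). fst x \<in> bcz_domain \<and> 0 \<le> snd x \<and> snd x < return_time (fst x)}"
    by (auto simp: suspension_def space_pair_measure)
  also have "\<dots> \<in> sets (borel \<Otimes>\<^sub>M borel)" by measurable
  finally show ?thesis by (simp only: borel_prod)
qed

lemma unit_flow_measurable [measurable]: "unit_flow \<in> borel_measurable borel"
proof -
  have "unit_flow \<in> (borel \<Otimes>\<^sub>M borel) \<rightarrow>\<^sub>M (borel \<Otimes>\<^sub>M borel)"
    unfolding unit_flow_def by measurable
  then show ?thesis by (simp only: borel_prod)
qed

lemma transversal_measurable [measurable]: "transversal \<in> borel_measurable borel"
proof -
  have "transversal \<in> ((borel \<Otimes>\<^sub>M borel) \<Otimes>\<^sub>M borel) \<rightarrow>\<^sub>M (borel \<Otimes>\<^sub>M borel)"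
    unfolding transversal_def by measurable
  then show ?thesis by (simp only: borel_prod)
qed

lemma space_suspension_measure [simp]: "space suspension_measure = UNIV"
  and sets_suspension_measure [simp, measurable_cong]: "sets suspension_measure = sets borel"
  by (auto simp: suspension_measure_def)

lemma unit_flow_in:
  assumes "x \<in> suspension" shows "unit_flow x \<in> suspension"
proof -
  obtain p u where x: "x = (p, u)" by (cases x)
  show ?thesis
    using assms bcz_map_in[of p] return_time_ge_1[of "bcz_map p"]
    by (auto simp: x suspension_def unit_flow_def)
qed

lemma nn_integral_suspension:
  fixes g :: "(real \<times> real) \<times> real \<Rightarrow> ennreal"
  assumes [measurable]: "g \<in> borel_measurable borel"
  shows "(\<integral>\<^sup>+x. g x \<partial>suspension_measure) =
    (\<integral>\<^sup>+p. (\<integral>\<^sup>+u. g (p, u) * indicator {0..<return_time p} u \<partial>lborel) * indicator bcz_domain p \<partial>lborel)"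
proof -
  have [measurable]: "g \<in> borel_measurable (borel \<Otimes>\<^sub>M borel)"
    by (simp add: borel_prod)
  have "(\<integral>\<^sup>+x. g x \<partial>suspension_measure) = (\<integral>\<^sup>+x. indicator suspension x * g x \<partial>lborel)"
    unfolding suspension_measure_def by (rule nn_integral_density) auto
  also have "\<dots> = (\<integral>\<^sup>+p. \<integral>\<^sup>+u. indicator suspension (p, u) * g (p, u) \<partial>lborel \<partial>lborel)"
    by (rule nn_integral_lborel_pair) measurable
  also have "\<dots> = (\<integral>\<^sup>+p. (\<integral>\<^sup>+u. g (p, u) * indicator {0..<return_time p} u \<partial>lborel) * indicator bcz_domain p \<partial>lborel)"
    by (auto simp: suspension_def indicator_def mult.commute intro!: nn_integral_cong)
  finally show ?thesis .
qed

lemma nn_integral_shift: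
  fixes h :: "real \<Rightarrow> ennreal"
  assumes "h \<in> borel_measurable borel"
  shows "(\<integral>\<^sup>+u. h (u + c) \<partial>lborel) = (\<integral>\<^sup>+u. h u \<partial>lborel)"
  using nn_integral_real_affine[OF assms, of 1 c] by (simp add: add.commute)

lemma fibre_measurable:
  fixes g :: "(real \<times> real) \<times> real \<Rightarrow> ennreal"
  assumes "g \<in> borel_measurable borel"
  shows "(\<lambda>p. \<integral>\<^sup>+u. g (p, u) \<partial>lborel) \<in> borel_measurable borel"
proof -
  have "g \<in> borel_measurable (borel \<Otimes>\<^sub>M borel)"
    using assms by (simp only: borel_prod)
  then have [measurable]: "g \<in> borel_measurable (borel \<Otimes>\<^sub>M lborel)"
    by (subst measurable_cong_sets[OF sets_pair_measure_cong[OF refl sets_lborel] refl])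
  show ?thesis by measurable
qed

text \<open>Over \<open>p\<close>, all but the last unit of the fibre slides up onto
  \<open>{1..<return_time p}\<close>, and the last unit moves to \<open>{0..<1}\<close> over
  \<open>bcz_map p\<close>. Invariance of area under the map then turns \<open>I (bcz_map p)\<close>
  into \<open>I p\<close>, and \<open>J + I\<close> is the whole fibre.\<close>

lemma nn_integral_unit_flow:
  fixes g :: "(real \<times> real) \<times> real \<Rightarrow> ennreal"
  assumes [measurable]: "g \<in> borel_measurable borel"
  shows "(\<integral>\<^sup>+x. g (unit_flow x) \<partial>suspension_measure) = (\<integral>\<^sup>+x. g x \<partial>suspension_measure)"
proof -
  have [measurable]: "g \<in> borel_measurable (borel \<Otimes>\<^sub>M borel)"
    by (simp add: borel_prod)
  have [measurable]: "(\<lambda>u. g (p, u)) \<in> borel_measurable borel" for p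
    by measurable
  define I where "I = (\<lambda>p. \<integral>\<^sup>+u. g (p, u) * indicator {0..<1} u \<partial>lborel)"
  define J where "J = (\<lambda>p. \<integral>\<^sup>+u. g (p, u) * indicator {1..<return_time p} u \<partial>lborel)"
  have I [measurable]: "I \<in> borel_measurable borel"
    unfolding I_def using fibre_measurable[of "\<lambda>x. g x * indicator {0..<1} (snd x)"] by simp
  have meas: "(\<lambda>x. g x * indicator {1..<return_time (fst x)} (snd x)) \<in> borel_measurable borel"
  proof -
    have "(\<lambda>x. g x * (if 1 \<le> snd x \<and> snd x < return_time (fst x) then 1 else 0)) \<in> borel_measurable (borel \<Otimes>\<^sub>M borel)"
      by measurable
    moreover have "(\<lambda>x. g x * (if 1 \<le> snd x \<and> snd x < return_time (fst x) then 1 else 0)) =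
        (\<lambda>x. g x * indicator {1..<return_time (fst x)} (snd x))"
      by (auto simp: indicator_def)
    ultimately show ?thesis by (simp only: borel_prod)
  qed
  have J [measurable]: "J \<in> borel_measurable borel"
    unfolding J_def using fibre_measurable[OF meas] by simp
  have 1: "(\<integral>\<^sup>+u. g (unit_flow (p, u)) * indicator {0..<return_time p} u \<partial>lborel) = J p + I (bcz_map p)"
    if p: "p \<in> bcz_domain" for p
  proof -
    let ?r = "return_time p"
    have r: "1 \<le> ?r" using return_time_ge_1[OF p] .
    have "(\<integral>\<^sup>+u. g (unit_flow (p, u)) * indicator {0..<?r} u \<partial>lborel)
        = (\<integral>\<^sup>+u. g (p, u + 1) * indicator {1..<?r} (u + 1)
            + g (bcz_map p, u + (1 - ?r)) * indicator {0..<1} (u + (1 - ?r)) \<partial>lborel)"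
      using r by (intro nn_integral_cong) (auto simp: unit_flow_def indicator_def algebra_simps)
    also have "\<dots> = (\<integral>\<^sup>+u. g (p, u + 1) * indicator {1..<?r} (u + 1) \<partial>lborel)
        + (\<integral>\<^sup>+u. g (bcz_map p, u + (1 - ?r)) * indicator {0..<1} (u + (1 - ?r)) \<partial>lborel)"
      by (rule nn_integral_add) auto
    also have "(\<integral>\<^sup>+u. g (p, u + 1) * indicator {1..<?r} (u + 1) \<partial>lborel) = J p"
      unfolding J_def by (rule nn_integral_shift[where h = "\<lambda>u. g (p, u) * indicator {1..<?r} u"]) auto
    also have "(\<integral>\<^sup>+u. g (bcz_map p, u + (1 - ?r)) * indicator {0..<1} (u + (1 - ?r)) \<partial>lborel) = I (bcz_map p)"
      unfolding I_def by (rule nn_integral_shift[where h = "\<lambda>u. g (bcz_map p, u) * indicator {0..<1} u"]) auto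
    finally show ?thesis .
  qed
  have 2: "(\<integral>\<^sup>+u. g (p, u) * indicator {0..<return_time p} u \<partial>lborel) = J p + I p"
    if p: "p \<in> bcz_domain" for p
  proof -
    let ?r = "return_time p"
    have r: "1 \<le> ?r" using return_time_ge_1[OF p] .
    have "(\<integral>\<^sup>+u. g (p, u) * indicator {0..<?r} u \<partial>lborel)
        = (\<integral>\<^sup>+u. g (p, u) * indicator {1..<?r} u + g (p, u) * indicator {0..<1} u \<partial>lborel)"
      using r by (intro nn_integral_cong) (auto simp: indicator_def)
    also have "\<dots> = J p + I p"
      unfolding I_def J_def by (rule nn_integral_add) auto
    finally show ?thesis .
  qed
  have "(\<integral>\<^sup>+x. g (unit_flow x) \<partial>suspension_measure)
      = (\<integral>\<^sup>+p. J p * indicator bcz_domain p + I (bcz_map p) * indicator bcz_domain p \<partial>lborel)"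
  proof (subst nn_integral_suspension, measurable, rule nn_integral_cong)
    fix p
    show "(\<integral>\<^sup>+u. g (unit_flow (p, u)) * indicator {0..<return_time p} u \<partial>lborel) * indicator bcz_domain p
        = J p * indicator bcz_domain p + I (bcz_map p) * indicator bcz_domain p"
      by (cases "p \<in> bcz_domain") (simp_all add: 1)
  qed
  also have "\<dots> = (\<integral>\<^sup>+p. J p * indicator bcz_domain p \<partial>lborel) + (\<integral>\<^sup>+p. I (bcz_map p) * indicator bcz_domain p \<partial>lborel)"
    by (rule nn_integral_add) auto
  also have "\<dots> = (\<integral>\<^sup>+p. J p * indicator bcz_domain p \<partial>lborel) + (\<integral>\<^sup>+p. I p * indicator bcz_domain p \<partial>lborel)"
    by (simp add: nn_integral_bcz_map)
  also have "\<dots> = (\<integral>\<^sup>+p. J p * indicator bcz_domain p + I p * indicator bcz_domain p \<partial>lborel)"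
    by (rule nn_integral_add[symmetric]) auto
  also have "\<dots> = (\<integral>\<^sup>+x. g x \<partial>suspension_measure)"
  proof (subst nn_integral_suspension, measurable, rule nn_integral_cong)
    fix p
    show "J p * indicator bcz_domain p + I p * indicator bcz_domain p
        = (\<integral>\<^sup>+u. g (p, u) * indicator {0..<return_time p} u \<partial>lborel) * indicator bcz_domain p"
      by (cases "p \<in> bcz_domain") (simp_all add: 2)
  qed
  finally show ?thesis .
qed

lemma unit_flow_funpow_measurable [measurable]: "unit_flow ^^ n \<in> borel_measurable borel"
  by (induction n) (auto simp: id_def o_def)

lemma nn_integral_unit_flow_funpow:
  fixes g :: "(real \<times> real) \<times> real \<Rightarrow> ennreal"
  assumes [measurable]: "g \<in> borel_measurable borel"
  shows "(\<integral>\<^sup>+x. g ((unit_flow ^^ n) x) \<partial>suspension_measure) = (\<integral>\<^sup>+x. g x \<partial>suspension_measure)"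
proof (induction n)
  case (Suc n)
  have "(\<integral>\<^sup>+x. g ((unit_flow ^^ Suc n) x) \<partial>suspension_measure)
      = (\<integral>\<^sup>+x. g ((unit_flow ^^ n) (unit_flow x)) \<partial>suspension_measure)"
    by (simp add: funpow_swap1)
  also have "\<dots> = (\<integral>\<^sup>+x. g ((unit_flow ^^ n) x) \<partial>suspension_measure)"
    by (rule nn_integral_unit_flow[where g = "\<lambda>x. g ((unit_flow ^^ n) x)"]) measurable
  finally show ?case using Suc by simp
qed simp

lemma emeasure_unit_flow_funpow:
  assumes [measurable]: "B \<in> sets borel"
  shows "emeasure suspension_measure {x. (unit_flow ^^ n) x \<in> B} = emeasure suspension_measure B"
proof -
  have "{x. (unit_flow ^^ n) x \<in> B} \<in> sets suspension_measure"
    using measurable_sets[OF unit_flow_funpow_measurable, of B n] by (simp add: vimage_def)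
  then have "emeasure suspension_measure {x. (unit_flow ^^ n) x \<in> B}
      = (\<integral>\<^sup>+x. indicator {x. (unit_flow ^^ n) x \<in> B} x \<partial>suspension_measure)"
    by simp
  also have "\<dots> = (\<integral>\<^sup>+x. indicator B ((unit_flow ^^ n) x) \<partial>suspension_measure)"
    by (intro nn_integral_cong) (auto simp: indicator_def)
  finally show ?thesis
    by (simp add: nn_integral_unit_flow_funpow)
qed

text \<open>From \<open>s + t > 1\<close> comes \<open>1 / (s t) \<le> 1 / s + 1 / t\<close>, and
  the domain has width \<open>s\<close> over \<open>s\<close>, which cancels the pole. Finiteness
  later allows dominated convergence with a constant majorant.\<close>

lemma emeasure_suspension_finite: "emeasure suspension_measure UNIV < \<infinity>"
proof -
  have "emeasure suspension_measure UNIV = (\<integral>\<^sup>+x. 1 \<partial>suspension_measure)" by simp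
  also have "\<dots> = (\<integral>\<^sup>+p. ennreal (return_time p) * indicator bcz_domain p \<partial>lborel)"
  proof (subst nn_integral_suspension, simp, rule nn_integral_cong)
    fix p
    show "(\<integral>\<^sup>+u. 1 * indicator {0..<return_time p} u \<partial>lborel) * indicator bcz_domain p
        = ennreal (return_time p) * indicator bcz_domain p"
      using return_time_ge_1[of p] by (cases "p \<in> bcz_domain") simp_all
  qed
  also have "\<dots> \<le> (\<integral>\<^sup>+p. ennreal (1 / fst p) * indicator bcz_domain p + ennreal (1 / snd p) * indicator bcz_domain p \<partial>lborel)"
    by (intro nn_integral_mono)
      (auto simp: indicator_def return_time_def bcz_domain_iff field_simps ennreal_plus[symmetric] simp del: ennreal_plus intro!: ennreal_leI)
  also have "\<dots> = (\<integral>\<^sup>+p. ennreal (1 / fst p) * indicator bcz_domain p \<partial>lborel) + (\<integral>\<^sup>+p. ennreal (1 / snd p) * indicator bcz_domain p \<partial>lborel)"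
    by (rule nn_integral_add) (auto simp: borel_prod_eq)
  also have "(\<integral>\<^sup>+p. ennreal (1 / fst p) * indicator bcz_domain p \<partial>lborel)
     = (\<integral>\<^sup>+s. \<integral>\<^sup>+t. ennreal (1 / s) * indicator bcz_domain (s, t) \<partial>lborel \<partial>lborel)"
    by (subst nn_integral_lborel_pair) (auto simp: borel_prod_eq)
  also have "\<dots> = (\<integral>\<^sup>+s. indicator {0<..1::real} s \<partial>lborel)"
  proof (rule nn_integral_cong)
    fix s :: real
    have "(\<integral>\<^sup>+t. ennreal (1 / s) * indicator bcz_domain (s, t) \<partial>lborel)
       = (\<integral>\<^sup>+t. (ennreal (1 / s) * indicator {0<..1} s) * indicator {1 - s<..1} t \<partial>lborel)"
      by (intro nn_integral_cong) (auto simp: indicator_def bcz_domain_iff)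
    also have "\<dots> = indicator {0<..1} s"
      by (subst nn_integral_cmult_indicator) (auto simp: indicator_def ennreal_mult[symmetric])
    finally show "(\<integral>\<^sup>+t. ennreal (1 / s) * indicator bcz_domain (s, t) \<partial>lborel) = indicator {0<..1} s" .
  qed
  also have "(\<integral>\<^sup>+p. ennreal (1 / snd p) * indicator bcz_domain p \<partial>lborel)
     = (\<integral>\<^sup>+t. \<integral>\<^sup>+s. ennreal (1 / t) * indicator bcz_domain (s, t) \<partial>lborel \<partial>lborel)"
    by (subst nn_integral_lborel_pair_swap) (auto simp: borel_prod_eq)
  also have "\<dots> = (\<integral>\<^sup>+t. indicator {0<..1::real} t \<partial>lborel)"
  proof (rule nn_integral_cong)
    fix t :: real
    have "(\<integral>\<^sup>+s. ennreal (1 / t) * indicator bcz_domain (s, t) \<partial>lborel)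
       = (\<integral>\<^sup>+s. (ennreal (1 / t) * indicator {0<..1} t) * indicator {1 - t<..1} s \<partial>lborel)"
      by (intro nn_integral_cong) (auto simp: indicator_def bcz_domain_iff)
    also have "\<dots> = indicator {0<..1} t"
      by (subst nn_integral_cmult_indicator) (auto simp: indicator_def ennreal_mult[symmetric])
    finally show "(\<integral>\<^sup>+s. ennreal (1 / t) * indicator bcz_domain (s, t) \<partial>lborel) = indicator {0<..1} t" .
  qed
  also have "(\<integral>\<^sup>+s. indicator {0<..1::real} s \<partial>lborel) + (\<integral>\<^sup>+t. indicator {0<..1::real} t \<partial>lborel) < (\<infinity> :: ennreal)"
    by simp
  finally show ?thesis .
qed

lemma finite_measure_suspension: "finite_measure suspension_measure"
  using emeasure_suspension_finite by (intro finite_measureI) auto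

lemma AE_suspension:
  "(AE x in suspension_measure. P x) \<longleftrightarrow> (AE x in lborel. x \<in> suspension \<longrightarrow> P x)"
  unfolding suspension_measure_def by (subst AE_density) (auto simp: indicator_def)

section \<open>Integer unimodular matrices and their relation to the flow\<close>

definition sl2_act :: "int \<Rightarrow> int \<Rightarrow> int \<Rightarrow> int \<Rightarrow> real \<times> real \<Rightarrow> real \<times> real" where
  "sl2_act a b c d p = (of_int a * fst p + of_int b * snd p, of_int c * fst p + of_int d * snd p)"

lemma sl2_act_sl2_act:
  "sl2_act a' b' c' d' (sl2_act a b c d p) =
   sl2_act (a' * a + b' * c) (a' * b + b' * d) (c' * a + d' * c) (c' * b + d' * d) p"
  by (simp add: sl2_act_def algebra_simps)

lemma sl2_det_mult:
  fixes a b c d a' b' c' d' :: int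
  assumes "a * d - b * c = 1" "a' * d' - b' * c' = 1"
  shows "(a' * a + b' * c) * (c' * b + d' * d) - (a' * b + b' * d) * (c' * a + d' * c) = 1"
  using assms by algebra

lemma sl2_act_measurable [measurable]: "sl2_act a b c d \<in> borel_measurable borel"
proof -
  have "sl2_act a b c d \<in> (borel \<Otimes>\<^sub>M borel) \<rightarrow>\<^sub>M (borel \<Otimes>\<^sub>M borel)"
    unfolding sl2_act_def by measurable
  then show ?thesis by (simp only: borel_prod)
qed

text \<open>The vectors \<open>fst x\<close> and \<open>transversal x\<close> are the abscissae and ordinates of a basis of a unimodular
  lattice. The time-\<open>n\<close> flow shears this lattice, subtracting \<open>n\<close> times the first vector from the second, and
  then changes the basis by an element of \<open>SL(2,\<int>)\<close>.\<close>

lemma unit_flow_funpow_matrix: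
  assumes "x \<in> suspension"
  obtains a b c d :: int where "a * d - b * c = 1"
    "\<And>k l. sl2_act a b c d (k *\<^sub>R fst x + l *\<^sub>R (transversal x - real n *\<^sub>R fst x))
      = k *\<^sub>R fst ((unit_flow ^^ n) x) + l *\<^sub>R transversal ((unit_flow ^^ n) x)"
proof -
  have "\<exists>a b c d :: int. a * d - b * c = 1 \<and>
    (\<forall>k l. sl2_act a b c d (k *\<^sub>R fst x + l *\<^sub>R (transversal x - real n *\<^sub>R fst x))
      = k *\<^sub>R fst ((unit_flow ^^ n) x) + l *\<^sub>R transversal ((unit_flow ^^ n) x))"
  proof (induction n)
    case 0
    show ?case
      by (rule exI[of _ 1], rule exI[of _ 0], rule exI[of _ 0], rule exI[of _ 1])
        (auto simp: sl2_act_def prod_eq_iff)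
  next
    case (Suc n)
    define y where "y = (unit_flow ^^ n) x"
    obtain a b c d :: int where det: "a * d - b * c = 1" and
      *: "\<And>k l. sl2_act a b c d (k *\<^sub>R fst x + l *\<^sub>R (transversal x - real n *\<^sub>R fst x))
            = k *\<^sub>R fst y + l *\<^sub>R transversal y"
      using Suc unfolding y_def by blast
    have y: "y \<in> suspension"
      unfolding y_def using assms by (induction n) (auto simp: unit_flow_in)
    obtain s t u where yeq: "y = ((s, t), u)" by (metis prod.collapse)
    have st: "s > 0" "t > 0" using y by (auto simp: yeq suspension_def bcz_domain_iff)
    have "\<exists>a' b' c' d' :: int. a' * d' - b' * c' = 1 \<and>
      (\<forall>k l. sl2_act a' b' c' d' (k *\<^sub>R fst y + l *\<^sub>R (transversal y - fst y))
         = k *\<^sub>R fst (unit_flow y) + l *\<^sub>R transversal (unit_flow y))"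
    proof (cases "u + 1 < return_time (s, t)")
      case True
      show ?thesis
        by (rule exI[of _ 1], rule exI[of _ 0], rule exI[of _ 0], rule exI[of _ 1])
          (use True in \<open>auto simp: sl2_act_def prod_eq_iff yeq unit_flow_def transversal_def algebra_simps\<close>)
    next
      case False
      \<comment> \<open>Crossing the section is the change of basis by the matrix of
        \<open>bcz_map\<close>; the ordinates fit because the height drops by exactly
        \<open>1 / (s * t)\<close>.\<close>
      show ?thesis
        by (rule exI[of _ 0], rule exI[of _ 1], rule exI[of _ "-1"], rule exI[of _ "\<lfloor>(1 + s) / t\<rfloor>"])
          (use False st in \<open>auto simp: sl2_act_def prod_eq_iff yeq unit_flow_def transversal_def bcz_map_eq return_time_def field_simps\<close>)
    qed
    then obtain a' b' c' d' :: int where det': "a' * d' - b' * c' = 1" and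
      **: "\<And>k l. sl2_act a' b' c' d' (k *\<^sub>R fst y + l *\<^sub>R (transversal y - fst y))
         = k *\<^sub>R fst (unit_flow y) + l *\<^sub>R transversal (unit_flow y)"
      by blast
    show ?case
    proof (intro exI conjI allI)
      show "(a' * a + b' * c) * (c' * b + d' * d) - (a' * b + b' * d) * (c' * a + d' * c) = 1"
        using det det' by (rule sl2_det_mult)
      fix k l :: real
      \<comment> \<open>One more unit of shear replaces the coefficient \<open>k\<close> by
        \<open>k - l\<close>. This is why the claim is made for all linear combinations and not just
        for the two basis vectors.\<close>
      have v: "k *\<^sub>R fst x + l *\<^sub>R (transversal x - real (Suc n) *\<^sub>R fst x)
          = (k - l) *\<^sub>R fst x + l *\<^sub>R (transversal x - real n *\<^sub>R fst x)"
        by (simp add: algebra_simps)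
      have w: "(k - l) *\<^sub>R fst y + l *\<^sub>R transversal y = k *\<^sub>R fst y + l *\<^sub>R (transversal y - fst y)"
        by (simp add: algebra_simps)
      show "sl2_act (a' * a + b' * c) (a' * b + b' * d) (c' * a + d' * c) (c' * b + d' * d)
          (k *\<^sub>R fst x + l *\<^sub>R (transversal x - real (Suc n) *\<^sub>R fst x))
        = k *\<^sub>R fst ((unit_flow ^^ Suc n) x) + l *\<^sub>R transversal ((unit_flow ^^ Suc n) x)"
        unfolding v sl2_act_sl2_act[symmetric] * w ** by (simp add: y_def)
    qed
  qed
  then show ?thesis using that by blast
qed

text \<open>Every fibre has length at least 1, so a non-null set of base points would carry positive
  mass in the suspension.\<close>

lemma AE_suspension_fst:
  assumes AE: "AE x in suspension_measure. P (fst x)" and [measurable]: "Measurable.pred borel P"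
  shows "AE p in lborel. p \<in> bcz_domain \<longrightarrow> P p"
proof -
  define g :: "(real \<times> real) \<times> real \<Rightarrow> ennreal" where "g = (\<lambda>x. if P (fst x) then 0 else 1)"
  define G :: "real \<times> real \<Rightarrow> ennreal" where "G = (\<lambda>p. (if P p then 0 else ennreal (return_time p)) * indicator bcz_domain p)"
  have "g \<in> borel_measurable (borel \<Otimes>\<^sub>M borel)" unfolding g_def by measurable
  then have [measurable]: "g \<in> borel_measurable borel" by (simp only: borel_prod)
  have [measurable]: "G \<in> borel_measurable borel" unfolding G_def by measurable
  have "(\<integral>\<^sup>+p. G p \<partial>lborel) = (\<integral>\<^sup>+x. g x \<partial>suspension_measure)"
  proof (subst nn_integral_suspension, measurable, rule nn_integral_cong)
    fix p
    show "G p = (\<integral>\<^sup>+u. g (p, u) * indicator {0..<return_time p} u \<partial>lborel) * indicator bcz_domain p"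
      using return_time_ge_1[of p] by (cases "p \<in> bcz_domain") (simp_all add: G_def g_def)
  qed
  also have "\<dots> = 0"
    using AE by (subst nn_integral_0_iff_AE, measurable) (auto simp: g_def)
  finally have "AE p in lborel. G p = 0"
    by (subst (asm) nn_integral_0_iff_AE) auto
  then show ?thesis
  proof eventually_elim
    case (elim p)
    show ?case
    proof (intro impI)
      assume "p \<in> bcz_domain"
      then show "P p" using elim return_time_ge_1[of p] by (auto simp: G_def split: if_splits)
    qed
  qed
qed

section \<open>Continuity of translation in measure\<close>

text \<open>Continuity of translation in \<open>L\<^sup>1\<close>, for perturbations \<open>g n\<close> of \<open>g\<^sub>0\<close> that push \<open>M\<close> to measures of
  bounded density.\<close>

lemma (in finite_measure) perturbation_null:
  fixes g :: "nat \<Rightarrow> 'a \<Rightarrow> 'b::euclidean_space"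
  assumes [measurable]: "\<And>n. g n \<in> borel_measurable M" "g\<^sub>0 \<in> borel_measurable M" "A \<in> sets borel"
    and lim: "\<And>x. x \<in> space M \<Longrightarrow> (\<lambda>n. g n x) \<longlonglongrightarrow> g\<^sub>0 x"
    and dens: "\<forall>\<^sub>F n in sequentially. \<forall>E\<in>sets borel. emeasure M {x \<in> space M. g n x \<in> E} \<le> ennreal C * emeasure lborel E"
  shows "(\<lambda>n. emeasure M {x \<in> space M. g\<^sub>0 x \<in> A \<and> g n x \<notin> A}) \<longlonglongrightarrow> 0"
proof (rule order_tendstoI)
  fix e :: ennreal assume "0 < e"
  then obtain r :: real where r: "0 < r" "ennreal (2 * r) < e"
  proof -
    obtain r where "0 < r" "ennreal r < e" using ennreal_real_between_0[OF \<open>0 < e\<close>] .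
    then show ?thesis using that[of "r / 2"] by simp
  qed
  define C' where "C' = max C 1"
  have C': "C \<le> C'" "1 \<le> C'" by (auto simp: C'_def)
  \<comment> \<open>For an open set pointwise convergence is enough: a point with limit in
    \<open>U\<close> is eventually mapped into \<open>U\<close>. What remains is that
    \<open>g n\<close> hits \<open>U - A\<close>, which the density bound makes unlikely.\<close>
  obtain U where U: "open U" "A \<subseteq> U" "emeasure lebesgue (U - A) < ennreal (r / C')"
  proof -
    have "A \<in> sets lebesgue" "0 < r / C'" using r C' by simp_all
    from sets_lebesgue_outer_open[OF this] show ?thesis using that by blast
  qed
  have [measurable]: "U \<in> sets borel" using U by simp
  have "(\<lambda>n. \<integral>\<^sup>+x. indicator {x \<in> space M. g\<^sub>0 x \<in> U \<and> g n x \<notin> U} x \<partial>M) \<longlonglongrightarrow> (\<integral>\<^sup>+x. 0 \<partial>M)"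
  proof (rule nn_integral_dominated_convergence[where w = "\<lambda>_. 1"])
    show "AE x in M. (\<lambda>n. indicator {x \<in> space M. g\<^sub>0 x \<in> U \<and> g n x \<notin> U} x) \<longlonglongrightarrow> (0 :: ennreal)"
    proof (rule AE_I2)
      fix x assume x: "x \<in> space M"
      show "(\<lambda>n. indicator {x \<in> space M. g\<^sub>0 x \<in> U \<and> g n x \<notin> U} x) \<longlonglongrightarrow> (0 :: ennreal)"
      proof (cases "g\<^sub>0 x \<in> U")
        case True
        then have "\<forall>\<^sub>F n in sequentially. g n x \<in> U"
          using lim[OF x] U(1) by (simp add: topological_tendstoD)
        then show ?thesis by (intro tendsto_eventually) (auto elim: eventually_mono)
      qed simp
    qed
  qed (auto simp: indicator_def emeasure_eq_measure)
  then have "(\<lambda>n. emeasure M {x \<in> space M. g\<^sub>0 x \<in> U \<and> g n x \<notin> U}) \<longlonglongrightarrow> 0" by simp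
  then have "\<forall>\<^sub>F n in sequentially. emeasure M {x \<in> space M. g\<^sub>0 x \<in> U \<and> g n x \<notin> U} < ennreal r"
    using r by (intro order_tendstoD) auto
  with dens show "\<forall>\<^sub>F n in sequentially. emeasure M {x \<in> space M. g\<^sub>0 x \<in> A \<and> g n x \<notin> A} < e"
  proof eventually_elim
    case (elim n)
    have "emeasure M {x \<in> space M. g\<^sub>0 x \<in> A \<and> g n x \<notin> A}
      \<le> emeasure M ({x \<in> space M. g\<^sub>0 x \<in> U \<and> g n x \<notin> U} \<union> {x \<in> space M. g n x \<in> U - A})"
      using U(2) by (intro emeasure_mono) auto
    also have "\<dots> \<le> emeasure M {x \<in> space M. g\<^sub>0 x \<in> U \<and> g n x \<notin> U} + emeasure M {x \<in> space M. g n x \<in> U - A}"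
      by (rule emeasure_subadditive) auto
    also have "emeasure M {x \<in> space M. g n x \<in> U - A} \<le> ennreal C * emeasure lborel (U - A)"
      by (rule bspec[OF elim(1)]) simp
    also have "\<dots> \<le> ennreal C' * ennreal (r / C')"
      using C' U(3) by (intro mult_mono ennreal_leI) auto
    also have "\<dots> = ennreal r" using C' r by (simp add: ennreal_mult[symmetric])
    also have "emeasure M {x \<in> space M. g\<^sub>0 x \<in> U \<and> g n x \<notin> U} + ennreal r \<le> ennreal r + ennreal r"
      using elim by (intro add_right_mono) auto
    also have "\<dots> = ennreal (2 * r)" using r by (simp add: ennreal_plus[symmetric] del: ennreal_plus)
    finally show ?case using r(2) by (simp add: add_left_mono)
  qed
qed simp

text \<open>The derivative is triangular with determinant \<open>k\<^sup>2\<close>: substitution in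
  \<open>t\<close> and then in \<open>s\<close> gives one factor \<open>k\<close> each. At a fixed
  height \<open>u\<close>, the vector \<open>k *\<^sub>R p + c *\<^sub>R transversal (p, u)\<close>
  has this shape with scale \<open>k - c * u\<close>.\<close>

lemma nn_integral_sheared_le:
  fixes E :: "(real \<times> real) set"
  assumes [measurable]: "E \<in> sets borel" and k: "0 < k\<^sub>0" "k\<^sub>0 \<le> k"
  shows "(\<integral>\<^sup>+p. indicator E (k * fst p, k * snd p + c / fst p) \<partial>lborel) \<le> ennreal (1 / k\<^sub>0\<^sup>2) * emeasure lborel E"
proof -
  have [measurable]: "E \<in> sets (borel \<Otimes>\<^sub>M borel)" using assms(1) by (simp only: borel_prod)
  have k': "0 < k" using k by simp
  have m: "(\<lambda>p. indicator E (k * fst p, k * snd p + c / fst p) :: ennreal) \<in> borel_measurable (borel \<Otimes>\<^sub>M borel)"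
    by measurable
  then have [measurable]: "(\<lambda>p. indicator E (k * fst p, k * snd p + c / fst p) :: ennreal) \<in> borel_measurable borel"
    by (simp only: borel_prod)
  have "ennreal k * (ennreal k * (\<integral>\<^sup>+p. indicator E (k * fst p, k * snd p + c / fst p) \<partial>lborel))
     = ennreal k * (\<integral>\<^sup>+s. ennreal k * (\<integral>\<^sup>+t. indicator E (k * s, k * t + c / s) \<partial>lborel) \<partial>lborel)"
    by (subst nn_integral_lborel_pair, measurable, subst nn_integral_cmult) auto
  also have "\<dots> = ennreal k * (\<integral>\<^sup>+s. \<integral>\<^sup>+t. indicator E (k * s, t) \<partial>lborel \<partial>lborel)"
  proof (intro arg_cong2[where f = "(*)"] refl nn_integral_cong)
    fix s :: real
    show "ennreal k * (\<integral>\<^sup>+t. indicator E (k * s, k * t + c / s) \<partial>lborel) = (\<integral>\<^sup>+t. indicator E (k * s, t) \<partial>lborel)"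
      using k' nn_integral_real_affine[of "\<lambda>t. indicator E (k * s, t)" k "c / s"] by (simp add: add.commute)
  qed
  also have "\<dots> = (\<integral>\<^sup>+s. \<integral>\<^sup>+t. indicator E (s, t) \<partial>lborel \<partial>lborel)"
    using k' nn_integral_real_affine[of "\<lambda>s. \<integral>\<^sup>+t. indicator E (s, t) \<partial>lborel" k 0] by simp
  also have "\<dots> = emeasure lborel E"
    by (subst nn_integral_lborel_pair[symmetric]) auto
  finally have eq: "ennreal (k * k) * (\<integral>\<^sup>+p. indicator E (k * fst p, k * snd p + c / fst p) \<partial>lborel) = emeasure lborel E"
    (is "_ * ?I = _") using k' by (simp add: ennreal_mult mult.assoc)
  have "?I = ennreal (1 / k\<^sub>0\<^sup>2) * (ennreal (k\<^sub>0\<^sup>2) * ?I)"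
    using k by (simp add: mult.assoc[symmetric] ennreal_mult[symmetric])
  also have "\<dots> \<le> ennreal (1 / k\<^sub>0\<^sup>2) * (ennreal (k * k) * ?I)"
    using k by (intro mult_left_mono mult_right_mono ennreal_leI) (auto simp: power2_eq_square intro: mult_mono)
  finally show ?thesis unfolding eq .
qed

text \<open>\<open>transversal\<close> is unbounded, since both \<open>1 / s\<close> and the height
  are. On the boxes \<open>K m\<close> the height is at most \<open>M\<close>, so the perturbed
  scale stays away from 0 and the images have bounded density; the boxes exhaust the suspension up
  to small measure.\<close>

lemma suspension_perturbation_null:
  fixes A :: "(real \<times> real) set"
  assumes A [measurable]: "A \<in> sets borel" and \<kappa>: "k \<longlonglongrightarrow> \<kappa>" "0 < \<kappa>" and c: "c \<longlonglongrightarrow> 0"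
  shows "(\<lambda>n. emeasure suspension_measure {x. \<kappa> *\<^sub>R fst x \<in> A \<and> k n *\<^sub>R fst x + c n *\<^sub>R transversal x \<notin> A}) \<longlonglongrightarrow> 0"
    (is "(\<lambda>n. emeasure _ (?S n)) \<longlonglongrightarrow> 0")
proof -
  define K :: "nat \<Rightarrow> ((real \<times> real) \<times> real) set" where
    "K = (\<lambda>m. cbox ((1 / real (Suc m), 1 / real (Suc m)), 0) ((1, 1), (real (Suc m))\<^sup>2))"
  have K_iff: "((s, t), u) \<in> K m \<longleftrightarrow> 1 / real (Suc m) \<le> s \<and> s \<le> 1 \<and> 1 / real (Suc m) \<le> t \<and> t \<le> 1 \<and> 0 \<le> u \<and> u \<le> (real (Suc m))\<^sup>2" for s t u m
    by (auto simp: K_def cbox_Pair_eq)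
  have [measurable]: "K m \<in> sets borel" for m by (simp add: K_def)
  have [measurable]: "?S n \<in> sets borel" for n
  proof -
    have "{x \<in> space (borel :: ((real \<times> real) \<times> real) measure). \<kappa> *\<^sub>R fst x \<in> A \<and> k n *\<^sub>R fst x + c n *\<^sub>R transversal x \<notin> A} \<in> sets borel"
      by measurable
    then show ?thesis by simp
  qed
  interpret S: finite_measure suspension_measure by (rule finite_measure_suspension)
  have K0: "(\<lambda>m. emeasure suspension_measure (- K m)) \<longlonglongrightarrow> 0"
  proof -
    have "(\<lambda>m. \<integral>\<^sup>+x. indicator (- K m) x \<partial>suspension_measure) \<longlonglongrightarrow> (\<integral>\<^sup>+x. 0 \<partial>suspension_measure)"
    proof (rule nn_integral_dominated_convergence[where w = "\<lambda>_. 1"])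
      show "AE x in suspension_measure. (\<lambda>m. indicator (- K m) x) \<longlonglongrightarrow> (0 :: ennreal)"
        unfolding AE_suspension
      proof (intro AE_I2 impI)
        fix x :: "(real \<times> real) \<times> real" assume x: "x \<in> suspension"
        obtain s t u where xe: "x = ((s, t), u)" by (metis prod.collapse)
        have st: "0 < s" "s \<le> 1" "0 < t" "t \<le> 1" "0 \<le> u" "u < 1 / (s * t)"
          using x by (auto simp: xe suspension_def bcz_domain_iff return_time_def)
        obtain m\<^sub>0 :: nat where m0: "max (1 / s) (1 / t) < real m\<^sub>0" by (meson reals_Archimedean2)
        have "x \<in> K m" if "m\<^sub>0 \<le> m" for m
        proof -
          have M: "1 / s \<le> real (Suc m)" "1 / t \<le> real (Suc m)" using m0 that by auto
          then have "1 / s * (1 / t) \<le> real (Suc m) * real (Suc m)" using st by (intro mult_mono) auto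
          then have "u \<le> (real (Suc m))\<^sup>2" using st by (simp add: power2_eq_square)
          moreover have "1 / real (Suc m) \<le> s" "1 / real (Suc m) \<le> t"
            using M st by (simp_all add: field_simps)
          ultimately show ?thesis using st by (simp add: xe K_iff)
        qed
        then have "\<forall>\<^sub>F m in sequentially. indicator (- K m) x = (0 :: ennreal)"
          unfolding eventually_sequentially by (intro exI[of _ m\<^sub>0]) auto
        then show "(\<lambda>m. indicator (- K m) x) \<longlonglongrightarrow> (0 :: ennreal)" by (rule tendsto_eventually)
      qed
    qed (auto simp: S.emeasure_eq_measure indicator_def)
    then show ?thesis by simp
  qed
  define N where "N = (\<lambda>m. density lborel (indicator (K m)))"
  have N_sets [measurable_cong, simp]: "sets (N m) = sets borel" and N_space [simp]: "space (N m) = UNIV" for m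
    by (auto simp: N_def)
  have N_em: "emeasure (N m) E = emeasure lborel (K m \<inter> E)" if [measurable]: "E \<in> sets borel" for m E
    unfolding N_def by (subst emeasure_density) (auto simp: indicator_inter_arith[symmetric])
  have Nlim: "(\<lambda>n. emeasure (N m) (?S n)) \<longlonglongrightarrow> 0" for m
  proof -
    interpret N: finite_measure "N m"
      by (rule finite_measureI) (use emeasure_lborel_cbox_finite less_imp_neq in \<open>fastforce simp: N_em K_def\<close>)
    define M where "M = (real (Suc m))\<^sup>2"
    have M: "1 \<le> M" by (simp add: M_def)
    \<comment> \<open>The thresholds ensure \<open>k n - c n * u \<ge> 3 * \<kappa> / 4 - \<kappa> /
      4 = \<kappa> / 2\<close> for all heights \<open>u\<close> in \<open>{0..M}\<close>.\<close>
    have ev1: "\<forall>\<^sub>F n in sequentially. 3 * \<kappa> / 4 < k n" using \<kappa> by (intro order_tendstoD) auto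
    have ev2: "\<forall>\<^sub>F n in sequentially. \<bar>c n\<bar> < \<kappa> / (4 * M)"
      using tendsto_rabs[OF c] M \<kappa> by (intro order_tendstoD[of _ "\<bar>0\<bar>"]) auto
    have "\<forall>\<^sub>F n in sequentially. \<forall>E\<in>sets borel.
        emeasure (N m) {x \<in> space (N m). k n *\<^sub>R fst x + c n *\<^sub>R transversal x \<in> E} \<le> ennreal (M * (1 / (\<kappa> / 2)\<^sup>2)) * emeasure lborel E"
      using ev1 ev2
    proof eventually_elim
      case (elim n)
      show ?case
      proof
        fix E :: "(real \<times> real) set" assume [measurable]: "E \<in> sets borel"
        let ?g = "\<lambda>x. k n *\<^sub>R fst x + c n *\<^sub>R transversal x"
        have [measurable]: "{x. ?g x \<in> E} \<in> sets borel"
        proof -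
          have "{x \<in> space (borel :: ((real \<times> real) \<times> real) measure). ?g x \<in> E} \<in> sets borel" by measurable
          then show ?thesis by simp
        qed
        have ge: "?g ((s, t), u) = ((k n - c n * u) * s, (k n - c n * u) * t + c n / s)" for s t u
          by (simp add: transversal_def algebra_simps)
        have "emeasure (N m) {x \<in> space (N m). ?g x \<in> E} = (\<integral>\<^sup>+x. indicator (K m) x * indicator E (?g x) \<partial>lborel)"
        proof -
          have "emeasure (N m) {x \<in> space (N m). ?g x \<in> E} = emeasure lborel (K m \<inter> {x. ?g x \<in> E})"
            by (simp add: N_em)
          also have "\<dots> = (\<integral>\<^sup>+x. indicator (K m \<inter> {x. ?g x \<in> E}) x \<partial>lborel)" by simp
          also have "\<dots> = (\<integral>\<^sup>+x. indicator (K m) x * indicator E (?g x) \<partial>lborel)"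
            by (intro nn_integral_cong) (auto simp: indicator_def)
          finally show ?thesis .
        qed
        also have "\<dots> = (\<integral>\<^sup>+u. \<integral>\<^sup>+p. indicator (K m) (p, u) * indicator E (?g (p, u)) \<partial>lborel \<partial>lborel)"
          by (rule nn_integral_lborel_pair_swap) measurable
        also have "\<dots> \<le> (\<integral>\<^sup>+u. ennreal (1 / (\<kappa> / 2)\<^sup>2) * emeasure lborel E * indicator {0..M} u \<partial>lborel)"
        proof (rule nn_integral_mono)
          fix u :: real
          show "(\<integral>\<^sup>+p. indicator (K m) (p, u) * indicator E (?g (p, u)) \<partial>lborel)
            \<le> ennreal (1 / (\<kappa> / 2)\<^sup>2) * emeasure lborel E * indicator {0..M} u"
          proof (cases "u \<in> {0..M}")
            case True
            have "\<bar>c n * u\<bar> = \<bar>c n\<bar> * u" using True by (simp add: abs_mult)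
            also have "\<dots> \<le> \<kappa> / (4 * M) * M"
              using True elim(2) M \<kappa>(2) by (intro mult_mono) (auto simp: less_imp_le)
            also have "\<dots> = \<kappa> / 4" using M by simp
            finally have kk: "\<kappa> / 2 \<le> k n - c n * u" using elim by linarith
            have "(\<integral>\<^sup>+p. indicator (K m) (p, u) * indicator E (?g (p, u)) \<partial>lborel)
              \<le> (\<integral>\<^sup>+p. indicator E ((k n - c n * u) * fst p, (k n - c n * u) * snd p + c n / fst p) \<partial>lborel)"
            proof (rule nn_integral_mono)
              fix p :: "real \<times> real"
              have "?g (p, u) = ((k n - c n * u) * fst p, (k n - c n * u) * snd p + c n / fst p)"
                using ge[of "fst p" "snd p" u] by (simp only: prod.collapse)
              then show "indicator (K m) (p, u) * indicator E (?g (p, u))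
                \<le> (indicator E ((k n - c n * u) * fst p, (k n - c n * u) * snd p + c n / fst p) :: ennreal)"
                by (simp only:) (auto simp: indicator_def)
            qed
            also have "\<dots> \<le> ennreal (1 / (\<kappa> / 2)\<^sup>2) * emeasure lborel E"
              using kk \<kappa> by (intro nn_integral_sheared_le) auto
            finally show ?thesis using True by simp
          next
            case False
            then have "(p, u) \<notin> K m" for p by (cases p) (auto simp: K_iff M_def)
            then show ?thesis using False by simp
          qed
        qed
        also have "\<dots> = ennreal (1 / (\<kappa> / 2)\<^sup>2) * emeasure lborel E * emeasure lborel {0..M}"
          by (rule nn_integral_cmult_indicator) simp
        also have "\<dots> = ennreal (M * (1 / (\<kappa> / 2)\<^sup>2)) * emeasure lborel E"
        proof -
          have "ennreal (M * (1 / (\<kappa> / 2)\<^sup>2)) = ennreal M * ennreal (1 / (\<kappa> / 2)\<^sup>2)"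
            using M by (intro ennreal_mult) auto
          then show ?thesis using M by (simp add: mult_ac)
        qed
        finally show "emeasure (N m) {x \<in> space (N m). ?g x \<in> E} \<le> ennreal (M * (1 / (\<kappa> / 2)\<^sup>2)) * emeasure lborel E" .
      qed
    qed
    moreover have "(\<lambda>n. k n *\<^sub>R fst x + c n *\<^sub>R transversal x) \<longlonglongrightarrow> \<kappa> *\<^sub>R fst x" for x
    proof -
      have "(\<lambda>n. k n *\<^sub>R fst x + c n *\<^sub>R transversal x) \<longlonglongrightarrow> \<kappa> *\<^sub>R fst x + 0 *\<^sub>R transversal x"
        by (intro tendsto_intros \<kappa> c)
      then show ?thesis by simp
    qed
    ultimately have "(\<lambda>n. emeasure (N m) {x \<in> space (N m). \<kappa> *\<^sub>R fst x \<in> A \<and> k n *\<^sub>R fst x + c n *\<^sub>R transversal x \<notin> A}) \<longlonglongrightarrow> 0"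
      by (intro N.perturbation_null) auto
    then show ?thesis by simp
  qed
  show ?thesis
  proof (rule order_tendstoI)
    fix e :: ennreal assume "0 < e"
    obtain e1 e2 where e12: "0 < e1" "0 < e2" "e1 + e2 < e"
    proof -
      obtain r where "0 < r" "ennreal r < e" using ennreal_real_between_0[OF \<open>0 < e\<close>] .
      then show ?thesis
        using that[of "ennreal (r / 2)" "ennreal (r / 2)"] by (simp add: ennreal_plus[symmetric] del: ennreal_plus)
    qed
    obtain m where m: "emeasure suspension_measure (- K m) < e1"
      using order_tendstoD(2)[OF K0 e12(1)] by (auto simp: eventually_sequentially)
    have "\<forall>\<^sub>F n in sequentially. emeasure (N m) (?S n) < e2" using Nlim e12 by (intro order_tendstoD)
    then show "\<forall>\<^sub>F n in sequentially. emeasure suspension_measure (?S n) < e"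
    proof eventually_elim
      case (elim n)
      have "emeasure suspension_measure (?S n) \<le> emeasure suspension_measure (- K m \<union> (K m \<inter> ?S n))"
        by (intro emeasure_mono) auto
      also have "\<dots> \<le> emeasure suspension_measure (- K m) + emeasure suspension_measure (K m \<inter> ?S n)"
        by (intro emeasure_subadditive) auto
      also have "emeasure suspension_measure (K m \<inter> ?S n) \<le> emeasure (N m) (?S n)"
        unfolding suspension_measure_def N_em[OF \<open>?S n \<in> sets borel\<close>]
        by (subst emeasure_density)
          (auto simp: nn_integral_indicator[symmetric] indicator_def simp del: nn_integral_indicator intro!: nn_integral_mono)
      also have "emeasure suspension_measure (- K m) + emeasure (N m) (?S n) \<le> e1 + e2"
        using m elim by (intro add_mono) auto
      finally show ?case using e12 by (simp add: add_left_mono)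
    qed
  qed simp
qed

lemma Collect_measurable_borel: "Measurable.pred borel P \<Longrightarrow> Collect P \<in> sets borel"
  by (simp add: pred_def)

text \<open>The unit disc is covered by finitely many balls of radius \<open>e / 2\<close>. If the
  two values of \<open>f\<close> differ by at least \<open>e\<close>, the ball around the
  unperturbed value misses the perturbed one, so the statement for sets applies to the preimages of
  the balls.\<close>

lemma suspension_perturbation_fun_null:
  fixes f :: "real \<times> real \<Rightarrow> complex"
  assumes f [measurable]: "f \<in> borel_measurable borel" and bd: "\<And>p. cmod (f p) \<le> 1"
    and \<kappa>: "k \<longlonglongrightarrow> \<kappa>" "0 < \<kappa>" and c: "c \<longlonglongrightarrow> 0" and e: "0 < e"
  shows "(\<lambda>n. emeasure suspension_measure
    {x. e \<le> cmod (f (k n *\<^sub>R fst x + c n *\<^sub>R transversal x) - f (\<kappa> *\<^sub>R fst x))}) \<longlonglongrightarrow> 0"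
proof -
  obtain T :: "complex set" where T: "finite T" "cball 0 1 \<subseteq> (\<Union>z\<in>T. ball z (e / 2))"
  proof -
    have "\<forall>e>0. \<exists>T. finite T \<and> cball (0::complex) 1 \<subseteq> (\<Union>z\<in>T. ball z e)"
      using compact_eq_totally_bounded[of "cball (0::complex) 1"] by (simp add: compact_cball)
    moreover have "0 < e / 2" using e by simp
    ultimately obtain T where "finite T" "cball (0::complex) 1 \<subseteq> (\<Union>z\<in>T. ball z (e / 2))" by metis
    then show ?thesis by (rule that)
  qed
  define S where "S = (\<lambda>z n. {x. \<kappa> *\<^sub>R fst x \<in> f -` ball z (e / 2) \<and> k n *\<^sub>R fst x + c n *\<^sub>R transversal x \<notin> f -` ball z (e / 2)})"
  have A [measurable]: "f -` ball z r \<in> sets borel" for z r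
    using measurable_sets[OF f, of "ball z r"] by simp
  have [measurable]: "S z n \<in> sets borel" for z n
    unfolding S_def by (rule Collect_measurable_borel) measurable
  have "(\<lambda>n. \<Sum>z\<in>T. emeasure suspension_measure (S z n)) \<longlonglongrightarrow> (\<Sum>z\<in>T. 0)"
    unfolding S_def by (intro tendsto_sum suspension_perturbation_null A \<kappa> c)
  then have lim: "(\<lambda>n. \<Sum>z\<in>T. emeasure suspension_measure (S z n)) \<longlonglongrightarrow> 0" by simp
  show ?thesis
  proof (rule tendsto_sandwich[OF _ _ tendsto_const lim])
    show "\<forall>\<^sub>F n in sequentially. emeasure suspension_measure
        {x. e \<le> cmod (f (k n *\<^sub>R fst x + c n *\<^sub>R transversal x) - f (\<kappa> *\<^sub>R fst x))} \<le> (\<Sum>z\<in>T. emeasure suspension_measure (S z n))"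
    proof (intro always_eventually allI)
      fix n
      have "{x. e \<le> cmod (f (k n *\<^sub>R fst x + c n *\<^sub>R transversal x) - f (\<kappa> *\<^sub>R fst x))} \<subseteq> (\<Union>z\<in>T. S z n)"
      proof
        fix x assume "x \<in> {x. e \<le> cmod (f (k n *\<^sub>R fst x + c n *\<^sub>R transversal x) - f (\<kappa> *\<^sub>R fst x))}"
        then have x: "e \<le> dist (f (k n *\<^sub>R fst x + c n *\<^sub>R transversal x)) (f (\<kappa> *\<^sub>R fst x))" by (simp add: dist_norm)
        have "f (\<kappa> *\<^sub>R fst x) \<in> cball 0 1" using bd by simp
        then obtain z where z: "z \<in> T" "dist z (f (\<kappa> *\<^sub>R fst x)) < e / 2" using T(2) by auto
        then have "\<not> dist z (f (k n *\<^sub>R fst x + c n *\<^sub>R transversal x)) < e / 2"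
          using x dist_triangle_half_r[of z "f (k n *\<^sub>R fst x + c n *\<^sub>R transversal x)" e "f (\<kappa> *\<^sub>R fst x)"] by auto
        then show "x \<in> (\<Union>z\<in>T. S z n)" using z by (auto simp: S_def)
      qed
      then have "emeasure suspension_measure {x. e \<le> cmod (f (k n *\<^sub>R fst x + c n *\<^sub>R transversal x) - f (\<kappa> *\<^sub>R fst x))}
        \<le> emeasure suspension_measure (\<Union>z\<in>T. S z n)"
        using T(1) by (intro emeasure_mono) auto
      also have "\<dots> \<le> (\<Sum>z\<in>T. emeasure suspension_measure (S z n))"
        using T(1) by (intro emeasure_subadditive_finite) auto
      finally show "emeasure suspension_measure
        {x. e \<le> cmod (f (k n *\<^sub>R fst x + c n *\<^sub>R transversal x) - f (\<kappa> *\<^sub>R fst x))} \<le> (\<Sum>z\<in>T. emeasure suspension_measure (S z n))" .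
    qed
  qed simp
qed

text \<open>The Mautner phenomenon. With \<open>c = (1 - l) / n\<close> the vectors \<open>l p + c q\<close> and \<open>p\<^sub>n + c q\<^sub>n\<close> are in one orbit,
  where \<open>(p\<^sub>n, q\<^sub>n)\<close> are \<open>(p, q)\<close> after time \<open>n\<close>; so membership in \<open>A\<close> is compared along
  \<open>l p \<leadsto> l p + c q \<leadsto> p\<^sub>n + c q\<^sub>n \<leadsto> p\<^sub>n \<leadsto> p\<close>.\<close>

lemma sl2_invariant_scaling:
  assumes A [measurable]: "A \<in> sets borel"
    and inv: "\<And>a b c d p. a * d - b * c = 1 \<Longrightarrow> sl2_act a b c d p \<in> A \<longleftrightarrow> p \<in> A"
    and l: "0 < l" "l < 1"
  shows "AE p in lborel. p \<in> bcz_domain \<longrightarrow> (l *\<^sub>R p \<in> A \<longleftrightarrow> p \<in> A)"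
proof (rule AE_suspension_fst)
  define c where "c = (\<lambda>n. (1 - l) / real (Suc n))"
  have c: "c \<longlonglongrightarrow> 0"
    unfolding c_def by (rule LIMSEQ_Suc[OF lim_const_over_n])
  have A' [measurable]: "- A \<in> sets borel" by simp
  let ?\<nu> = "emeasure suspension_measure"
  \<comment> \<open>Perturbation is controlled in one direction only, from inside a set to outside.
    Each of the comparisons at scales \<open>l\<close> and \<open>1\<close> is thus made for
    \<open>A\<close> and for \<open>- A\<close>; those at scale \<open>1\<close> take place at the
    later time, where the flow preserves the measure.\<close>
  define S where "S = (\<lambda>\<kappa> B n. {x. \<kappa> *\<^sub>R fst x \<in> B \<and> \<kappa> *\<^sub>R fst x + c n *\<^sub>R transversal x \<notin> B})"
  have S [measurable]: "S \<kappa> B n \<in> sets borel" if [measurable]: "B \<in> sets borel" for \<kappa> B n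
    unfolding S_def by (rule Collect_measurable_borel) measurable
  have lim: "(\<lambda>n. ?\<nu> (S \<kappa> B n)) \<longlonglongrightarrow> 0" if "0 < \<kappa>" "B \<in> sets borel" for \<kappa> B
    unfolding S_def by (rule suspension_perturbation_null[OF that(2) tendsto_const that(1) c])
  have "(\<lambda>n. ?\<nu> (S l A n) + ?\<nu> (S l (- A) n) + ?\<nu> (S 1 A n) + ?\<nu> (S 1 (- A) n)) \<longlonglongrightarrow> 0 + 0 + 0 + 0"
    using l by (intro tendsto_add lim A A') auto
  then have lim0: "(\<lambda>n. ?\<nu> (S l A n) + ?\<nu> (S l (- A) n) + ?\<nu> (S 1 A n) + ?\<nu> (S 1 (- A) n)) \<longlonglongrightarrow> 0" by simp
  define B where "B = {x \<in> suspension. (l *\<^sub>R fst x \<in> A) \<noteq> (fst x \<in> A)}"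
  have [measurable]: "B \<in> sets borel"
    unfolding B_def by (rule Collect_measurable_borel) measurable
  have le: "?\<nu> B \<le> ?\<nu> (S l A n) + ?\<nu> (S l (- A) n) + ?\<nu> (S 1 A n) + ?\<nu> (S 1 (- A) n)" for n
  proof -
    let ?H = "unit_flow ^^ Suc n"
    let ?P = "\<lambda>X. {x. ?H x \<in> X}"
    have P [measurable]: "?P X \<in> sets borel" if [measurable]: "X \<in> sets borel" for X
      by (rule Collect_measurable_borel) measurable
    have "B \<subseteq> ((S l A n \<union> S l (- A) n) \<union> ?P (S 1 A n)) \<union> ?P (S 1 (- A) n)"
    proof
      fix x assume x: "x \<in> B"
      then have xs: "x \<in> suspension" and ne: "(l *\<^sub>R fst x \<in> A) \<noteq> (fst x \<in> A)" by (auto simp: B_def)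
      obtain a b a' b' :: int where det: "a * b' - b * a' = 1" and
        *: "\<And>k m. sl2_act a b a' b' (k *\<^sub>R fst x + m *\<^sub>R (transversal x - real (Suc n) *\<^sub>R fst x))
          = k *\<^sub>R fst (?H x) + m *\<^sub>R transversal (?H x)"
        by (rule unit_flow_funpow_matrix[OF xs, where n = "Suc n"]) (rule that)
      \<comment> \<open>The choice of \<open>c n\<close>: shearing by \<open>Suc n\<close> takes
        exactly \<open>1 - l\<close> off the coefficient of \<open>fst x\<close>.\<close>
      have "real (Suc n) * c n = 1 - l" by (simp add: c_def)
      then have l': "l = 1 - c n * real (Suc n)" by (simp add: mult.commute)
      have eq: "1 *\<^sub>R fst x + c n *\<^sub>R (transversal x - real (Suc n) *\<^sub>R fst x) = l *\<^sub>R fst x + c n *\<^sub>R transversal x"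
        unfolding l' by (simp only: scaleR_diff_left scaleR_diff_right scaleR_scaleR) simp
      have 1: "l *\<^sub>R fst x + c n *\<^sub>R transversal x \<in> A \<longleftrightarrow> 1 *\<^sub>R fst (?H x) + c n *\<^sub>R transversal (?H x) \<in> A"
        using inv[OF det, of "1 *\<^sub>R fst x + c n *\<^sub>R (transversal x - real (Suc n) *\<^sub>R fst x)"]
        unfolding *[of 1 "c n"] unfolding eq by blast
      have 2: "fst x \<in> A \<longleftrightarrow> 1 *\<^sub>R fst (?H x) \<in> A"
        using inv[OF det, of "fst x"] *[of 1 0] by simp
      show "x \<in> ((S l A n \<union> S l (- A) n) \<union> ?P (S 1 A n)) \<union> ?P (S 1 (- A) n)"
        using ne 1 2 unfolding S_def by blast
    qed
    then have s0: "?\<nu> B \<le> ?\<nu> (((S l A n \<union> S l (- A) n) \<union> ?P (S 1 A n)) \<union> ?P (S 1 (- A) n))"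
      by (intro emeasure_mono) auto
    have s1: "?\<nu> (((S l A n \<union> S l (- A) n) \<union> ?P (S 1 A n)) \<union> ?P (S 1 (- A) n))
        \<le> ?\<nu> ((S l A n \<union> S l (- A) n) \<union> ?P (S 1 A n)) + ?\<nu> (?P (S 1 (- A) n))"
      by (intro emeasure_subadditive) auto
    have s2: "?\<nu> ((S l A n \<union> S l (- A) n) \<union> ?P (S 1 A n)) \<le> ?\<nu> (S l A n \<union> S l (- A) n) + ?\<nu> (?P (S 1 A n))"
      by (intro emeasure_subadditive) auto
    have s3: "?\<nu> (S l A n \<union> S l (- A) n) \<le> ?\<nu> (S l A n) + ?\<nu> (S l (- A) n)"
      by (intro emeasure_subadditive) auto
    show ?thesis
      using order_trans[OF s0 order_trans[OF s1 add_right_mono[OF order_trans[OF s2 add_right_mono[OF s3]]]]]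
      unfolding emeasure_unit_flow_funpow[OF S[OF A]] emeasure_unit_flow_funpow[OF S[OF A']] .
  qed
  have "?\<nu> B \<le> 0" by (rule tendsto_lowerbound[OF lim0]) (use le in auto)
  then have "B \<in> null_sets suspension_measure" by (intro null_setsI) auto
  then have "AE x in suspension_measure. x \<notin> B" by (rule AE_not_in)
  then show "AE x in suspension_measure. (l *\<^sub>R fst x \<in> A) = (fst x \<in> A)"
    unfolding AE_suspension by eventually_elim (auto simp: B_def)
qed measurable

section \<open>Moebius maps on Farey intervals\<close>

text \<open>Descent in the Stern--Brocot tree: an irrational \<open>x\<close> never equals the
  mediant, so one of the two halves again contains it, and the sum of the denominators grows by at
  least 1.\<close>

lemma farey_interval_exists:
  fixes x :: real
  assumes x: "0 < x" "x < 1" "x \<notin> \<rat>"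
  shows "\<exists>p q p' q' :: int. 0 < q \<and> 0 < q' \<and> p' * q - p * q' = 1 \<and>
    real_of_int p < real_of_int q * x \<and> real_of_int q' * x < real_of_int p' \<and> int N < q + q'"
proof (induction N)
  case 0
  show ?case
    by (rule exI[of _ 0], rule exI[of _ 1], rule exI[of _ 1], rule exI[of _ 1]) (use x in auto)
next
  case (Suc N)
  then obtain p q p' q' :: int where *: "0 < q" "0 < q'" "p' * q - p * q' = 1"
    "real_of_int p < real_of_int q * x" "real_of_int q' * x < real_of_int p'" "int N < q + q'"
    by blast
  have "real_of_int (q + q') * x \<noteq> real_of_int (p + p')"
  proof
    assume "real_of_int (q + q') * x = real_of_int (p + p')"
    then have "x = real_of_int (p + p') / real_of_int (q + q')"
      using * by (simp add: field_simps)
    then have "x \<in> \<rat>" by (metis Rats_divide Rats_of_int)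
    then show False using x by simp
  qed
  then consider "real_of_int (p + p') < real_of_int (q + q') * x" | "real_of_int (q + q') * x < real_of_int (p + p')"
    by linarith
  then show ?case
  proof cases
    case 1
    show ?thesis
      by (rule exI[of _ "p + p'"], rule exI[of _ "q + q'"], rule exI[of _ p'], rule exI[of _ q'])
        (use 1 * in \<open>auto simp: algebra_simps\<close>)
  next
    case 2
    show ?thesis
      by (rule exI[of _ p], rule exI[of _ q], rule exI[of _ "p + p'"], rule exI[of _ "q + q'"])
        (use 2 * in \<open>auto simp: algebra_simps\<close>)
  qed
qed

lemma archimedean_step:
  fixes A B :: real
  assumes "0 < A" "0 < B"
  obtains k :: nat where "real k * A < B" "B \<le> (real k + 1) * A"
proof -
  define m where "m = \<lceil>B / A\<rceil>"
  have m: "B / A \<le> of_int m" "of_int m < B / A + 1"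
    by (auto simp: m_def) linarith
  have "0 < B / A" using assms by simp
  then have "0 < m" using m by linarith
  show ?thesis
  proof (rule that[of "nat (m - 1)"])
    show "real (nat (m - 1)) * A < B" "B \<le> (real (nat (m - 1)) + 1) * A"
      using m \<open>0 < m\<close> assms by (auto simp: field_simps)
  qed
qed

text \<open>The balanced intervals are those right after a turn in the Stern--Brocot tree; they make the
  distortion of the corresponding Moebius map bounded.\<close>

lemma balanced_farey_interval:
  fixes x :: real
  assumes x: "0 < x" "x < 1" "x \<notin> \<rat>" and d: "0 < d"
  obtains p q p' q' :: int where "0 < q" "0 < q'" "p' * q - p * q' = 1"
    "real_of_int p / real_of_int q \<le> x" "x \<le> real_of_int p' / real_of_int q'"
    "q \<le> 2 * q'" "q' \<le> 2 * q" "1 / (real_of_int q * real_of_int q') < d"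
proof -
  obtain N :: nat where N: "3 / d < real N" by (meson reals_Archimedean2)
  obtain p q p' q' :: int where *: "0 < q" "0 < q'" "p' * q - p * q' = 1"
    "real_of_int p < real_of_int q * x" "real_of_int q' * x < real_of_int p'" "int N < q + q'"
    using farey_interval_exists[OF x, of N] by blast
  \<comment> \<open>The distances from \<open>x\<close> to the endpoints, multiplied by the
    denominators. Moving one endpoint to the mediant subtracts the other distance, so the descent is
    the subtractive Euclidean algorithm on \<open>A\<close> and \<open>B\<close>.\<close>
  define A where "A = real_of_int q * x - real_of_int p"
  define B where "B = real_of_int p' - real_of_int q' * x"
  have AB: "0 < A" "0 < B" using * by (auto simp: A_def B_def)
  have fin: "1 / (real_of_int r * real_of_int r') < d"
    if r: "0 < r" "0 < r'" "int N < r + r'" "r \<le> 2 * r'" "r' \<le> 2 * r" for r r' :: int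
  proof -
    have le: "r + r' \<le> 3 * (r * r')"
    proof -
      have "r \<le> r * r'" "r' \<le> r * r'"
        using r mult_left_mono[of 1 r' r] mult_right_mono[of 1 r r'] by simp_all
      then show ?thesis using r by linarith
    qed
    then have "int N < 3 * (r * r')" using r(3) by linarith
    then have "real_of_int (int N) < real_of_int (3 * (r * r'))" by (simp only: of_int_less_iff)
    then have "real N < 3 * (real_of_int r * real_of_int r')" by simp
    then have "3 / d < 3 * (real_of_int r * real_of_int r')" using N by linarith
    moreover have "0 < real_of_int r * real_of_int r'" using r by simp
    ultimately show ?thesis using d by (simp add: field_simps)
  qed
  show ?thesis
  proof (cases "q \<le> q'")
    case True
    \<comment> \<open>The right end is moved \<open>k\<close> times, leaving
      \<open>B - k * A > 0\<close>; the next mediant falls on the left because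
      \<open>(k + 1) * A - B \<ge> 0\<close>. After this turn \<open>?r = q + ?r'\<close>, and
      \<open>q \<le> q' \<le> ?r'\<close> gives the balance; this is why the end with the larger
      denominator moves before the turn.\<close>
    obtain k :: nat where k: "real k * A < B" "B \<le> (real k + 1) * A"
      using archimedean_step[OF AB] by blast
    let ?r = "q + q' + int k * q" and ?r' = "q' + int k * q"
    let ?s = "p + p' + int k * p" and ?s' = "p' + int k * p"
    have pos: "0 < ?r" "0 < ?r'" using * by (auto intro!: add_pos_nonneg)
    have bal: "?r \<le> 2 * ?r'" "?r' \<le> 2 * ?r" "int N < ?r + ?r'"
    proof -
      have "0 \<le> int k * q" using * by simp
      moreover have "q + q' + m \<le> 2 * (q' + m) \<and> q' + m \<le> 2 * (q + q' + m) \<and> int N < q + q' + m + (q' + m)" if "0 \<le> m" for m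
        using *(1,2,6) True that by auto
      ultimately show "?r \<le> 2 * ?r'" "?r' \<le> 2 * ?r" "int N < ?r + ?r'" by blast+
    qed
    show ?thesis
    proof (rule that[of ?r ?r' ?s' ?s])
      show "?s' * ?r - ?s * ?r' = 1" using *(3) by algebra
      have "real_of_int ?s \<le> real_of_int ?r * x"
        using k(2) unfolding A_def B_def by (simp add: algebra_simps)
      moreover have "0 < real_of_int ?r" using pos(1) by (simp only: of_int_0_less_iff)
      ultimately show "real_of_int ?s / real_of_int ?r \<le> x"
        by (simp only: pos_divide_le_eq mult.commute)
      have "real_of_int ?r' * x \<le> real_of_int ?s'"
        using k(1) unfolding A_def B_def by (simp add: algebra_simps)
      moreover have "0 < real_of_int ?r'" using pos(2) by (simp only: of_int_0_less_iff)
      ultimately show "x \<le> real_of_int ?s' / real_of_int ?r'"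
        by (simp only: pos_le_divide_eq mult.commute)
    qed (fact pos bal fin[OF pos bal(3,1,2)])+
  next
    case False
    obtain k :: nat where k: "real k * B < A" "A \<le> (real k + 1) * B"
      using archimedean_step[OF AB(2,1)] by blast
    let ?r' = "q + q' + int k * q'" and ?r = "q + int k * q'"
    let ?s' = "p + p' + int k * p'" and ?s = "p + int k * p'"
    have pos: "0 < ?r" "0 < ?r'" using * by (auto intro!: add_pos_nonneg)
    have bal: "?r \<le> 2 * ?r'" "?r' \<le> 2 * ?r" "int N < ?r + ?r'"
    proof -
      have "0 \<le> int k * q'" using * by simp
      moreover have "q + m \<le> 2 * (q + q' + m) \<and> q + q' + m \<le> 2 * (q + m) \<and> int N < q + m + (q + q' + m)" if "0 \<le> m" for m
        using *(1,2,6) False that by auto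
      ultimately show "?r \<le> 2 * ?r'" "?r' \<le> 2 * ?r" "int N < ?r + ?r'" by blast+
    qed
    show ?thesis
    proof (rule that[of ?r ?r' ?s' ?s])
      show "?s' * ?r - ?s * ?r' = 1" using *(3) by algebra
      have "real_of_int ?s \<le> real_of_int ?r * x"
        using k(1) unfolding A_def B_def by (simp add: algebra_simps)
      moreover have "0 < real_of_int ?r" using pos(1) by (simp only: of_int_0_less_iff)
      ultimately show "real_of_int ?s / real_of_int ?r \<le> x"
        by (simp only: pos_divide_le_eq mult.commute)
      have "real_of_int ?r' * x \<le> real_of_int ?s'"
        using k(2) unfolding A_def B_def by (simp add: algebra_simps)
      moreover have "0 < real_of_int ?r'" using pos(2) by (simp only: of_int_0_less_iff)
      ultimately show "x \<le> real_of_int ?s' / real_of_int ?r'"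
        by (simp only: pos_le_divide_eq mult.commute)
    qed (fact pos bal fin[OF pos bal(3,1,2)])+
  qed
qed

text \<open>The map \<open>g\<close> preserves \<open>A\<close> and sends \<open>{0..1}\<close> onto
  the part of the Farey interval to the left of the mediant. Its derivative is at least
  \<open>1 / (Q + Q')\<^sup>2\<close>, which for balanced denominators is at least a ninth of the
  length \<open>1 / (Q * Q')\<close>. So \<open>A\<close> fills each balanced interval to a
  proportion bounded below.\<close>

lemma moebius_distortion:
  fixes A :: "real set" and p q p' q' :: int
  assumes [measurable]: "A \<in> sets borel"
    and inv: "\<And>a b c d :: int. \<And>x :: real. a * d - b * c = 1 \<Longrightarrow> 0 < of_int a + of_int b * x \<Longrightarrow>
      x \<in> A \<longleftrightarrow> (of_int c + of_int d * x) / (of_int a + of_int b * x) \<in> A"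
    and q: "0 < q" "0 < q'" "p' * q - p * q' = 1" and bal: "q \<le> 2 * q'" "q' \<le> 2 * q"
  shows "emeasure lborel (A \<inter> {0..1}) * emeasure lborel {p / q..p' / q'}
    \<le> 9 * emeasure lborel (A \<inter> {p / q..p' / q'})"
proof -
  define Q Q' P P' where "Q = real_of_int q" and "Q' = real_of_int q'" and "P = real_of_int p" and "P' = real_of_int p'"
  have Q: "0 < Q" "0 < Q'" "Q \<le> 2 * Q'" "Q' \<le> 2 * Q"
    using q bal by (auto simp: Q_def Q'_def)
  have det: "P' * Q - P * Q' = 1"
    unfolding Q_def Q'_def P_def P'_def using q(3) by (metis of_int_1 of_int_diff of_int_mult)
  define g where "g = (\<lambda>y. (P + P' * y) / (Q + Q' * y))"
  define g' where "g' = (\<lambda>y. 1 / (Q + Q' * y)\<^sup>2)"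
  have pos: "0 < Q + Q' * y" if "0 \<le> y" for y
    using Q that by (simp add: add_pos_nonneg)
  have g_in: "g y \<in> A \<longleftrightarrow> y \<in> A" if "0 \<le> y" for y
    using inv[of q p' q' p y] pos[OF that] q(3) by (simp add: g_def Q_def Q'_def P_def P'_def mult.commute)
  have g1: "g 1 \<le> P' / Q'"
    using Q det by (simp add: g_def divide_simps algebra_simps)
  have g0: "g 0 = P / Q" by (simp add: g_def)
  have len: "emeasure lborel {P / Q..P' / Q'} = ennreal (1 / (Q * Q'))"
  proof -
    have "P' / Q' - P / Q = 1 / (Q * Q')" using Q det by (simp add: field_simps)
    moreover have "0 \<le> 1 / (Q * Q')" using Q by simp
    ultimately have "P / Q \<le> P' / Q'" by linarith
    then show ?thesis using \<open>P' / Q' - P / Q = 1 / (Q * Q')\<close> by simp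
  qed
  have "ennreal (1 / (Q * Q') / 9) * emeasure lborel (A \<inter> {0..1})
      = (\<integral>\<^sup>+y. ennreal (1 / (Q * Q') / 9) * indicator (A \<inter> {0..1}) y \<partial>lborel)"
    by (rule nn_integral_cmult_indicator[symmetric]) simp
  also have "\<dots> \<le> (\<integral>\<^sup>+y. indicator A (g y) * ennreal (g' y) * indicator {0..1} y \<partial>lborel)"
  proof (rule nn_integral_mono)
    fix y
    show "ennreal (1 / (Q * Q') / 9) * indicator (A \<inter> {0..1}) y
      \<le> indicator A (g y) * ennreal (g' y) * indicator {0..1} y"
    proof (cases "y \<in> A \<inter> {0..1}")
      case True
      then have y: "0 \<le> y" "y \<le> 1" "y \<in> A" by auto
      have "Q + Q' * y \<le> Q + Q'" using y Q by simp
      then have "(Q + Q' * y)\<^sup>2 \<le> (Q + Q')\<^sup>2" using pos[OF y(1)] by (intro power_mono) auto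
      also have "\<dots> \<le> 9 * (Q * Q')"
      proof -
        have "0 \<le> (2 * Q' - Q) * (2 * Q - Q')" using Q by (intro mult_nonneg_nonneg) auto
        moreover have "0 < Q * Q'" using Q by simp
        ultimately show ?thesis by (simp add: power2_eq_square algebra_simps)
      qed
      finally have "1 / (Q * Q') / 9 \<le> g' y"
        using pos[OF y(1)] Q unfolding g'_def by (simp add: field_simps)
      then show ?thesis using True y g_in[OF y(1)] by (auto intro!: ennreal_leI)
    qed auto
  qed
  also have "\<dots> = (\<integral>\<^sup>+x. indicator A x * indicator {g 0..g 1} x \<partial>lborel)"
  proof (rule nn_integral_substitution_aux[symmetric])
    show "(g has_real_derivative g' y) (at y)" if "y \<in> {0..1}" for y
    proof -
      have "Q + Q' * y \<noteq> 0" using pos[of y] that by auto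
      then show ?thesis
        unfolding g_def g'_def using det
        by (auto intro!: derivative_eq_intros simp: power2_eq_square divide_simps) (simp add: algebra_simps)
    qed
    show "continuous_on {0..1} g'"
      unfolding g'_def using less_imp_neq[OF pos, symmetric] by (intro continuous_intros) auto
  qed (auto simp: g'_def)
  also have "\<dots> \<le> (\<integral>\<^sup>+x. indicator (A \<inter> {P / Q..P' / Q'}) x \<partial>lborel)"
    using g1 g0 by (intro nn_integral_mono) (auto simp: indicator_def)
  also have "\<dots> = emeasure lborel (A \<inter> {P / Q..P' / Q'})" by simp
  finally have main: "ennreal (1 / (Q * Q') / 9) * emeasure lborel (A \<inter> {0..1})
    \<le> emeasure lborel (A \<inter> {P / Q..P' / Q'})" .
  have "ennreal (1 / (Q * Q')) = 9 * ennreal (1 / (Q * Q') / 9)"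
  proof -
    have "ennreal (9 * (1 / (Q * Q') / 9)) = ennreal 9 * ennreal (1 / (Q * Q') / 9)"
      using Q by (intro ennreal_mult) auto
    then show ?thesis by simp
  qed
  then have "emeasure lborel (A \<inter> {0..1}) * emeasure lborel {P / Q..P' / Q'}
     = 9 * (ennreal (1 / (Q * Q') / 9) * emeasure lborel (A \<inter> {0..1}))"
    unfolding len by (simp add: mult.assoc mult.left_commute mult.commute)
  also have "\<dots> \<le> 9 * emeasure lborel (A \<inter> {P / Q..P' / Q'})"
    using main by (rule mult_left_mono) simp
  finally show ?thesis unfolding Q_def Q'_def P_def P'_def .
qed

text \<open>Otherwise the complement \<open>B\<close> is covered, up to a null set, by disjoint
  balanced Farey intervals inside an open \<open>U\<close> with \<open>U - B\<close> of measure less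
  than \<open>e\<close>. By the distortion bound these contain points of \<open>A\<close> of total
  measure at least \<open>\<mu> / 9\<close> times the measure of \<open>B\<close>, which is
  \<open>e\<close>; but such points lie in \<open>U - B\<close>.\<close>

lemma moebius_ergodic_unit_interval:
  fixes A :: "real set"
  assumes A [measurable]: "A \<in> sets borel"
    and inv: "\<And>a b c d :: int. \<And>x :: real. a * d - b * c = 1 \<Longrightarrow> 0 < of_int a + of_int b * x \<Longrightarrow>
      x \<in> A \<longleftrightarrow> (of_int c + of_int d * x) / (of_int a + of_int b * x) \<in> A"
    and pos: "emeasure lborel (A \<inter> {0..1}) \<noteq> 0"
  shows "emeasure lborel ({0<..<1} - A) = 0"
proof (rule ccontr)
  assume ne: "emeasure lborel ({0<..<1} - A) \<noteq> 0"
  define \<mu> where "\<mu> = emeasure lborel (A \<inter> {0..1})"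
  \<comment> \<open>Rationals are removed because only irrational points lie in arbitrarily short
    balanced intervals by the descent above.\<close>
  define B where "B = {0<..<1} - A - \<rat>"
  have [measurable]: "(\<rat> :: real set) \<in> sets borel"
    by (simp add: countable_rat countable_imp_null_set_lborel null_setsD2 sets.countable)
  have B [measurable]: "B \<in> sets borel" unfolding B_def by measurable
  have Beq: "emeasure lborel B = emeasure lborel ({0<..<1} - A)"
    unfolding B_def by (rule emeasure_Diff_null_set) (auto intro: countable_imp_null_set_lborel countable_rat)
  have fin: "\<mu> < \<infinity>"
    unfolding \<mu>_def using emeasure_mono[of "A \<inter> {0..1}" "{0..1}" lborel] le_less_trans[of _ 1 "\<infinity>::ennreal"] by simp
  have finB: "emeasure lborel B < \<infinity>"
  proof -
    have "B \<subseteq> {0..1}" by (auto simp: B_def)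
    then show ?thesis
      using emeasure_mono[of B "{0..1}" lborel] le_less_trans[of _ 1 "\<infinity>::ennreal"] by simp
  qed
  have prod_pos: "0 < \<mu> * emeasure lborel B"
    using pos ne Beq unfolding \<mu>_def by (simp add: ennreal_zero_less_mult_iff zero_less_iff_neq_zero)
  have prod_fin: "\<mu> * emeasure lborel B < \<infinity>"
    using fin finB by (simp add: ennreal_mult_less_top)
  define e where "e = enn2real (\<mu> * emeasure lborel B) / 9"
  have e: "0 < e" using prod_pos prod_fin by (simp add: e_def enn2real_positive_iff)
  obtain U where U: "open U" "B \<subseteq> U" "emeasure lebesgue (U - B) < ennreal e"
  proof -
    have "B \<in> sets lebesgue" using B by simp
    from sets_lebesgue_outer_open[OF this e] show ?thesis using that by blast
  qed
  have [measurable]: "U \<in> sets borel" using U by simp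
  define K :: "(int \<times> int \<times> int \<times> int) set" where "K = {(p, q, p', q'). 0 < q \<and> 0 < q' \<and> p' * q - p * q' = 1
      \<and> q \<le> 2 * q' \<and> q' \<le> 2 * q \<and> {real_of_int p / real_of_int q..real_of_int p' / real_of_int q'} \<subseteq> U}"
  define l :: "int \<times> int \<times> int \<times> int \<Rightarrow> real" where "l = (\<lambda>(p, q, p', q'). real_of_int p / real_of_int q)"
  define r :: "int \<times> int \<times> int \<times> int \<Rightarrow> real" where "r = (\<lambda>(p, q, p', q'). real_of_int p' / real_of_int q')"
  have rl: "r i - l i = 1 / (real_of_int (fst (snd i)) * real_of_int (snd (snd (snd i)))) \<and> l i < r i" if "i \<in> K" for i
  proof -
    obtain p q p' q' where i: "i = (p, q, p', q')" by (metis prod_cases4)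
    have q: "0 < q" "0 < q'" "p' * q - p * q' = 1" using that by (auto simp: K_def i)
    have "real_of_int p' * real_of_int q - real_of_int p * real_of_int q' = 1"
      using q(3) by (metis of_int_1 of_int_diff of_int_mult)
    then have "r i - l i = 1 / (real_of_int q * real_of_int q')"
      using q by (simp add: r_def l_def i field_simps)
    moreover have "0 < 1 / (real_of_int q * real_of_int q')" using q by simp
    ultimately have "0 < r i - l i" by simp
    then show ?thesis using \<open>r i - l i = _\<close> by (simp add: i)
  qed
  \<comment> \<open>Vitali's theorem speaks of balls, so an interval is presented by its midpoint
    and half its length.\<close>
  have cb: "cball ((l i + r i) / 2) ((r i - l i) / 2) = {l i..r i}" for i
    by (auto simp: cball_eq_atLeastAtMost field_simps)
  obtain C where C: "countable C" "C \<subseteq> K"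
    "pairwise (\<lambda>i j. disjnt (cball ((l i + r i) / 2) ((r i - l i) / 2)) (cball ((l j + r j) / 2) ((r j - l j) / 2))) C"
    "negligible (B - (\<Union>i\<in>C. cball ((l i + r i) / 2) ((r i - l i) / 2)))"
  proof (rule Vitali_covering_theorem_cballs[of K "\<lambda>i. (r i - l i) / 2" B "\<lambda>i. (l i + r i) / 2"])
    show "0 < (r i - l i) / 2" if "i \<in> K" for i using conjunct2[OF rl[OF that]] by simp
  next
    fix x d :: real assume x: "x \<in> B" and d: "0 < d"
    have "x \<in> U" using U(2) x by blast
    then obtain e' where e': "0 < e'" "cball x e' \<subseteq> U" using U(1) open_contains_cball by blast
    have de: "0 < min d e'" using d e' by simp
    have x01: "0 < x" "x < 1" "x \<notin> \<rat>" using x by (auto simp: B_def)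
    obtain p q p' q' where q: "0 < q" "0 < q'" "p' * q - p * q' = 1"
      "real_of_int p / real_of_int q \<le> x" "x \<le> real_of_int p' / real_of_int q'"
      "q \<le> 2 * q'" "q' \<le> 2 * q" "1 / (real_of_int q * real_of_int q') < min d e'"
      using balanced_farey_interval[OF x01 de] .
    let ?i = "(p, q, p', q')"
    have det: "real_of_int p' * real_of_int q - real_of_int p * real_of_int q' = 1"
      using q(3) by (metis of_int_1 of_int_diff of_int_mult)
    then have len: "r ?i - l ?i = 1 / (real_of_int q * real_of_int q')"
      using q by (simp add: r_def l_def field_simps)
    have lr: "l ?i \<le> x" "x \<le> r ?i" using q by (auto simp: l_def r_def)
    have "{l ?i..r ?i} \<subseteq> cball x e'"
      using lr len q(8) by (auto simp: dist_real_def)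
    then have "?i \<in> K" using e' q by (auto simp: K_def l_def r_def)
    moreover have "x \<in> cball ((l ?i + r ?i) / 2) ((r ?i - l ?i) / 2)" unfolding cb using lr by simp
    moreover have "(r ?i - l ?i) / 2 < d"
    proof -
      have half: "y / 2 < d" if "y < d" "0 \<le> y" for y :: real using that by linarith
      have "r ?i - l ?i < d" unfolding len using q(8) by simp
      moreover have "0 \<le> r ?i - l ?i" using lr by simp
      ultimately show ?thesis by (rule half)
    qed
    ultimately show "\<exists>i. i \<in> K \<and> x \<in> cball ((l i + r i) / 2) ((r i - l i) / 2) \<and> (r i - l i) / 2 < d"
      by blast
  qed
  have disj: "disjoint_family_on (\<lambda>i. {l i..r i}) C"
    using C(3) unfolding cb disjoint_family_on_def pairwise_def disjnt_def by auto
  have V: "(\<Union>i\<in>C. {l i..r i}) \<in> sets borel" using C(1) by (intro sets.countable_UN') auto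
  have "B - (\<Union>i\<in>C. {l i..r i}) \<in> null_sets lborel"
    using C(4) V unfolding cb by (auto simp: negligible_iff_null_sets null_sets_completion_iff)
  then have "emeasure lborel ((\<Union>i\<in>C. {l i..r i}) \<union> (B - (\<Union>i\<in>C. {l i..r i}))) = emeasure lborel (\<Union>i\<in>C. {l i..r i})"
    using V by (intro emeasure_Un_null_set) auto
  moreover have "emeasure lborel B \<le> emeasure lborel ((\<Union>i\<in>C. {l i..r i}) \<union> (B - (\<Union>i\<in>C. {l i..r i})))"
    using V by (intro emeasure_mono) auto
  ultimately have "emeasure lborel B \<le> emeasure lborel (\<Union>i\<in>C. {l i..r i})" by simp
  also have "\<dots> = (\<integral>\<^sup>+i. emeasure lborel {l i..r i} \<partial>count_space C)"
    using C(1) disj by (intro emeasure_UN_countable) auto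
  finally have "\<mu> * emeasure lborel B \<le> \<mu> * (\<integral>\<^sup>+i. emeasure lborel {l i..r i} \<partial>count_space C)"
    by (rule mult_left_mono) simp
  also have "\<dots> = (\<integral>\<^sup>+i. \<mu> * emeasure lborel {l i..r i} \<partial>count_space C)"
    by (rule nn_integral_cmult[symmetric]) simp
  also have "\<dots> \<le> (\<integral>\<^sup>+i. 9 * emeasure lborel (A \<inter> {l i..r i}) \<partial>count_space C)"
  proof (rule nn_integral_mono)
    fix i assume "i \<in> space (count_space C)"
    then have "i \<in> K" using C(2) by auto
    obtain p q p' q' where i: "i = (p, q, p', q')" by (metis prod_cases4)
    show "\<mu> * emeasure lborel {l i..r i} \<le> 9 * emeasure lborel (A \<inter> {l i..r i})"
      using moebius_distortion[OF A inv, of q q' p' p] \<open>i \<in> K\<close> unfolding \<mu>_def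
      by (simp add: K_def i l_def r_def)
  qed
  also have "\<dots> = 9 * (\<integral>\<^sup>+i. emeasure lborel (A \<inter> {l i..r i}) \<partial>count_space C)"
    by (rule nn_integral_cmult) simp
  also have "(\<integral>\<^sup>+i. emeasure lborel (A \<inter> {l i..r i}) \<partial>count_space C) = emeasure lborel (\<Union>i\<in>C. A \<inter> {l i..r i})"
  proof (rule emeasure_UN_countable[symmetric])
    show "disjoint_family_on (\<lambda>i. A \<inter> {l i..r i}) C"
      using disj unfolding disjoint_family_on_def by blast
  qed (use C(1) in auto)
  finally have "\<mu> * emeasure lborel B \<le> 9 * emeasure lborel (\<Union>i\<in>C. A \<inter> {l i..r i})" .
  also have "\<dots> \<le> 9 * emeasure lborel (U - B)"
    using C(2) by (intro mult_left_mono emeasure_mono) (auto simp: K_def l_def r_def B_def)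
  also have "\<dots> < 9 * ennreal e"
    using U(3) by (intro ennreal_mult_strict_left_mono) auto
  finally have lt: "\<mu> * emeasure lborel B < 9 * ennreal e" .
  have "9 * ennreal e = ennreal (9 * e)" using e by (simp add: ennreal_mult)
  also have "\<dots> = \<mu> * emeasure lborel B"
    using prod_fin by (simp add: e_def ennreal_enn2real_if)
  finally show False using lt by simp
qed

section \<open>Ergodicity\<close>

lemma AE_lborel_pairI:
  fixes P :: "real \<times> real \<Rightarrow> bool"
  assumes "AE x in lborel. AE y in lborel. P (x, y)" and "Measurable.pred borel P"
  shows "AE p in lborel. P p"
proof -
  have "{x \<in> space (lborel \<Otimes>\<^sub>M lborel). P x} \<in> sets (lborel \<Otimes>\<^sub>M lborel)"
    using assms(2) unfolding lborel_prod by (simp add: pred_def)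
  then have "AE p in (lborel \<Otimes>\<^sub>M lborel). P p"
    using assms(1) by (intro lborel_pair.AE_pair_measure) auto
  then show ?thesis unfolding lborel_prod .
qed

lemma AE_periodic_nonneg:
  fixes Q :: "real \<Rightarrow> bool"
  assumes unit: "AE x in lborel. x \<in> {0..1} \<longrightarrow> Q x" and [measurable]: "Measurable.pred borel Q"
    and per: "\<And>x. Q (1 + x) \<longleftrightarrow> Q x"
  shows "AE x in lborel. 0 \<le> x \<longrightarrow> Q x"
proof -
  have per': "Q (real n + x) \<longleftrightarrow> Q x" for n x
    by (induction n) (auto simp: add.assoc per)
  have "AE x in lborel. \<forall>n::nat. - real n + 1 * x \<in> {0..1} \<longrightarrow> Q (- real n + 1 * x)"
    unfolding AE_all_countable by (intro allI AE_borel_affine[OF _ _ unit]) auto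
  then show ?thesis
  proof eventually_elim
    case (elim x)
    show ?case
    proof
      assume "0 \<le> x"
      then have "- real (nat \<lfloor>x\<rfloor>) + 1 * x \<in> {0..1}" by (auto simp: of_nat_nat) linarith
      then have "Q (- real (nat \<lfloor>x\<rfloor>) + 1 * x)" using elim by blast
      then show "Q x" using per'[of "nat \<lfloor>x\<rfloor>" "- real (nat \<lfloor>x\<rfloor>) + 1 * x"] by simp
    qed
  qed
qed

lemma AE_slope:
  fixes Q :: "real \<Rightarrow> bool"
  assumes "AE x in lborel. 0 \<le> x \<longrightarrow> Q x" and [measurable]: "Measurable.pred borel Q"
  shows "AE p in lborel. p \<in> bcz_domain \<longrightarrow> Q (snd p / fst p)"
proof (rule AE_lborel_pairI)
  show "AE s in lborel. AE t in lborel. (s, t) \<in> bcz_domain \<longrightarrow> Q (snd (s, t) / fst (s, t))"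
  proof (rule AE_I2)
    fix s :: real
    show "AE t in lborel. (s, t) \<in> bcz_domain \<longrightarrow> Q (snd (s, t) / fst (s, t))"
    proof (cases "0 < s")
      case True
      have "AE t in lborel. 0 \<le> 0 + (1 / s) * t \<longrightarrow> Q (0 + (1 / s) * t)"
        using True by (intro AE_borel_affine assms) auto
      then show ?thesis
        by eventually_elim (use True in \<open>auto simp: bcz_domain_iff\<close>)
    qed (auto simp: bcz_domain_iff)
  qed
qed measurable

lemma not_AE_False_interval:
  assumes "0 < (d::real)" shows "\<not> (AE r in lborel. \<not> (0 < r \<and> r < d))"
proof
  assume "AE r in lborel. \<not> (0 < r \<and> r < d)"
  then have "emeasure lborel {0<..<d} = 0"
    by (subst (asm) AE_iff_measurable[where N = "{0<..<d}"]) auto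
  then show False using assms by simp
qed

text \<open>An invariant set is homogeneous by the Mautner phenomenon, hence given by an invariant set \<open>D\<close> of slopes.\<close>

lemma sl2_invariant_trivial:
  assumes A [measurable]: "A \<in> sets borel"
    and inv: "\<And>a b c d p. a * d - b * c = 1 \<Longrightarrow> sl2_act a b c d p \<in> A \<longleftrightarrow> p \<in> A"
  shows "(AE p in lborel. p \<in> bcz_domain \<longrightarrow> p \<in> A) \<or> (AE p in lborel. p \<in> bcz_domain \<longrightarrow> p \<notin> A)"
proof -
  have A' [measurable]: "A \<in> sets (borel \<Otimes>\<^sub>M borel)" using A by (simp only: borel_prod)
  \<comment> \<open>A slope belongs to \<open>D\<close> if almost all of its ray near the origin is
    in \<open>A\<close>. Using the germ of the ray, and not one point of it, makes \<open>D\<close>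
    invariant at every slope without exceptional null set. The radii \<open>1 / real (Suc m)\<close>
    keep the union countable.\<close>
  define D where "D = {x. \<exists>m::nat. AE r in lborel. 0 < r \<and> r < 1 / real (Suc m) \<longrightarrow> (r, r * x) \<in> A}"
  have D_iff: "x \<in> D \<longleftrightarrow> (\<exists>d>0. AE r in lborel. 0 < r \<and> r < d \<longrightarrow> (r, r * x) \<in> A)" for x
  proof
    assume "x \<in> D"
    then obtain m where "AE r in lborel. 0 < r \<and> r < 1 / real (Suc m) \<longrightarrow> (r, r * x) \<in> A"
      unfolding D_def by blast
    then show "\<exists>d>0. AE r in lborel. 0 < r \<and> r < d \<longrightarrow> (r, r * x) \<in> A"
      by (intro exI[of _ "1 / real (Suc m)"]) simp
  next
    assume "\<exists>d>0. AE r in lborel. 0 < r \<and> r < d \<longrightarrow> (r, r * x) \<in> A"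
    then obtain d where d: "0 < d" "AE r in lborel. 0 < r \<and> r < d \<longrightarrow> (r, r * x) \<in> A" by blast
    obtain m where m: "1 / real (Suc m) < d" using d(1) reals_Archimedean[of d] by (auto simp: inverse_eq_divide)
    have "AE r in lborel. 0 < r \<and> r < 1 / real (Suc m) \<longrightarrow> (r, r * x) \<in> A"
      using d(2) by eventually_elim (use m in auto)
    then show "x \<in> D" unfolding D_def by blast
  qed
  have [measurable]: "D \<in> sets borel"
  proof -
    define g :: "nat \<Rightarrow> real \<Rightarrow> ennreal" where
      "g = (\<lambda>m x. \<integral>\<^sup>+r. (if 0 < r \<and> r < 1 / real (Suc m) \<and> (r, r * x) \<notin> A then 1 else 0) \<partial>lborel)"
    have [measurable]: "g m \<in> borel_measurable borel" for m
      unfolding g_def by measurable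
    have "(AE r in lborel. 0 < r \<and> r < 1 / real (Suc m) \<longrightarrow> (r, r * x) \<in> A) \<longleftrightarrow> g m x = 0" for m x
      unfolding g_def by (subst nn_integral_0_iff_AE) (auto intro!: AE_cong split: if_splits)
    then have "D = {x \<in> space borel. \<exists>m. g m x = 0}" by (simp add: D_def)
    also have "\<dots> \<in> sets borel" by measurable
    finally show ?thesis .
  qed
  \<comment> \<open>A matrix maps the ray of slope \<open>x\<close> to the ray of the transformed
    slope, stretched by the constant \<open>k > 0\<close>; this affects neither null sets nor germs
    at the origin.\<close>
  have D_inv1: "x \<in> D"
    if det: "a * d - b * c = 1" and pos: "0 < of_int a + of_int b * x"
      and x': "(of_int c + of_int d * x) / (of_int a + of_int b * x) \<in> D" for a b c d x
  proof -
    define k where "k = of_int a + of_int b * x"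
    have k: "0 < k" using pos by (simp add: k_def)
    obtain e where e: "0 < e" "AE r in lborel. 0 < r \<and> r < e \<longrightarrow> (r, r * ((of_int c + of_int d * x) / k)) \<in> A"
      using x' unfolding D_iff k_def by blast
    have "AE r in lborel. 0 < 0 + k * r \<and> 0 + k * r < e \<longrightarrow> (0 + k * r, (0 + k * r) * ((of_int c + of_int d * x) / k)) \<in> A"
      by (rule AE_borel_affine[OF _ _ e(2)]) (use k in auto)
    then have "AE r in lborel. 0 < r \<and> r < e / k \<longrightarrow> (r, r * x) \<in> A"
    proof eventually_elim
      case (elim r)
      show ?case
      proof
        assume r: "0 < r \<and> r < e / k"
        then have "0 < 0 + k * r \<and> 0 + k * r < e" using k by (simp add: field_simps)
        then have "(0 + k * r, (0 + k * r) * ((of_int c + of_int d * x) / k)) \<in> A" using elim by blast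
        moreover have "(0 + k * r) * ((of_int c + of_int d * x) / k) = r * (of_int c + of_int d * x)"
          using k by simp
        ultimately have "(k * r, r * (of_int c + of_int d * x)) \<in> A" by simp
        moreover have "sl2_act a b c d (r, r * x) = (k * r, r * (of_int c + of_int d * x))"
          by (simp add: sl2_act_def k_def algebra_simps)
        ultimately show "(r, r * x) \<in> A" using inv[OF det] by metis
      qed
    qed
    moreover have "0 < e / k" using e k by simp
    ultimately show ?thesis unfolding D_iff by blast
  qed
  have D_inv: "x \<in> D \<longleftrightarrow> (of_int c + of_int d * x) / (of_int a + of_int b * x) \<in> D"
    if det: "a * d - b * c = 1" and pos: "0 < of_int a + of_int b * x" for a b c d x
  proof
    assume "(of_int c + of_int d * x) / (of_int a + of_int b * x) \<in> D"
    then show "x \<in> D" by (rule D_inv1[OF det pos])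
  next
    assume x: "x \<in> D"
    define k where "k = of_int a + of_int b * x"
    define x' where "x' = (of_int c + of_int d * x) / k"
    have k: "0 < k" using pos by (simp add: k_def)
    have rdet: "of_int a * of_int d - of_int b * of_int c = (1 :: real)"
      using det by (metis of_int_1 of_int_diff of_int_mult)
    have 1: "of_int d + of_int (- b) * x' = 1 / k"
    proof -
      have "(of_int d + of_int (- b) * x') * k = of_int d * k - of_int b * (of_int c + of_int d * x)"
        using k by (simp add: x'_def field_simps)
      also have "\<dots> = 1" unfolding k_def using rdet by (simp add: algebra_simps)
      finally show ?thesis using k by (simp add: field_simps)
    qed
    have 2: "(of_int (- c) + of_int a * x') / (1 / k) = x"
    proof -
      have "(of_int (- c) + of_int a * x') * k = of_int a * (of_int c + of_int d * x) - of_int c * k"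
        using k by (simp add: x'_def field_simps)
      also have "\<dots> = (of_int a * of_int d - of_int b * of_int c) * x" unfolding k_def by (simp add: algebra_simps)
      finally show ?thesis using rdet by simp
    qed
    have "x' \<in> D"
    proof (rule D_inv1[of d a "- b" "- c"])
      show "d * a - - b * - c = 1" using det by (simp add: mult.commute)
      show "0 < real_of_int d + of_int (- b) * x'" unfolding 1 using k by simp
      show "(of_int (- c) + of_int a * x') / (of_int d + of_int (- b) * x') \<in> D" unfolding 1 2 by (rule x)
    qed
    then show "(of_int c + of_int d * x) / (of_int a + of_int b * x) \<in> D" by (simp add: x'_def k_def)
  qed
  have per: "1 + x \<in> D \<longleftrightarrow> x \<in> D" for x
    using D_inv[of 1 1 0 1 x] by simp
  have slope: "AE p in lborel. p \<in> bcz_domain \<longrightarrow> (p \<in> A \<longleftrightarrow> snd p / fst p \<in> D)"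
  proof -
    have "AE l in lborel. AE p in lborel. 0 < l \<and> l < 1 \<longrightarrow> p \<in> bcz_domain \<longrightarrow> (l *\<^sub>R p \<in> A \<longleftrightarrow> p \<in> A)"
    proof (rule AE_I2)
      fix l :: real
      show "AE p in lborel. 0 < l \<and> l < 1 \<longrightarrow> p \<in> bcz_domain \<longrightarrow> (l *\<^sub>R p \<in> A \<longleftrightarrow> p \<in> A)"
        using sl2_invariant_scaling[OF A inv, of l] by (cases "0 < l \<and> l < 1") auto
    qed
    \<comment> \<open>The exceptional null set of points depends on \<open>l\<close>. Exchanging the
      quantifiers by Fubini gives, for almost every point, the comparison along almost all of the
      segment to the origin.\<close>
    then have "AE p in lborel. AE l in lborel. 0 < l \<and> l < 1 \<longrightarrow> p \<in> bcz_domain \<longrightarrow> (l *\<^sub>R p \<in> A \<longleftrightarrow> p \<in> A)"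
    proof (rule lborel_pair.AE_commute[THEN iffD1, rotated])
      have "{x \<in> space (borel \<Otimes>\<^sub>M borel). 0 < fst x \<and> fst x < 1 \<longrightarrow> snd x \<in> bcz_domain \<longrightarrow> (fst x *\<^sub>R snd x \<in> A \<longleftrightarrow> snd x \<in> A)}
        \<in> sets (borel \<Otimes>\<^sub>M (borel :: (real \<times> real) measure))"
        by measurable
      then show "{x \<in> space (lborel \<Otimes>\<^sub>M lborel). 0 < fst x \<and> fst x < 1 \<longrightarrow> snd x \<in> bcz_domain \<longrightarrow> (fst x *\<^sub>R snd x \<in> A \<longleftrightarrow> snd x \<in> A)}
        \<in> sets (lborel \<Otimes>\<^sub>M (lborel :: (real \<times> real) measure))"
        by (simp add: space_pair_measure sets_pair_measure_cong[OF sets_lborel sets_lborel])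
    qed
    then show ?thesis
    proof eventually_elim
      case (elim p)
      show ?case
      proof
        assume p: "p \<in> bcz_domain"
        obtain s t where pe: "p = (s, t)" by (cases p)
        have s: "0 < s" using p by (simp add: pe bcz_domain_iff)
        have "AE r in lborel. 0 < 0 + (1 / s) * r \<and> 0 + (1 / s) * r < 1 \<longrightarrow> p \<in> bcz_domain \<longrightarrow> ((0 + (1 / s) * r) *\<^sub>R p \<in> A \<longleftrightarrow> p \<in> A)"
          by (rule AE_borel_affine[OF _ _ elim]) (use s in auto)
        then have *: "AE r in lborel. 0 < r \<and> r < s \<longrightarrow> ((r, r * (t / s)) \<in> A \<longleftrightarrow> p \<in> A)"
          by eventually_elim (use p s in \<open>auto simp: pe\<close>)
        show "p \<in> A \<longleftrightarrow> snd p / fst p \<in> D"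
        proof
          assume "p \<in> A"
          with * show "snd p / fst p \<in> D" unfolding D_iff using s by (auto simp: pe)
        next
          assume "snd p / fst p \<in> D"
          then obtain d where d: "0 < d" "AE r in lborel. 0 < r \<and> r < d \<longrightarrow> (r, r * (t / s)) \<in> A"
            unfolding D_iff by (auto simp: pe)
          show "p \<in> A"
          proof (rule ccontr)
            assume "p \<notin> A"
            have "AE r in lborel. \<not> (0 < r \<and> r < min s d)"
              using * d(2) by eventually_elim (use \<open>p \<notin> A\<close> in auto)
            then show False using not_AE_False_interval[of "min s d"] s d(1) by simp
          qed
        qed
      qed
    qed
  qed
  show ?thesis
  proof (cases "emeasure lborel (D \<inter> {0..1}) = 0")
    case True
    then have "D \<inter> {0..1} \<in> null_sets lborel" by (intro null_setsI) auto
    then have "AE x in lborel. x \<notin> D \<inter> {0..1}" by (rule AE_not_in)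
    then have "AE x in lborel. x \<in> {0..1} \<longrightarrow> x \<notin> D" by eventually_elim auto
    then have "AE x in lborel. 0 \<le> x \<longrightarrow> x \<notin> D"
      by (rule AE_periodic_nonneg) (use per in auto)
    then have "AE p in lborel. p \<in> bcz_domain \<longrightarrow> snd p / fst p \<notin> D"
      by (rule AE_slope) measurable
    with slope have "AE p in lborel. p \<in> bcz_domain \<longrightarrow> p \<notin> A"
      by eventually_elim auto
    then show ?thesis ..
  next
    case False
    have "emeasure lborel ({0<..<1} - D) = 0"
      by (rule moebius_ergodic_unit_interval[OF _ D_inv False]) auto
    then have "{0<..<1} - D \<in> null_sets lborel" by (intro null_setsI) auto
    then have "AE x in lborel. x \<notin> {0<..<1} - D" by (rule AE_not_in)
    moreover have "AE x in lborel. x \<noteq> (0::real)" "AE x in lborel. x \<noteq> (1::real)" by (rule AE_lborel_singleton)+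
    ultimately have "AE x in lborel. x \<in> {0..1} \<longrightarrow> x \<in> D"
      by eventually_elim auto
    then have "AE x in lborel. 0 \<le> x \<longrightarrow> x \<in> D"
      by (rule AE_periodic_nonneg) (use per in auto)
    then have "AE p in lborel. p \<in> bcz_domain \<longrightarrow> snd p / fst p \<in> D"
      by (rule AE_slope) measurable
    with slope have "AE p in lborel. p \<in> bcz_domain \<longrightarrow> p \<in> A"
      by eventually_elim auto
    then show ?thesis ..
  qed
qed

section \<open>SL(2,Z)-orbits inside the domain, and functions equivariant along them\<close>

lemma sl2_act_inverse:
  assumes "a * d - b * c = 1"
  shows "sl2_act d (- b) (- c) a (sl2_act a b c d p) = p"
proof -
  have 1: "d * a - b * c = 1" "a * d - c * b = 1" "d * b - b * d = 0" "- (c * a) + a * c = 0"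
    using assms by (simp_all add: mult.commute)
  have "sl2_act d (- b) (- c) a (sl2_act a b c d p) = sl2_act 1 0 0 1 p"
    unfolding sl2_act_sl2_act using 1 by (simp add: mult.commute)
  then show ?thesis by (simp add: sl2_act_def)
qed

lemma bcz_map_sl2: "bcz_map p = sl2_act 0 1 (- 1) \<lfloor>(1 + fst p) / snd p\<rfloor> p"
  by (cases p) (simp add: bcz_map_eq sl2_act_def)

text \<open>The induction is on the difference \<open>b / (s s')\<close> of the slopes, which drops by the return time, hence by at
  least 1, in every step.\<close>

lemma sl2_orbit_forward:
  assumes "p \<in> bcz_domain" "p' \<in> bcz_domain" "p' = sl2_act a b c d p" "a * d - b * c = 1" "0 \<le> b"
    and "of_int b \<le> real n * (fst p * fst p')"
  shows "\<exists>k. p' = (bcz_map ^^ k) p"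
  using assms
proof (induction n arbitrary: p a b c d)
  case 0
  obtain s t where p: "p = (s, t)" by (cases p)
  obtain s' t' where p': "p' = (s', t')" by (cases p')
  have st: "0 < s" "s \<le> 1" "0 < t" "t \<le> 1" "s + t > 1" "0 < s'" "s' \<le> 1" "0 < t'" "t' \<le> 1" "s' + t' > 1"
    using 0 by (auto simp: p p' bcz_domain_iff)
  have b: "b = 0" using 0 by simp
  have eq: "s' = of_int a * s" "t' = of_int c * s + of_int d * t"
    using 0(3) by (auto simp: p p' b sl2_act_def)
  have "0 < a" using eq(1) st by (simp add: zero_less_mult_iff)
  moreover have "a * d = 1" using 0 b by simp
  ultimately have ad: "a = 1" "d = 1" by (auto simp: zmult_eq_1_iff)
  \<comment> \<open>Both \<open>t\<close> and \<open>t' = c s + t\<close> lie in the window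
    \<open>{1 - s<..1}\<close>, which has length \<open>s\<close>.\<close>
  have "c = 0"
  proof (rule ccontr)
    assume "c \<noteq> 0"
    then consider "1 \<le> c" | "c \<le> - 1" by linarith
    then show False
    proof cases
      case 1
      then have "1 * s \<le> of_int c * s" using st by (intro mult_right_mono) auto
      then show False using eq st unfolding ad of_int_1 by linarith
    next
      case 2
      then have "of_int c * s \<le> (- 1) * s" using st by (intro mult_right_mono) auto
      then show False using eq st unfolding ad of_int_1 by linarith
    qed
  qed
  then have "p' = p" using eq ad by (simp add: p p')
  then show ?case by (intro exI[of _ 0]) simp
next
  case (Suc n)
  obtain s t where p: "p = (s, t)" by (cases p)
  obtain s' t' where p': "p' = (s', t')" by (cases p')
  have st: "0 < s" "s \<le> 1" "0 < t" "t \<le> 1" "s + t > 1" "0 < s'" "s' \<le> 1" "0 < t'" "t' \<le> 1" "s' + t' > 1"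
    using Suc.prems by (auto simp: p p' bcz_domain_iff)
  show ?case
  proof (cases "b = 0")
    case True
    then show ?thesis using Suc.IH[OF Suc.prems(1-5)] st by (simp add: p p')
  next
    case False
    then have b: "1 \<le> b" using Suc.prems by simp
    have eq: "s' = of_int a * s + of_int b * t"
      using Suc.prems(3) by (auto simp: p p' sl2_act_def)
    \<comment> \<open>Otherwise \<open>s' \<ge> s + t > 1\<close>. This sign is the hypothesis
      \<open>0 \<le> b\<close> of the next step, whose upper right entry is
      \<open>- a\<close>.\<close>
    have a: "a \<le> 0"
    proof (rule ccontr)
      assume "\<not> a \<le> 0"
      then have "1 * s \<le> of_int a * s" "1 * t \<le> of_int b * t"
        using b st by (intro mult_right_mono; simp)+
      then show False using eq st by linarith
    qed
    define K where "K = \<lfloor>(1 + fst p) / snd p\<rfloor>"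
    have "sl2_act (a * K + b) (- a) (c * K + d) (- c) (bcz_map p) = p'"
      unfolding bcz_map_sl2 K_def[symmetric] sl2_act_sl2_act Suc.prems(3) by (simp add: algebra_simps)
    moreover have "(a * K + b) * (- c) - (- a) * (c * K + d) = 1"
      using Suc.prems(4) by (simp add: algebra_simps)
    \<comment> \<open>Dividing \<open>- a * s = b * t - s'\<close> by \<open>s * t * s'\<close>
      gives \<open>- a / (t s') = b / (s s') - 1 / (s t)\<close>: the slope difference has lost one
      return time.\<close>
    moreover have "real_of_int (- a) \<le> real n * (fst (bcz_map p) * fst p')"
    proof -
      have "real_of_int (- a) * s = of_int b * t - s'" using eq by simp
      also have "\<dots> \<le> real (Suc n) * (s * s') * t - s'"
        using Suc.prems(6) st by (intro diff_right_mono mult_right_mono) (auto simp: p p')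
      also have "\<dots> = real n * (t * s') * s - (1 - s * t) * s'" by (simp add: algebra_simps)
      also have "\<dots> \<le> real n * (t * s') * s"
        using st mult_mono[of s 1 t 1] by simp
      finally have "real_of_int (- a) \<le> real n * (t * s')" using mult_right_le_imp_le st(1) by blast
      then show ?thesis by (simp add: p p' bcz_map_eq)
    qed
    ultimately have "\<exists>k. p' = (bcz_map ^^ k) (bcz_map p)"
      using Suc.IH[OF bcz_map_in[OF Suc.prems(1)] Suc.prems(2), of "a * K + b" "- a" "c * K + d" "- c"] a by auto
    then obtain k where "p' = (bcz_map ^^ Suc k) p" by (auto simp: funpow_swap1)
    then show ?thesis by blast
  qed
qed

text \<open>The sign of \<open>b\<close> tells which point comes earlier on the orbit; inverting the
  matrix changes it.\<close>

lemma sl2_orbit_bcz: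
  assumes p: "p \<in> bcz_domain" and p': "p' \<in> bcz_domain" and eq: "p' = sl2_act a b c d p" and det: "a * d - b * c = 1"
  shows "(\<exists>k. p' = (bcz_map ^^ k) p) \<or> (\<exists>k. p = (bcz_map ^^ k) p')"
proof -
  have pos: "0 < fst p * fst p'" using p p' by (cases p; cases p') (auto simp: bcz_domain_iff)
  have arch: "\<exists>n::nat. x \<le> real n * (fst p * fst p')" for x
    using reals_Archimedean3[OF pos] by (meson less_imp_le)
  show ?thesis
  proof (cases "0 \<le> b")
    case True
    obtain n :: nat where "of_int b \<le> real n * (fst p * fst p')" using arch by blast
    then show ?thesis using sl2_orbit_forward[OF p p' eq det True] by blast
  next
    case False
    obtain n :: nat where "of_int (- b) \<le> real n * (fst p' * fst p)" using arch by (metis mult.commute)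
    moreover have "p = sl2_act d (- b) (- c) a p'" using sl2_act_inverse[OF det] eq by simp
    moreover have "d * a - (- b) * (- c) = 1" using det by (simp add: mult.commute)
    ultimately show ?thesis using sl2_orbit_forward[OF p' p, of d "- b" "- c" a n] False by auto
  qed
qed

lemma sl2_act_vimage_null:
  assumes det: "a * d - b * c = 1" and N: "N \<in> null_sets lborel"
  shows "{p. sl2_act a b c d p \<in> N} \<in> null_sets lborel"
proof -
  have Nb [measurable]: "N \<in> sets borel" using N by auto
  have meas: "{p. sl2_act a b c d p \<in> N} \<in> sets borel"
    by (rule Collect_measurable_borel) measurable
  have det': "d * a - (- b) * (- c) = 1" using det by (simp add: mult.commute)
  have "{p. sl2_act a b c d p \<in> N} = sl2_act d (- b) (- c) a ` N"
  proof (intro set_eqI iffI)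
    fix p assume "p \<in> {p. sl2_act a b c d p \<in> N}"
    then show "p \<in> sl2_act d (- b) (- c) a ` N" using sl2_act_inverse[OF det, of p] by (metis image_eqI mem_Collect_eq)
  next
    fix p assume "p \<in> sl2_act d (- b) (- c) a ` N"
    then show "p \<in> {p. sl2_act a b c d p \<in> N}" using sl2_act_inverse[OF det'] by auto
  qed
  moreover have "negligible (sl2_act d (- b) (- c) a ` N)"
  proof (rule negligible_differentiable_image_negligible)
    have "linear (sl2_act d (- b) (- c) a)"
      by (rule linearI) (simp_all add: sl2_act_def algebra_simps)
    then show "sl2_act d (- b) (- c) a differentiable_on N"
      by (rule linear_imp_differentiable_on)
    show "negligible N" using N Nb by (simp add: negligible_iff_null_sets null_sets_completion_iff)
  qed simp
  ultimately show ?thesis using meas by (simp add: negligible_iff_null_sets null_sets_completion_iff)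
qed

text \<open>The points violating the equation form a null set, and so does its saturation
  \<open>Sat\<close> under the countable group. \<open>Sat\<close> is invariant, so replacing
  \<open>f\<close> by 0 there creates no new violation. Arguments that follow whole orbits, also of
  rescaled points, can then ignore null sets.\<close>

lemma bcz_equivariant_version:
  fixes f :: "real \<times> real \<Rightarrow> complex"
  assumes f [measurable]: "f \<in> borel_measurable borel"
    and eig: "AE p in lborel. p \<in> bcz_domain \<longrightarrow> f (bcz_map p) = \<alpha> * f p"
  obtains f' where "f' \<in> borel_measurable borel" "\<And>p. p \<in> bcz_domain \<Longrightarrow> f' (bcz_map p) = \<alpha> * f' p"
    "AE p in lborel. f' p = f p" "\<And>p. f' p = f p \<or> f' p = 0"
proof -
  define Bad where "Bad = {p. p \<in> bcz_domain \<and> f (bcz_map p) \<noteq> \<alpha> * f p}"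
  have [measurable]: "Bad \<in> sets borel"
    unfolding Bad_def by (rule Collect_measurable_borel) measurable
  have Bad: "Bad \<in> null_sets lborel"
  proof (rule null_setsI)
    show "emeasure lborel Bad = 0"
      using eig by (subst (asm) AE_iff_measurable[where N = Bad]) (auto simp: Bad_def)
  qed simp
  define G where "G = {(a, b, c, d). a * d - b * c = (1::int)}"
  define Sat where "Sat = (\<Union>(a, b, c, d)\<in>G. {p. sl2_act a b c d p \<in> Bad})"
  have Sat: "Sat \<in> null_sets lborel"
    unfolding Sat_def by (rule null_sets_UN') (auto simp: G_def intro!: sl2_act_vimage_null Bad)
  then have [measurable]: "Sat \<in> sets borel" by auto
  have Sat_iff: "p \<in> Sat \<longleftrightarrow> (\<exists>a b c d. a * d - b * c = 1 \<and> sl2_act a b c d p \<in> Bad)" for p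
    by (auto simp: Sat_def G_def)
  have Sat1: "p \<in> Sat" if g: "sl2_act a b c d p \<in> Sat" "a * d - b * c = 1" for a b c d p
  proof -
    obtain a' b' c' d' where "a' * d' - b' * c' = 1" "sl2_act a' b' c' d' (sl2_act a b c d p) \<in> Bad"
      using g(1) unfolding Sat_iff by blast
    then show ?thesis unfolding sl2_act_sl2_act Sat_iff using sl2_det_mult[OF g(2)] by blast
  qed
  have Sat2: "sl2_act a b c d p \<in> Sat \<longleftrightarrow> p \<in> Sat" if det: "a * d - b * c = 1" for a b c d p
  proof
    assume "p \<in> Sat"
    then have "sl2_act d (- b) (- c) a (sl2_act a b c d p) \<in> Sat" using sl2_act_inverse[OF det] by simp
    moreover have "d * a - (- b) * (- c) = 1" using det by (simp add: mult.commute)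
    ultimately show "sl2_act a b c d p \<in> Sat" by (rule Sat1)
  qed (rule Sat1[OF _ det])
  have Sat3: "bcz_map p \<in> Sat \<longleftrightarrow> p \<in> Sat" for p
    unfolding bcz_map_sl2 by (rule Sat2) simp
  have Bad_Sat: "p \<in> Sat" if "p \<in> Bad" for p
    unfolding Sat_iff by (rule exI[of _ 1], rule exI[of _ 0], rule exI[of _ 0], rule exI[of _ 1])
      (use that in \<open>simp add: sl2_act_def\<close>)
  show ?thesis
  proof (rule that[of "\<lambda>p. if p \<in> Sat then 0 else f p"])
    show "(\<lambda>p. if p \<in> Sat then 0 else f p) \<in> borel_measurable borel" by measurable
    show "AE p in lborel. (if p \<in> Sat then 0 else f p) = f p"
      using AE_not_in[OF Sat] by eventually_elim simp
    show "(if bcz_map p \<in> Sat then 0 else f (bcz_map p)) = \<alpha> * (if p \<in> Sat then 0 else f p)"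
      if "p \<in> bcz_domain" for p
      using that Bad_Sat[of p] Sat3[of p] by (auto simp: Bad_def)
  qed auto
qed

lemma not_AE_bcz_domain: "\<not> (AE p in lborel. p \<notin> bcz_domain)"
proof
  assume "AE p in lborel. p \<notin> bcz_domain"
  then have "emeasure lborel bcz_domain = 0"
    by (subst (asm) AE_iff_measurable[where N = bcz_domain]) auto
  then show False by (simp add: emeasure_bcz_domain)
qed

text \<open>The saturation of a level set meets the domain only in that level set, so every Borel
  set has a null or a conull preimage. The union \<open>W\<close> of the basic open sets with null
  preimage is not everything, and any \<open>z\<close> outside it is the almost sure value: each
  basic neighbourhood of \<open>z\<close> has conull preimage, and countably many of them shrink to
  \<open>z\<close>.\<close>

lemma bcz_invariant_const:
  fixes f :: "real \<times> real \<Rightarrow> complex"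
  assumes f: "f \<in> borel_measurable borel"
    and inv: "AE p in lborel. p \<in> bcz_domain \<longrightarrow> f (bcz_map p) = f p"
  shows "\<exists>z. AE p in lborel. p \<in> bcz_domain \<longrightarrow> f p = z"
proof -
  have "AE p in lborel. p \<in> bcz_domain \<longrightarrow> f (bcz_map p) = 1 * f p" using inv by simp
  then obtain f' where f' [measurable]: "f' \<in> borel_measurable borel"
    and inv': "\<And>p. p \<in> bcz_domain \<Longrightarrow> f' (bcz_map p) = 1 * f' p"
    and ae: "AE p in lborel. f' p = f p"
    by (rule bcz_equivariant_version[OF f]) (rule that)
  have pow: "f' ((bcz_map ^^ k) p) = f' p \<and> (bcz_map ^^ k) p \<in> bcz_domain" if "p \<in> bcz_domain" for k p
    using that by (induction k) (auto simp: inv' bcz_map_in)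
  have zero_one: "(AE p in lborel. p \<in> bcz_domain \<longrightarrow> f' p \<in> Y) \<or> (AE p in lborel. p \<in> bcz_domain \<longrightarrow> f' p \<notin> Y)"
    if [measurable]: "Y \<in> sets borel" for Y
  proof -
    define B where "B = {p. p \<in> bcz_domain \<and> f' p \<in> Y}"
    have [measurable]: "B \<in> sets borel"
      unfolding B_def by (rule Collect_measurable_borel) measurable
    define G where "G = {(a, b, c, d). a * d - b * c = (1::int)}"
    define A where "A = (\<Union>(a, b, c, d)\<in>G. {p. sl2_act a b c d p \<in> B})"
    have A_iff: "p \<in> A \<longleftrightarrow> (\<exists>a b c d. a * d - b * c = 1 \<and> sl2_act a b c d p \<in> B)" for p
      by (auto simp: A_def G_def)
    have A: "A \<in> sets borel"
      unfolding A_def by (rule sets.countable_UN') (auto intro!: Collect_measurable_borel)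
    have A1: "p \<in> A" if g: "sl2_act a b c d p \<in> A" "a * d - b * c = 1" for a b c d p
    proof -
      obtain a' b' c' d' where "a' * d' - b' * c' = 1" "sl2_act a' b' c' d' (sl2_act a b c d p) \<in> B"
        using g(1) unfolding A_iff by blast
      then show ?thesis unfolding sl2_act_sl2_act A_iff using sl2_det_mult[OF g(2)] by blast
    qed
    have A2: "sl2_act a b c d p \<in> A \<longleftrightarrow> p \<in> A" if det: "a * d - b * c = 1" for a b c d p
    proof
      assume "p \<in> A"
      then have "sl2_act d (- b) (- c) a (sl2_act a b c d p) \<in> A" using sl2_act_inverse[OF det] by simp
      moreover have "d * a - (- b) * (- c) = 1" using det by (simp add: mult.commute)
      ultimately show "sl2_act a b c d p \<in> A" by (rule A1)
    qed (rule A1[OF _ det])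
    have "p \<in> A \<longleftrightarrow> f' p \<in> Y" if p: "p \<in> bcz_domain" for p
    proof
      assume "p \<in> A"
      then obtain a b c d where g: "a * d - b * c = 1" "sl2_act a b c d p \<in> B" unfolding A_iff by blast
      then have "sl2_act a b c d p \<in> bcz_domain" "f' (sl2_act a b c d p) \<in> Y" by (auto simp: B_def)
      with sl2_orbit_bcz[OF p this(1) refl g(1)] pow p show "f' p \<in> Y" by metis
    next
      assume "f' p \<in> Y"
      then show "p \<in> A"
        unfolding A_iff by (intro exI[of _ 1] exI[of _ 0])
          (use p in \<open>simp add: B_def sl2_act_def\<close>)
    qed
    with sl2_invariant_trivial[OF A A2] show ?thesis
      by (auto elim: eventually_mono)
  qed
  obtain \<B> :: "complex set set" where \<B>: "countable \<B>" "topological_basis \<B>"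
    using ex_countable_basis by blast
  define W where "W = {b \<in> \<B>. AE p in lborel. p \<in> bcz_domain \<longrightarrow> f' p \<notin> b}"
  have cW: "countable W" using \<B>(1) by (auto simp: W_def intro: countable_subset)
  have "AE p in lborel. \<forall>b\<in>W. p \<in> bcz_domain \<longrightarrow> f' p \<notin> b"
    unfolding AE_ball_countable[OF cW] by (auto simp: W_def)
  then have W: "AE p in lborel. p \<in> bcz_domain \<longrightarrow> f' p \<notin> \<Union>W"
    by eventually_elim auto
  have "\<Union>W \<noteq> UNIV"
  proof
    assume "\<Union>W = UNIV"
    with W have "AE p in lborel. p \<notin> bcz_domain" by (simp only: UNIV_I not_True_eq_False imp_conv_disj simp_thms)
    then show False using not_AE_bcz_domain by simp
  qed
  then obtain z where z: "z \<notin> \<Union>W" by auto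
  define V where "V = {b \<in> \<B>. z \<in> b}"
  have cV: "countable V" using \<B>(1) by (auto simp: V_def intro: countable_subset)
  have "AE p in lborel. \<forall>b\<in>V. p \<in> bcz_domain \<longrightarrow> f' p \<in> b"
    unfolding AE_ball_countable[OF cV]
  proof
    fix b assume b: "b \<in> V"
    then have "open b" using topological_basis_open[OF \<B>(2)] by (auto simp: V_def)
    then have "b \<in> sets borel" by simp
    moreover have "b \<notin> W" using b z by (auto simp: V_def)
    ultimately show "AE p in lborel. p \<in> bcz_domain \<longrightarrow> f' p \<in> b"
      using zero_one[of b] b by (auto simp: W_def V_def)
  qed
  with ae have "AE p in lborel. p \<in> bcz_domain \<longrightarrow> f p = z"
  proof eventually_elim
    case (elim p)
    show ?case
    proof (intro impI, rule ccontr)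
      assume p: "p \<in> bcz_domain" and ne: "f p \<noteq> z"
      obtain b where "b \<in> \<B>" "z \<in> b" "b \<subseteq> - {f p}"
        using topological_basisE[OF \<B>(2), of "- {f p}" z] ne by auto
      then show False using elim p by (auto simp: V_def)
    qed
  qed
  then show ?thesis by blast
qed

section \<open>Self-similarity and the thin strip\<close>

text \<open>For \<open>s > 0\<close>, the representative of \<open>(s, t)\<close> modulo integer
  multiples of \<open>s\<close> in the second coordinate that lies in \<open>{1 - s<..1}\<close>:
  the normalisation of the second basis vector used by the domain.\<close>

definition reduce :: "real \<times> real \<Rightarrow> real \<times> real" where
  "reduce p = (fst p, snd p + of_int \<lfloor>(1 - snd p) / fst p\<rfloor> * fst p)"

lemma reduce_measurable [measurable]: "reduce \<in> borel_measurable borel"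
proof -
  have "reduce \<in> (borel \<Otimes>\<^sub>M borel) \<rightarrow>\<^sub>M (borel \<Otimes>\<^sub>M borel)"
    unfolding reduce_def by measurable
  then show ?thesis by (simp only: borel_prod)
qed

lemma bcz_map_reduce: "bcz_map (s, t) = reduce (t, - s)"
  by (simp add: bcz_map_eq reduce_def)

lemma reduce_shift: "s \<noteq> 0 \<Longrightarrow> reduce (s, t + of_int k * s) = reduce (s, t)"
proof -
  assume s: "s \<noteq> 0"
  have "(1 - (t + of_int k * s)) / s = (1 - t) / s - of_int k" using s by (simp add: field_simps)
  then have "\<lfloor>(1 - (t + of_int k * s)) / s\<rfloor> = \<lfloor>(1 - t) / s\<rfloor> - k" by simp
  then show ?thesis
    by (simp only: reduce_def fst_conv snd_conv) (simp add: algebra_simps)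
qed

lemma reduce_id: "p \<in> bcz_domain \<Longrightarrow> reduce p = p"
proof -
  assume p: "p \<in> bcz_domain"
  obtain s t where pe: "p = (s, t)" by (cases p)
  have "0 \<le> (1 - t) / s" "(1 - t) / s < 1" using p by (auto simp: pe bcz_domain_iff field_simps)
  then have "\<lfloor>(1 - t) / s\<rfloor> = 0" by linarith
  then show ?thesis by (simp add: pe reduce_def)
qed

lemma reduce_scaled_bcz_map:
  assumes "t \<noteq> 0" "l \<noteq> 0"
  shows "reduce (l *\<^sub>R bcz_map (s, t)) = reduce (l * t, - (l * s))"
  using reduce_shift[of "l * t" "- (l * s)" "\<lfloor>(1 + s) / t\<rfloor>"] assms
  by (simp add: bcz_map_eq algebra_simps)

text \<open>Scaling by \<open>l < 1\<close> conjugates the map to its first return to \<open>{s \<le> l}\<close> -- the self-similarity of the map.\<close>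

lemma scaled_step_off:
  assumes p: "(s, t) \<in> bcz_domain" and l: "0 < l" "l < 1" and st: "1 < l * (s + t)"
  shows "reduce (l *\<^sub>R bcz_map (s, t)) = bcz_map (reduce (l *\<^sub>R (s, t)))" "reduce (l *\<^sub>R (s, t)) \<in> bcz_domain"
proof -
  have st': "0 < s" "s \<le> 1" "0 < t" "t \<le> 1" using p by (auto simp: bcz_domain_iff)
  have "l * s \<le> 1" "l * t \<le> 1" using st' l by (auto intro!: mult_le_one)
  then have in_dom: "(l * s, l * t) \<in> bcz_domain" using st' l st by (simp add: bcz_domain_iff algebra_simps)
  then show "reduce (l *\<^sub>R (s, t)) \<in> bcz_domain" by (simp add: reduce_id)
  show "reduce (l *\<^sub>R bcz_map (s, t)) = bcz_map (reduce (l *\<^sub>R (s, t)))"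
    using st' l by (simp add: reduce_id[OF in_dom] reduce_scaled_bcz_map) (simp add: bcz_map_reduce)
qed

text \<open>On the strip the sum of the two basis vectors remains short after scaling and becomes an
  additional stop: the path is \<open>(l s, l (s + t))\<close>, \<open>(l (s + t), l t)\<close>, and
  then the reduced scaled image. The two conditions \<open>mid\<close> say that both stops lie in
  the domain; near the corners they can fail.\<close>

lemma scaled_step_on:
  assumes p: "(s, t) \<in> bcz_domain" and l: "0 < l" "l < 1" and st: "l * (s + t) \<le> 1"
    and mid: "1 < l * (2 * s + t)" "1 < l * (s + 2 * t)"
  shows "reduce (l *\<^sub>R bcz_map (s, t)) = bcz_map (bcz_map (reduce (l *\<^sub>R (s, t))))"
    "reduce (l *\<^sub>R (s, t)) \<in> bcz_domain"
proof -
  have st': "0 < s" "s \<le> 1" "0 < t" "t \<le> 1" using p by (auto simp: bcz_domain_iff)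
  have le: "l * s \<le> 1" "l * t \<le> 1" using st' l by (auto intro!: mult_le_one)
  have y: "(l * s, l * (s + t)) \<in> bcz_domain"
    using st' l st mid le by (simp add: bcz_domain_iff algebra_simps)
  have y2: "(l * (s + t), l * t) \<in> bcz_domain"
    using st' l st mid le by (simp add: bcz_domain_iff algebra_simps)
  have "reduce (l *\<^sub>R (s, t)) = reduce (l * s, l * (s + t))"
    using reduce_shift[of "l * s" "l * t" 1] st' l by (simp add: algebra_simps)
  then have 1: "reduce (l *\<^sub>R (s, t)) = (l * s, l * (s + t))" using reduce_id[OF y] by simp
  then show "reduce (l *\<^sub>R (s, t)) \<in> bcz_domain" using y by simp
  have pos: "0 < l * s + l * t" using st' l by (intro add_pos_pos) auto
  have "bcz_map (l * s, l * (s + t)) = reduce (l * (s + t), l * t)"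
    using pos reduce_shift[of "l * (s + t)" "- (l * s)" 1] st' l by (simp add: bcz_map_reduce algebra_simps)
  then have 2: "bcz_map (l * s, l * (s + t)) = (l * (s + t), l * t)" using reduce_id[OF y2] by simp
  have "bcz_map (l * (s + t), l * t) = reduce (l * t, - (l * s))"
    using reduce_shift[of "l * t" "- (l * s)" "-1"] st' l by (simp add: bcz_map_reduce algebra_simps)
  then show "reduce (l *\<^sub>R bcz_map (s, t)) = bcz_map (bcz_map (reduce (l *\<^sub>R (s, t))))"
    unfolding 1 2 using st' l by (simp add: reduce_scaled_bcz_map)
qed

section \<open>The thin strip and its visits by the flow\<close>

definition thin_strip :: "real \<Rightarrow> (real \<times> real) set" where
  "thin_strip h = {p \<in> bcz_domain. fst p + snd p \<le> 1 + h}"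

text \<open>With coordinates at least \<open>1 / 8\<close> and \<open>h < 1 / 8\<close>, the
  conditions \<open>2 s + t > 1 + h\<close> and \<open>s + 2 t > 1 + h\<close> follow from
  \<open>s + t > 1\<close>, so scaling by \<open>1 / (1 + h)\<close> inserts exactly one additional
  step.\<close>

definition strip_core :: "real \<Rightarrow> (real \<times> real) set" where
  "strip_core h = {p \<in> thin_strip h. 1 / 8 \<le> fst p \<and> 1 / 8 \<le> snd p}"

text \<open>A visit is counted only in the time unit in which the flow leaves the fibre. Each
  passage thus counts once, however long the fibre, and since fibres have length at least 1 the
  measure of \<open>exits B\<close> is the area of \<open>B\<close>.\<close>

definition exits :: "(real \<times> real) set \<Rightarrow> ((real \<times> real) \<times> real) set" where
  "exits B = {x \<in> suspension. fst x \<in> B \<and> return_time (fst x) \<le> snd x + 1}"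

lemma thin_strip_measurable [measurable]: "thin_strip h \<in> sets borel"
  unfolding thin_strip_def by measurable

lemma strip_core_measurable [measurable]: "strip_core h \<in> sets borel"
  unfolding strip_core_def by measurable

lemma exits_measurable [measurable]:
  assumes [measurable]: "B \<in> sets borel" shows "exits B \<in> sets borel"
  unfolding exits_def by measurable

lemma emeasure_exits:
  assumes [measurable]: "B \<in> sets borel" and sub: "B \<subseteq> bcz_domain"
  shows "emeasure suspension_measure (exits B) = emeasure lborel B"
proof -
  have "emeasure suspension_measure (exits B) = (\<integral>\<^sup>+x. indicator (exits B) x \<partial>suspension_measure)" by simp
  also have "\<dots> = (\<integral>\<^sup>+p. indicator B p \<partial>lborel)"
  proof (subst nn_integral_suspension, measurable, rule nn_integral_cong)
    fix p
    show "(\<integral>\<^sup>+u. indicator (exits B) (p, u) * indicator {0..<return_time p} u \<partial>lborel) * indicator bcz_domain p = indicator B p"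
    proof (cases "p \<in> B")
      case True
      then have p: "p \<in> bcz_domain" using sub by auto
      have r: "1 \<le> return_time p" using return_time_ge_1[OF p] .
      have "(\<integral>\<^sup>+u. indicator (exits B) (p, u) * indicator {0..<return_time p} u \<partial>lborel)
         = (\<integral>\<^sup>+u. indicator {return_time p - 1..<return_time p} u \<partial>lborel)"
        using True p r by (intro nn_integral_cong) (auto simp: exits_def suspension_def indicator_def)
      also have "\<dots> = 1" by simp
      finally show ?thesis using True p by simp
    next
      case False
      then show ?thesis by (simp add: exits_def)
    qed
  qed
  finally show ?thesis by simp
qed

lemma emeasure_diagonal_strip:
  assumes "a \<le> b" "0 \<le> h"
  shows "emeasure lborel {p :: real \<times> real. a \<le> fst p \<and> fst p \<le> b \<and> 1 < fst p + snd p \<and> fst p + snd p \<le> 1 + h} = ennreal ((b - a) * h)"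
    and "emeasure lborel {p :: real \<times> real. a \<le> snd p \<and> snd p \<le> b \<and> 1 < fst p + snd p \<and> fst p + snd p \<le> 1 + h} = ennreal ((b - a) * h)"
proof -
  have [measurable]: "{p :: real \<times> real. a \<le> fst p \<and> fst p \<le> b \<and> 1 < fst p + snd p \<and> fst p + snd p \<le> 1 + h} \<in> sets borel"
    by (rule Collect_measurable_borel) measurable
  have [measurable]: "{p :: real \<times> real. a \<le> snd p \<and> snd p \<le> b \<and> 1 < fst p + snd p \<and> fst p + snd p \<le> 1 + h} \<in> sets borel"
    by (rule Collect_measurable_borel) measurable
  have fib: "(\<integral>\<^sup>+s. ennreal h * indicator {a..b} s \<partial>lborel) = ennreal ((b - a) * h)"
    using assms by (subst nn_integral_cmult_indicator) (auto simp: ennreal_mult[symmetric] mult.commute)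
  have "emeasure lborel {p :: real \<times> real. a \<le> fst p \<and> fst p \<le> b \<and> 1 < fst p + snd p \<and> fst p + snd p \<le> 1 + h}
     = (\<integral>\<^sup>+p. indicator {p :: real \<times> real. a \<le> fst p \<and> fst p \<le> b \<and> 1 < fst p + snd p \<and> fst p + snd p \<le> 1 + h} p \<partial>lborel)"
    by simp
  also have "\<dots> = (\<integral>\<^sup>+s. \<integral>\<^sup>+t. indicator {a..b} s * indicator {1 - s<..1 - s + h} t \<partial>lborel \<partial>lborel)"
    by (subst nn_integral_lborel_pair) (auto intro!: nn_integral_cong simp: indicator_def)
  also have "\<dots> = (\<integral>\<^sup>+s. ennreal h * indicator {a..b} s \<partial>lborel)"
    using assms by (intro nn_integral_cong) (simp add: nn_integral_cmult_indicator mult.commute)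
  finally show "emeasure lborel {p :: real \<times> real. a \<le> fst p \<and> fst p \<le> b \<and> 1 < fst p + snd p \<and> fst p + snd p \<le> 1 + h} = ennreal ((b - a) * h)"
    using fib by simp
  have "emeasure lborel {p :: real \<times> real. a \<le> snd p \<and> snd p \<le> b \<and> 1 < fst p + snd p \<and> fst p + snd p \<le> 1 + h}
     = (\<integral>\<^sup>+p. indicator {p :: real \<times> real. a \<le> snd p \<and> snd p \<le> b \<and> 1 < fst p + snd p \<and> fst p + snd p \<le> 1 + h} p \<partial>lborel)"
    by simp
  also have "\<dots> = (\<integral>\<^sup>+s. \<integral>\<^sup>+t. indicator {a..b} s * indicator {1 - s<..1 - s + h} t \<partial>lborel \<partial>lborel)"
    by (subst nn_integral_lborel_pair_swap) (auto intro!: nn_integral_cong simp: indicator_def)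
  also have "\<dots> = (\<integral>\<^sup>+s. ennreal h * indicator {a..b} s \<partial>lborel)"
    using assms by (intro nn_integral_cong) (simp add: nn_integral_cmult_indicator mult.commute)
  finally show "emeasure lborel {p :: real \<times> real. a \<le> snd p \<and> snd p \<le> b \<and> 1 < fst p + snd p \<and> fst p + snd p \<le> 1 + h} = ennreal ((b - a) * h)"
    using fib by simp
qed

text \<open>Where the abscissa is between \<open>1 / 8\<close> and \<open>7 / 8\<close>, the full
  width of the strip belongs to the core.\<close>

lemma strip_core_ge:
  assumes "0 \<le> h" "h \<le> 1 / 8"
  shows "ennreal (3 / 4 * h) \<le> emeasure lborel (strip_core h)"
proof -
  have "ennreal (3 / 4 * h) = emeasure lborel {p :: real \<times> real. 1 / 8 \<le> fst p \<and> fst p \<le> 7 / 8 \<and> 1 < fst p + snd p \<and> fst p + snd p \<le> 1 + h}"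
    using assms by (subst emeasure_diagonal_strip) auto
  also have "\<dots> \<le> emeasure lborel (strip_core h)"
    using assms by (intro emeasure_mono) (auto simp: strip_core_def thin_strip_def bcz_domain_iff)
  finally show ?thesis .
qed

lemma strip_corner_le:
  assumes "0 \<le> h"
  shows "emeasure lborel (thin_strip h - strip_core h) \<le> ennreal (1 / 4 * h)"
proof -
  let ?A = "{p :: real \<times> real. 0 \<le> fst p \<and> fst p \<le> 1 / 8 \<and> 1 < fst p + snd p \<and> fst p + snd p \<le> 1 + h}"
  let ?B = "{p :: real \<times> real. 0 \<le> snd p \<and> snd p \<le> 1 / 8 \<and> 1 < fst p + snd p \<and> fst p + snd p \<le> 1 + h}"
  have [measurable]: "?A \<in> sets borel" "?B \<in> sets borel"
    by (rule Collect_measurable_borel, measurable)+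
  have "emeasure lborel (thin_strip h - strip_core h) \<le> emeasure lborel (?A \<union> ?B)"
    by (intro emeasure_mono) (auto simp: strip_core_def thin_strip_def bcz_domain_iff)
  also have "\<dots> \<le> emeasure lborel ?A + emeasure lborel ?B"
    by (intro emeasure_subadditive) auto
  also have "\<dots> = ennreal (1 / 8 * h) + ennreal (1 / 8 * h)"
    using emeasure_diagonal_strip[of 0 "1 / 8" h] assms by simp
  also have "\<dots> = ennreal (1 / 4 * h)" using assms by (simp add: ennreal_plus[symmetric] del: ennreal_plus)
  finally show ?thesis .
qed

section \<open>Second moment: two visits to the strip at different times\<close>

definition echo_strip :: "real \<Rightarrow> int \<Rightarrow> (real \<times> real) set" where
  "echo_strip h D = (\<Union>a\<in>{- (\<bar>D\<bar> + 1)..\<bar>D\<bar> + 1}. {p. 1 < fst p + snd p \<and> fst p + snd p \<le> 1 + h \<and>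
     1 < of_int a * (fst p + snd p) + of_int D * snd p \<and> of_int a * (fst p + snd p) + of_int D * snd p \<le> 1 + h})"

lemma echo_strip_measurable [measurable]: "echo_strip h D \<in> sets borel"
  unfolding echo_strip_def by (rule sets.finite_UN) (auto intro!: Collect_measurable_borel)

text \<open>In the coordinates \<open>x = s + t\<close> and \<open>y = a x + D t\<close>, with
  Jacobian \<open>\<bar>D\<bar>\<close>, each set of the union is a square of side \<open>h\<close>.
  There are \<open>2 * \<bar>D\<bar> + 3 \<le> 5 * \<bar>D\<bar>\<close> values of \<open>a\<close>,
  so the growth of the union cancels against the Jacobian.\<close>

lemma emeasure_echo_strip:
  assumes h: "0 \<le> h" and D: "D \<noteq> 0"
  shows "emeasure lborel (echo_strip h D) \<le> ennreal (5 * h\<^sup>2)"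
proof -
  define S where "S = (\<lambda>a::int. {p :: real \<times> real. 1 < fst p + snd p \<and> fst p + snd p \<le> 1 + h \<and>
     1 < of_int a * (fst p + snd p) + of_int D * snd p \<and> of_int a * (fst p + snd p) + of_int D * snd p \<le> 1 + h})"
  have [measurable]: "S a \<in> sets borel" for a
    unfolding S_def by (rule Collect_measurable_borel) measurable
  have S: "emeasure lborel (S a) = ennreal (h\<^sup>2 / \<bar>of_int D\<bar>)" for a
  proof -
    define g :: "real \<times> real \<Rightarrow> ennreal" where "g = (\<lambda>p. if 1 < fst p \<and> fst p \<le> 1 + h \<and>
      1 < of_int a * fst p + of_int D * snd p \<and> of_int a * fst p + of_int D * snd p \<le> 1 + h then 1 else 0)"
    have [measurable]: "g \<in> borel_measurable borel"
      unfolding g_def by measurable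
    have [measurable]: "g \<in> borel_measurable (borel \<Otimes>\<^sub>M borel)"
      unfolding g_def by measurable
    have "emeasure lborel (S a) = (\<integral>\<^sup>+p. indicator (S a) p \<partial>lborel)" by simp
    also have "\<dots> = (\<integral>\<^sup>+t. \<integral>\<^sup>+s. g (s + t, t) \<partial>lborel \<partial>lborel)"
      by (subst nn_integral_lborel_pair_swap) (auto intro!: nn_integral_cong simp: S_def g_def indicator_def)
    also have "\<dots> = (\<integral>\<^sup>+t. \<integral>\<^sup>+x. g (x, t) \<partial>lborel \<partial>lborel)"
    proof (rule nn_integral_cong)
      fix t :: real
      show "(\<integral>\<^sup>+s. g (s + t, t) \<partial>lborel) = (\<integral>\<^sup>+x. g (x, t) \<partial>lborel)"
        by (rule nn_integral_shift[of "\<lambda>x. g (x, t)"]) measurable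
    qed
    also have "\<dots> = (\<integral>\<^sup>+p. g p \<partial>lborel)"
      by (rule nn_integral_lborel_pair_swap[symmetric]) measurable
    also have "\<dots> = (\<integral>\<^sup>+x. \<integral>\<^sup>+t. g (x, t) \<partial>lborel \<partial>lborel)"
      by (rule nn_integral_lborel_pair) measurable
    also have "\<dots> = (\<integral>\<^sup>+x. ennreal (h / \<bar>of_int D\<bar>) * indicator {1<..1 + h} x \<partial>lborel)"
    proof (rule nn_integral_cong)
      fix x :: real
      show "(\<integral>\<^sup>+t. g (x, t) \<partial>lborel) = ennreal (h / \<bar>of_int D\<bar>) * indicator {1<..1 + h} x"
      proof (cases "x \<in> {1<..1 + h}")
        case True
        have "(\<integral>\<^sup>+y. indicator {1<..1 + h} y \<partial>lborel)
          = ennreal \<bar>of_int D\<bar> * (\<integral>\<^sup>+t. indicator {1<..1 + h} (of_int a * x + of_int D * t) \<partial>lborel)"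
          by (rule nn_integral_real_affine) (use D in auto)
        also have "(\<integral>\<^sup>+t. indicator {1<..1 + h} (of_int a * x + of_int D * t) \<partial>lborel) = (\<integral>\<^sup>+t. g (x, t) \<partial>lborel)"
          using True by (intro nn_integral_cong) (auto simp: g_def indicator_def)
        finally have "ennreal h = ennreal \<bar>of_int D\<bar> * (\<integral>\<^sup>+t. g (x, t) \<partial>lborel)" using h by simp
        then have "ennreal (1 / \<bar>of_int D\<bar>) * ennreal h = ennreal (1 / \<bar>of_int D\<bar>) * (ennreal \<bar>of_int D\<bar> * (\<integral>\<^sup>+t. g (x, t) \<partial>lborel))" by simp
        also have "\<dots> = (\<integral>\<^sup>+t. g (x, t) \<partial>lborel)"
          using D by (simp add: mult.assoc[symmetric] ennreal_mult[symmetric])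
        finally show ?thesis using True h by (simp add: ennreal_mult[symmetric])
      next
        case False
        then have "g (x, t) = 0" for t by (auto simp: g_def)
        then show ?thesis using False by simp
      qed
    qed
    also have "\<dots> = ennreal (h / \<bar>of_int D\<bar>) * ennreal h"
      using h by (subst nn_integral_cmult_indicator) auto
    also have "\<dots> = ennreal (h\<^sup>2 / \<bar>of_int D\<bar>)"
      using h by (simp add: ennreal_mult[symmetric] power2_eq_square)
    finally show ?thesis .
  qed
  have "emeasure lborel (echo_strip h D) \<le> (\<Sum>a\<in>{- (\<bar>D\<bar> + 1)..\<bar>D\<bar> + 1}. emeasure lborel (S a))"
    unfolding echo_strip_def S_def[symmetric] by (rule emeasure_subadditive_finite) auto
  also have "\<dots> = ennreal (\<Sum>a\<in>{- (\<bar>D\<bar> + 1)..\<bar>D\<bar> + 1}. h\<^sup>2 / \<bar>of_int D\<bar>)"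
    unfolding S by (rule sum_ennreal) simp
  also have "\<dots> \<le> ennreal (5 * h\<^sup>2)"
  proof (rule ennreal_leI)
    have "real (nat (2 * \<bar>D\<bar> + 3)) \<le> 5 * \<bar>real_of_int D\<bar>" using D by auto
    then have "real (nat (2 * \<bar>D\<bar> + 3)) * (h\<^sup>2 / \<bar>of_int D\<bar>) \<le> 5 * \<bar>real_of_int D\<bar> * (h\<^sup>2 / \<bar>of_int D\<bar>)"
      by (rule mult_right_mono) simp
    also have "\<dots> = 5 * h\<^sup>2" using D by simp
    finally have "real (nat (2 * \<bar>D\<bar> + 3)) * (h\<^sup>2 / \<bar>of_int D\<bar>) \<le> 5 * h\<^sup>2" .
    moreover have "card {- (\<bar>D\<bar> + 1)..\<bar>D\<bar> + 1} = nat (2 * \<bar>D\<bar> + 3)" by simp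
    ultimately show "(\<Sum>a\<in>{- (\<bar>D\<bar> + 1)..\<bar>D\<bar> + 1}. h\<^sup>2 / \<bar>real_of_int D\<bar>) \<le> 5 * h\<^sup>2" by (simp only: sum_constant)
  qed
  finally show ?thesis .
qed

text \<open>If two vectors of a unimodular lattice both have abscissa in \<open>(1, 1 + h]\<close>, then the second is
  \<open>a\<close> times the first plus \<open>D\<close> times a basis vector, where \<open>D\<close> is their determinant, hence roughly the time \<open>j\<close>
  between the two.\<close>

lemma exits_strip_core_echo:
  assumes x: "x \<in> exits (strip_core h)" and y: "(unit_flow ^^ j) x \<in> exits (strip_core h)"
    and j: "1 \<le> j" and h: "0 < h" "real j * h \<le> 1 / 1000"
  shows "\<exists>D. D \<noteq> 0 \<and> int j - 12 \<le> D \<and> D \<le> int j + 12 \<and> fst x \<in> echo_strip h D"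
proof -
  have h1: "h \<le> 1 / 1000"
  proof -
    have "1 * h \<le> real j * h" using j h by (intro mult_right_mono) auto
    then show ?thesis using h by linarith
  qed
  obtain s t u where xe: "x = ((s, t), u)" by (metis prod.collapse)
  obtain s1 t1 u1 where ye: "(unit_flow ^^ j) x = ((s1, t1), u1)" by (metis prod.collapse)
  have xs: "x \<in> suspension" using x by (simp add: exits_def)
  have st: "1 / 8 \<le> s" "s \<le> 1" "1 / 8 \<le> t" "t \<le> 1" "1 < s + t" "s + t \<le> 1 + h" "u < 1 / (s * t)" "1 / (s * t) \<le> u + 1"
    using x by (auto simp: xe exits_def suspension_def strip_core_def thin_strip_def bcz_domain_iff return_time_def)
  have st1: "1 / 8 \<le> s1" "s1 \<le> 1" "1 / 8 \<le> t1" "t1 \<le> 1" "1 < s1 + t1" "s1 + t1 \<le> 1 + h" "u1 < 1 / (s1 * t1)" "1 / (s1 * t1) \<le> u1 + 1"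
    using y by (auto simp: ye exits_def suspension_def strip_core_def thin_strip_def bcz_domain_iff return_time_def)
  obtain a b c d :: int where det: "a * d - b * c = 1" and
    g: "\<And>k l. sl2_act a b c d (k *\<^sub>R (s, t) + l *\<^sub>R (transversal x - real j *\<^sub>R (s, t))) = k *\<^sub>R (s1, t1) + l *\<^sub>R transversal ((s1, t1), u1)"
    using unit_flow_funpow_matrix[OF xs, of j] unfolding ye unfolding xe by (metis fst_conv)
  \<comment> \<open>\<open>(A, B)\<close> are the coefficients, in the basis at the earlier time, of
    the sum of the two basis vectors at the later time. Its determinant against the earlier sum,
    with coefficients \<open>(1, 1)\<close>, is \<open>B - A\<close>.\<close>
  define A B D where "A = a + c" and "B = b + d" and "D = B - A"
  define r r1 where "r = 1 / (s * t) - u" and "r1 = 1 / (s1 * t1) - u1"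
  have r: "0 < r" "r \<le> 1" "0 < r1" "r1 \<le> 1" using st st1 by (auto simp: r_def r1_def)
  define \<xi> \<xi>1 where "\<xi> = s + t" and "\<xi>1 = s1 + t1"
  have xi: "1 < \<xi>" "\<xi> \<le> 1 + h" "1 < \<xi>1" "\<xi>1 \<le> 1 + h" using st st1 by (auto simp: \<xi>_def \<xi>1_def)
  have s1: "s1 = of_int a * s + of_int b * t" and t1: "t1 = of_int c * s + of_int d * t"
    using g[of 1 0] by (simp_all add: sl2_act_def)
  have xi1: "\<xi>1 = of_int A * \<xi> + of_int D * t"
    by (simp add: \<xi>1_def \<xi>_def s1 t1 A_def B_def D_def algebra_simps)
  have pos: "0 < s" "0 < t" "0 < s1" "0 < t1" using st st1 by linarith+
  \<comment> \<open>The determinant computed from abscissae and ordinates. The two sums have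
    ordinates \<open>\<xi> * r - 1 / t\<close> and \<open>\<xi>1 * r1 - 1 / t1\<close>, where
    \<open>r\<close> and \<open>r1\<close> are the remaining times to the next return; undoing the
    shear adds \<open>j * \<xi>1\<close> to the second.\<close>
  have key: "of_int D = \<xi>1 / t + \<xi> * \<xi>1 * (real j + r1 - r) - \<xi> / t1"
  proof -
    have "of_int A * (- u * s - real j * s) + of_int B * (1 / s - u * t - real j * t) = - u1 * s1 + (1 / s1 - u1 * t1)"
      using g[of 0 1] by (simp add: sl2_act_def transversal_def xe A_def B_def algebra_simps)
    then have "of_int B / s - (u + real j) * (of_int A * s + of_int B * t) = 1 / s1 - u1 * \<xi>1"
      by (simp add: \<xi>1_def algebra_simps)
    moreover have Bt: "of_int A * s + of_int B * t = \<xi>1"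
      by (simp add: xi1 \<xi>_def D_def algebra_simps)
    moreover have "of_int B / s = \<xi>1 / (s * t) - of_int A / t"
      using pos Bt by (simp add: field_simps)
    moreover have "1 / s1 = \<xi>1 / (s1 * t1) - 1 / t1"
      using pos by (simp add: \<xi>1_def field_simps)
    ultimately have "\<xi>1 / (s * t) - of_int A / t - (u + real j) * \<xi>1 = \<xi>1 / (s1 * t1) - 1 / t1 - u1 * \<xi>1" by simp
    moreover have "\<xi>1 / (s * t) = \<xi>1 * (r + u)" "\<xi>1 / (s1 * t1) = \<xi>1 * (r1 + u1)"
      by (simp_all add: r_def r1_def)
    ultimately have "of_int A / t = \<xi>1 * (r - real j - r1) + 1 / t1" by (simp add: algebra_simps)
    then have "\<xi> * (of_int A / t) = \<xi> * (\<xi>1 * (r - real j - r1) + 1 / t1)" by simp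
    moreover have "\<xi> * (of_int A / t) = \<xi>1 / t - of_int D"
      using pos by (simp add: xi1 field_simps)
    ultimately show ?thesis by (simp add: algebra_simps)
  qed
  \<comment> \<open>Error terms in \<open>key\<close>: the quotients by \<open>t\<close> and
    \<open>t1\<close> lie between 1 and 9, so they differ by at most 8; replacing
    \<open>\<xi> * \<xi>1\<close> by 1 costs at most \<open>3 * h * j \<le> 1\<close>; the remaining
    times cost at most 2.\<close>
  have D_near: "\<bar>of_int D - real j\<bar> \<le> 12"
  proof -
    have div: "1 \<le> z / w \<and> z / w \<le> 9" if "1 < z" "z \<le> 1 + h" "1 / 8 \<le> w" "w \<le> 1" for z w :: real
      using that h1 by (auto simp: field_simps)
    have e1: "1 \<le> \<xi>1 / t" "\<xi>1 / t \<le> 9" "1 \<le> \<xi> / t1" "\<xi> / t1 \<le> 9"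
      using div[of \<xi>1 t] div[of \<xi> t1] xi st st1 by auto
    have p1: "1 \<le> \<xi> * \<xi>1" using xi mult_mono[of 1 \<xi> 1 \<xi>1] by simp
    have p2: "\<xi> * \<xi>1 \<le> 1 + 3 * h"
    proof -
      have "\<xi> * \<xi>1 \<le> (1 + h) * (1 + h)" using xi by (intro mult_mono) auto
      also have "\<dots> = 1 + 2 * h + h * h" by (simp add: algebra_simps)
      also have "h * h \<le> 1 * h" using h h1 by (intro mult_right_mono) auto
      finally show ?thesis by simp
    qed
    have e2: "0 \<le> (\<xi> * \<xi>1 - 1) * real j" using p1 by simp
    have e3: "(\<xi> * \<xi>1 - 1) * real j \<le> 1"
    proof -
      have "(\<xi> * \<xi>1 - 1) * real j \<le> (3 * h) * real j" using p2 by (intro mult_right_mono) auto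
      moreover have "(3 * h) * real j = 3 * (real j * h)" by simp
      ultimately show ?thesis using h(2) by linarith
    qed
    have "\<bar>\<xi> * \<xi>1 * (r1 - r)\<bar> \<le> 2 * 1"
      unfolding abs_mult using p1 p2 h1 r by (intro mult_mono) auto
    then have e4: "\<bar>\<xi> * \<xi>1 * (r1 - r)\<bar> \<le> 2" by simp
    have "of_int D - real j = \<xi>1 / t - \<xi> / t1 + (\<xi> * \<xi>1 - 1) * real j + \<xi> * \<xi>1 * (r1 - r)"
      unfolding key by (simp add: algebra_simps)
    then show ?thesis using e1 e2 e3 e4 by (simp only: abs_le_iff) linarith
  qed
  \<comment> \<open>For parallel sums \<open>A = 1\<close>, since both abscissae are in
    \<open>(1, 1 + h]\<close>. The windows of the domain then force the same basis, and
    \<open>key\<close> becomes \<open>j + r1 - r = 0\<close>, impossible as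
    \<open>j \<ge> 1\<close>, \<open>r \<le> 1\<close> and \<open>r1 > 0\<close>.\<close>
  have D0: "D \<noteq> 0"
  proof
    assume D0: "D = 0"
    then have eq: "\<xi>1 = of_int A * \<xi>" using xi1 by simp
    have "0 < A" using eq xi by (smt (verit) mult_nonpos_nonneg of_int_le_0_iff)
    moreover have "A < 2"
    proof (rule ccontr)
      assume "\<not> A < 2"
      then have "2 * \<xi> \<le> of_int A * \<xi>" using xi by (intro mult_right_mono) auto
      then show False using eq xi h1 by linarith
    qed
    ultimately have A1: "A = 1" by linarith
    then have B1: "B = 1" using D0 by (simp add: D_def)
    have cd: "c = 1 - a" "d = 1 - b" using A1 B1 by (auto simp: A_def B_def)
    have b: "b = a - 1" using det unfolding cd by (simp add: algebra_simps)
    have s1': "s1 = s + of_int (a - 1) * \<xi>" unfolding s1 b by (simp add: \<xi>_def algebra_simps)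
    have "a = 1"
    proof (rule ccontr)
      assume "a \<noteq> 1"
      then consider "1 \<le> a - 1" | "a - 1 \<le> - 1" by linarith
      then show False
      proof cases
        case 1
        then have "1 \<le> real_of_int (a - 1)" by linarith
        then have "1 * \<xi> \<le> of_int (a - 1) * \<xi>" using xi by (intro mult_right_mono) auto
        then show False using s1' xi st1 pos by linarith
      next
        case 2
        then have "real_of_int (a - 1) \<le> - 1" by linarith
        then have "of_int (a - 1) * \<xi> \<le> - 1 * \<xi>" using xi by (intro mult_right_mono) auto
        then show False using s1' pos \<xi>_def by linarith
      qed
    qed
    then have "t1 = t" using t1 cd b by simp
    moreover have "\<xi>1 = \<xi>" using eq A1 by simp
    ultimately have "\<xi> * \<xi> * (real j + r1 - r) = 0" using key D0 by simp
    then have "real j + r1 - r = 0" using xi by simp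
    then show False using r j by linarith
  qed
  have A: "\<bar>A\<bar> \<le> \<bar>D\<bar> + 1"
  proof -
    have "\<bar>real_of_int A\<bar> * 1 \<le> \<bar>real_of_int A\<bar> * \<xi>" using xi by (intro mult_left_mono) auto
    also have "\<dots> = \<bar>\<xi>1 - of_int D * t\<bar>" using xi by (simp add: xi1 abs_mult)
    also have "\<dots> \<le> \<xi>1 + \<bar>of_int D\<bar> * t" using xi pos abs_triangle_ineq4[of \<xi>1 "of_int D * t"] by (simp add: abs_mult)
    also have "\<dots> \<le> \<xi>1 + \<bar>of_int D\<bar> * 1" using st by (intro add_left_mono mult_left_mono) auto
    finally have "\<bar>real_of_int A\<bar> < \<bar>real_of_int D\<bar> + 2" using xi h1 by linarith
    then show ?thesis by linarith
  qed
  have "fst x \<in> echo_strip h D"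
    unfolding echo_strip_def
  proof (rule UN_I[of A])
    show "A \<in> {- (\<bar>D\<bar> + 1)..\<bar>D\<bar> + 1}" using A by auto
    show "fst x \<in> {p. 1 < fst p + snd p \<and> fst p + snd p \<le> 1 + h \<and>
     1 < of_int A * (fst p + snd p) + of_int D * snd p \<and> of_int A * (fst p + snd p) + of_int D * snd p \<le> 1 + h}"
      using xi xi1 by (simp add: xe \<xi>_def)
  qed
  moreover have "int j - 12 \<le> D" "D \<le> int j + 12" using D_near by linarith+
  ultimately show ?thesis using D0 by blast
qed

text \<open>At most 25 determinants are possible, and each contributes at most
  \<open>5 * h\<^sup>2\<close>. The bound is the square of the probability scale of one visit, as
  for independent events.\<close>

lemma emeasure_two_visits:
  assumes j: "1 \<le> j" and h: "0 < h" "real j * h \<le> 1 / 1000"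
  shows "emeasure suspension_measure {x. x \<in> exits (strip_core h) \<and> (unit_flow ^^ j) x \<in> exits (strip_core h)} \<le> ennreal (125 * h\<^sup>2)"
proof -
  define I where "I = {int j - 12..int j + 12} - {0}"
  define E where "E = bcz_domain \<inter> (\<Union>D\<in>I. echo_strip h D)"
  have E: "E \<in> sets borel" unfolding E_def I_def by (intro sets.Int sets.finite_UN) auto
  have "emeasure suspension_measure {x. x \<in> exits (strip_core h) \<and> (unit_flow ^^ j) x \<in> exits (strip_core h)}
     \<le> emeasure suspension_measure (exits E)"
  proof (rule emeasure_mono)
    show "{x. x \<in> exits (strip_core h) \<and> (unit_flow ^^ j) x \<in> exits (strip_core h)} \<subseteq> exits E"
    proof
      fix x assume "x \<in> {x. x \<in> exits (strip_core h) \<and> (unit_flow ^^ j) x \<in> exits (strip_core h)}"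
      then have x: "x \<in> exits (strip_core h)" "(unit_flow ^^ j) x \<in> exits (strip_core h)" by auto
      obtain D where "D \<in> I" "fst x \<in> echo_strip h D"
        using exits_strip_core_echo[OF x j h] by (auto simp: I_def)
      then show "x \<in> exits E" using x(1) by (auto simp: exits_def E_def strip_core_def thin_strip_def)
    qed
  qed (use E in simp)
  also have "\<dots> = emeasure lborel E" by (rule emeasure_exits[OF E]) (auto simp: E_def)
  also have "\<dots> \<le> emeasure lborel (\<Union>D\<in>I. echo_strip h D)"
    by (rule emeasure_mono) (auto simp: E_def I_def)
  also have "\<dots> \<le> (\<Sum>D\<in>I. emeasure lborel (echo_strip h D))"
    by (rule emeasure_subadditive_finite) (auto simp: I_def)
  also have "\<dots> \<le> (\<Sum>D\<in>I. ennreal (5 * h\<^sup>2))"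
    using h by (intro sum_mono emeasure_echo_strip) (auto simp: I_def)
  also have "\<dots> = ennreal (\<Sum>D\<in>I. 5 * h\<^sup>2)" by (rule sum_ennreal) simp
  also have "\<dots> \<le> ennreal (125 * h\<^sup>2)"
  proof (rule ennreal_leI)
    have "card I \<le> card {int j - 12..int j + 12}" unfolding I_def by (intro card_mono) auto
    also have "\<dots> = 25" by simp
    finally have "real (card I) * (5 * h\<^sup>2) \<le> 25 * (5 * h\<^sup>2)" by (intro mult_right_mono) auto
    then show "(\<Sum>D\<in>I. 5 * h\<^sup>2) \<le> 125 * h\<^sup>2" by simp
  qed
  finally show ?thesis .
qed

text \<open>Off the strip the point and its rescaled copy both make one step, so the factors
  \<open>\<alpha>\<close> and \<open>cnj \<alpha>\<close> cancel. On the core the copy makes two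
  steps, which leaves one factor \<open>\<alpha>\<close>.\<close>

lemma twist_step:
  fixes f :: "real \<times> real \<Rightarrow> complex"
  assumes eig: "\<And>p. p \<in> bcz_domain \<Longrightarrow> f (bcz_map p) = \<alpha> * f p" and \<alpha>: "cmod \<alpha> = 1"
    and h: "0 < h" "h < 1 / 8" and l: "l = 1 / (1 + h)"
    and x: "x \<in> suspension" "x \<notin> exits (thin_strip h - strip_core h)"
  shows "f (reduce (l *\<^sub>R fst (unit_flow x))) * cnj (f (fst (unit_flow x)))
    = (if x \<in> exits (strip_core h) then \<alpha> else 1) * (f (reduce (l *\<^sub>R fst x)) * cnj (f (fst x)))"
proof -
  obtain s t u where xe: "x = ((s, t), u)" by (metis prod.collapse)
  have p: "(s, t) \<in> bcz_domain" using x by (auto simp: xe suspension_def)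
  have st: "0 < s" "s \<le> 1" "0 < t" "t \<le> 1" "1 < s + t" using p by (auto simp: bcz_domain_iff)
  have l01: "0 < l" "l < 1" using h by (auto simp: l)
  have aa: "\<alpha> * cnj \<alpha> = 1" using complex_norm_square[of \<alpha>] \<alpha> by simp
  show ?thesis
  proof (cases "u + 1 < return_time (s, t)")
    case True
    then have "x \<notin> exits (strip_core h)" by (auto simp: xe exits_def)
    then show ?thesis using True by (simp add: xe unit_flow_def)
  next
    case False
    then have Hx: "fst (unit_flow x) = bcz_map (s, t)" by (simp add: xe unit_flow_def)
    have ex: "x \<in> exits B \<longleftrightarrow> (s, t) \<in> B" for B using x(1) False by (auto simp: xe exits_def)
    show ?thesis
    proof (cases "s + t \<le> 1 + h")
      case False
      then have "1 < l * (s + t)" using h by (simp add: l field_simps)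
      note step = scaled_step_off[OF p l01 this]
      have "x \<notin> exits (strip_core h)" unfolding ex using False by (auto simp: strip_core_def thin_strip_def)
      moreover have "f (reduce (l *\<^sub>R bcz_map (s, t))) * cnj (f (bcz_map (s, t)))
        = (\<alpha> * cnj \<alpha>) * (f (reduce (l *\<^sub>R (s, t))) * cnj (f (s, t)))"
        unfolding step(1) eig[OF step(2)] eig[OF p] by (simp add: mult_ac)
      ultimately show ?thesis unfolding Hx aa by (simp add: xe)
    next
      case True
      then have "(s, t) \<in> strip_core h"
        using x(2) p unfolding ex by (auto simp: thin_strip_def)
      then have core: "x \<in> exits (strip_core h)" "1 / 8 \<le> s" "1 / 8 \<le> t" unfolding ex by (auto simp: strip_core_def)
      have "l * (s + t) \<le> 1" "1 < l * (2 * s + t)" "1 < l * (s + 2 * t)"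
        using True h core st by (auto simp: l field_simps)
      note step = scaled_step_on[OF p l01 this]
      have "f (reduce (l *\<^sub>R bcz_map (s, t))) * cnj (f (bcz_map (s, t)))
        = \<alpha> * ((\<alpha> * cnj \<alpha>) * (f (reduce (l *\<^sub>R (s, t))) * cnj (f (s, t))))"
        unfolding step(1) eig[OF bcz_map_in[OF step(2)]] eig[OF step(2)] eig[OF p] by (simp add: mult_ac)
      then show ?thesis using core unfolding Hx aa by (simp add: xe)
    qed
  qed
qed

lemma twist_steps:
  fixes f :: "real \<times> real \<Rightarrow> complex"
  assumes eig: "\<And>p. p \<in> bcz_domain \<Longrightarrow> f (bcz_map p) = \<alpha> * f p" and \<alpha>: "cmod \<alpha> = 1"
    and h: "0 < h" "h < 1 / 8" and l: "l = 1 / (1 + h)"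
    and x: "x \<in> suspension" "\<And>i. i < n \<Longrightarrow> (unit_flow ^^ i) x \<notin> exits (thin_strip h - strip_core h)"
  shows "f (reduce (l *\<^sub>R fst ((unit_flow ^^ n) x))) * cnj (f (fst ((unit_flow ^^ n) x)))
    = \<alpha> ^ card {i. i < n \<and> (unit_flow ^^ i) x \<in> exits (strip_core h)} * (f (reduce (l *\<^sub>R fst x)) * cnj (f (fst x)))"
  using x(2)
proof (induction n)
  case (Suc n)
  have in_s: "(unit_flow ^^ n) x \<in> suspension" using x(1) by (induction n) (auto simp: unit_flow_in)
  let ?P = "\<lambda>i. (unit_flow ^^ i) x \<in> exits (strip_core h)"
  have "{i. i < Suc n \<and> ?P i} = (if ?P n then insert n {i. i < n \<and> ?P i} else {i. i < n \<and> ?P i})"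
    by (auto simp: less_Suc_eq)
  then have card: "card {i. i < Suc n \<and> ?P i} = (if ?P n then Suc (card {i. i < n \<and> ?P i}) else card {i. i < n \<and> ?P i})"
    by simp
  show ?case
    using twist_step[where f = f, OF eig \<alpha> h l in_s] Suc unfolding card by (simp add: mult.assoc)
qed simp

lemma emeasure_suspension_fst_null:
  assumes N: "N \<in> null_sets lborel"
  shows "emeasure suspension_measure {x. fst x \<in> N} = 0"
proof -
  have [measurable]: "N \<in> sets borel" using N by auto
  have [measurable]: "{x :: (real \<times> real) \<times> real. fst x \<in> N} \<in> sets borel"
    by (rule Collect_measurable_borel) measurable
  have "emeasure suspension_measure {x. fst x \<in> N} = (\<integral>\<^sup>+x. indicator {x. fst x \<in> N} x \<partial>suspension_measure)" by simp
  also have "\<dots> = (\<integral>\<^sup>+p. 0 \<partial>(lborel :: (real \<times> real) measure))"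
    by (subst nn_integral_suspension, measurable, rule nn_integral_cong_AE)
      (use AE_not_in[OF N] in \<open>eventually_elim, simp\<close>)
  finally show ?thesis by simp
qed

lemma emeasure_thin_strip_tendsto:
  assumes h: "h \<longlonglongrightarrow> 0"
  shows "(\<lambda>n. emeasure suspension_measure {x. fst x \<in> thin_strip (h n)}) \<longlonglongrightarrow> 0"
proof -
  have [measurable]: "{x :: (real \<times> real) \<times> real. fst x \<in> thin_strip r} \<in> sets borel" for r
    by (rule Collect_measurable_borel) measurable
  interpret S: finite_measure suspension_measure by (rule finite_measure_suspension)
  have "(\<lambda>n. \<integral>\<^sup>+x. indicator {x. fst x \<in> thin_strip (h n)} x \<partial>suspension_measure) \<longlonglongrightarrow> (\<integral>\<^sup>+x. 0 \<partial>suspension_measure)"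
  proof (rule nn_integral_dominated_convergence[where w = "\<lambda>_. 1"])
    show "AE x in suspension_measure. (\<lambda>n. indicator {x. fst x \<in> thin_strip (h n)} x) \<longlonglongrightarrow> (0 :: ennreal)"
      unfolding AE_suspension
    proof (intro AE_I2 impI)
      fix x :: "(real \<times> real) \<times> real" assume "x \<in> suspension"
      then have "0 < fst (fst x) + snd (fst x) - 1" by (auto simp: suspension_def bcz_domain_def)
      then have "\<forall>\<^sub>F n in sequentially. h n < fst (fst x) + snd (fst x) - 1" by (rule order_tendstoD(2)[OF h])
      then have "\<forall>\<^sub>F n in sequentially. indicator {x. fst x \<in> thin_strip (h n)} x = (0 :: ennreal)"
        by eventually_elim (auto simp: thin_strip_def)
      then show "(\<lambda>n. indicator {x. fst x \<in> thin_strip (h n)} x) \<longlonglongrightarrow> (0 :: ennreal)" by (rule tendsto_eventually)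
    qed
  qed (auto simp: S.emeasure_eq_measure indicator_def)
  then show ?thesis by simp
qed

section \<open>Weak mixing\<close>

lemma twisted_eigenvalue_1:
  fixes f :: "real \<times> real \<Rightarrow> complex"
  assumes f [measurable]: "f \<in> borel_measurable borel" and bd: "\<And>p. cmod (f p) \<le> 1"
    and eig: "\<And>p. p \<in> bcz_domain \<Longrightarrow> f (bcz_map p) = \<alpha> * f p"
    and one: "AE p in lborel. p \<in> bcz_domain \<longrightarrow> cmod (f p) = 1" and \<alpha>: "cmod \<alpha> = 1"
  shows "\<alpha> = 1"
proof (rule ccontr)
  assume "\<alpha> \<noteq> 1"
  \<comment> \<open>Since \<open>\<bar>\<alpha>\<bar> = 1\<close>, a number and its product with
    \<open>\<alpha>\<close> cannot both be closer than \<open>\<delta>\<close> to 1.\<close>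
  define \<delta> where "\<delta> = cmod (\<alpha> - 1) / 2"
  have \<delta>: "0 < \<delta>" using \<open>\<alpha> \<noteq> 1\<close> by (simp add: \<delta>_def)
  \<comment> \<open>With \<open>Suc n\<close> time steps, steps times width is constantly
    \<open>x = 1 / 1000\<close>. This is small enough for the estimate of two visits and for
    \<open>3 / 4 * x - 1 / 4 * x - 125 * x\<^sup>2\<close> to be positive.\<close>
  define h where "h = (\<lambda>n. 1 / 1000 / real (Suc n))"
  define l where "l = (\<lambda>n. 1 / (1 + h n))"
  define tw where "tw = (\<lambda>n p. f (reduce (l n *\<^sub>R p)) * cnj (f p))"
  define B where "B = (\<lambda>n. {x. \<delta> \<le> cmod (tw n (fst x) - 1)} :: ((real \<times> real) \<times> real) set)"
  let ?\<nu> = "emeasure suspension_measure"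
  have h: "0 < h n" "h n < 1 / 8" "real (Suc n) * h n = 1 / 1000" for n
    by (simp_all add: h_def field_simps)
  have h0: "h \<longlonglongrightarrow> 0" unfolding h_def by (rule LIMSEQ_Suc[OF lim_const_over_n])
  have l1: "l \<longlonglongrightarrow> 1"
  proof -
    have "l \<longlonglongrightarrow> 1 / (1 + 0)" unfolding l_def by (intro tendsto_intros h0) simp
    then show ?thesis by simp
  qed
  have [measurable]: "cnj \<in> borel_measurable borel"
    by (intro borel_measurable_continuous_onI continuous_intros)
  have [measurable]: "tw n \<in> borel_measurable borel" for n
    unfolding tw_def by measurable
  have B [measurable]: "B n \<in> sets borel" for n
    unfolding B_def by (rule Collect_measurable_borel) measurable
  \<comment> \<open>Off the thin strip \<open>l n *\<^sub>R p\<close> is already reduced, and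
    \<open>\<bar>f p\<bar> = 1\<close> turns the distance of the twist from 1 into that of
    \<open>f (l n *\<^sub>R p)\<close> from \<open>f p\<close>. Dilations are perturbations without
    transversal part, hence continuous in measure.\<close>
  have B0: "(\<lambda>n. ?\<nu> (B n)) \<longlonglongrightarrow> 0"
  proof -
    define S where "S = (\<lambda>n. {x. \<delta> \<le> cmod (f (l n *\<^sub>R fst x + 0 *\<^sub>R transversal x) - f (1 *\<^sub>R fst x))})"
    define T where "T = (\<lambda>n. {x :: (real \<times> real) \<times> real. fst x \<in> thin_strip (h n)})"
    define N where "N = {p. p \<in> bcz_domain \<and> cmod (f p) \<noteq> 1}"
    have [measurable]: "S n \<in> sets borel" "T n \<in> sets borel" for n
      unfolding S_def T_def by (rule Collect_measurable_borel, measurable)+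
    have Nb [measurable]: "N \<in> sets borel"
      unfolding N_def by (rule Collect_measurable_borel) measurable
    have N: "N \<in> null_sets lborel"
    proof (rule null_setsI)
      show "emeasure lborel N = 0"
        using one by (subst (asm) AE_iff_measurable[where N = N]) (auto simp: N_def)
    qed simp
    have [measurable]: "{x :: (real \<times> real) \<times> real. fst x \<in> N} \<in> sets borel"
      by (rule Collect_measurable_borel) measurable
    have limST: "(\<lambda>n. ?\<nu> (S n) + ?\<nu> (T n)) \<longlonglongrightarrow> 0 + 0"
      unfolding S_def T_def
      by (intro tendsto_add suspension_perturbation_fun_null f bd l1 emeasure_thin_strip_tendsto h0 tendsto_const \<delta>) simp
    have le: "?\<nu> (B n) \<le> ?\<nu> (S n) + ?\<nu> (T n)" for n
    proof -
      have "B n \<inter> suspension \<subseteq> (S n \<union> T n) \<union> {x. fst x \<in> N}"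
      proof
        fix x assume x: "x \<in> B n \<inter> suspension"
        obtain s t u where xe: "x = ((s, t), u)" by (metis prod.collapse)
        show "x \<in> (S n \<union> T n) \<union> {x. fst x \<in> N}"
        proof (cases "s + t \<le> 1 + h n \<or> cmod (f (s, t)) \<noteq> 1")
          case True
          then show ?thesis using x by (auto simp: xe suspension_def T_def thin_strip_def N_def)
        next
          case False
          have p: "(s, t) \<in> bcz_domain" using x by (auto simp: xe suspension_def)
          then have st: "0 < s" "s \<le> 1" "0 < t" "t \<le> 1" by (auto simp: bcz_domain_iff)
          have l01: "0 < l n" "l n < 1" using h[of n] by (auto simp: l_def)
          have "1 < l n * (s + t)" using False h[of n] by (simp add: l_def field_simps)
          moreover have "l n * s \<le> 1" "l n * t \<le> 1" using st l01 by (auto intro!: mult_le_one)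
          ultimately have "(l n * s, l n * t) \<in> bcz_domain" using st l01 by (simp add: bcz_domain_iff algebra_simps)
          then have "tw n (s, t) = f (l n *\<^sub>R (s, t)) * cnj (f (s, t))" by (simp add: tw_def reduce_id)
          moreover have "f (s, t) * cnj (f (s, t)) = 1" using complex_norm_square[of "f (s, t)"] False by simp
          ultimately have "tw n (s, t) - 1 = (f (l n *\<^sub>R (s, t)) - f (s, t)) * cnj (f (s, t))"
            by (simp add: left_diff_distrib)
          then have "cmod (tw n (s, t) - 1) = cmod (f (l n *\<^sub>R (s, t)) - f (s, t))"
            using False by (simp add: norm_mult)
          then have "x \<in> S n" using x by (auto simp: xe B_def S_def)
          then show ?thesis by simp
        qed
      qed
      have "AE x in suspension_measure. x \<in> suspension" by (simp add: AE_suspension)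
      then have "?\<nu> (B n) \<le> ?\<nu> ((S n \<union> T n) \<union> {x. fst x \<in> N})"
        using \<open>B n \<inter> suspension \<subseteq> _\<close> by (intro emeasure_mono_AE) (auto elim: eventually_mono)
      also have "\<dots> \<le> ?\<nu> (S n \<union> T n) + ?\<nu> {x. fst x \<in> N}"
        by (intro emeasure_subadditive) auto
      also have "\<dots> = ?\<nu> (S n \<union> T n)" using emeasure_suspension_fst_null[OF N] by simp
      also have "\<dots> \<le> ?\<nu> (S n) + ?\<nu> (T n)"
        by (intro emeasure_subadditive) auto
      finally show ?thesis .
    qed
    show ?thesis
      by (rule tendsto_sandwich[OF _ _ tendsto_const]) (use limST le in auto)
  qed
  \<comment> \<open>Core visits have expectation at least \<open>3 / 4000\<close>, corner visits at
    most \<open>1 / 4000\<close>, ordered pairs of core visits at most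
    \<open>125 / 1000000 = 1 / 8000\<close>. The difference must come from the two occurrences of
    \<open>B n\<close>, at the start and at the end of the orbit piece.\<close>
  have lower: "ennreal (3 / 4000) \<le> ?\<nu> (B n) + ?\<nu> (B n) + ennreal (3 / 8000)" for n
  proof -
    let ?N = "Suc n"
    let ?H = "\<lambda>i. unit_flow ^^ i"
    define C where "C = exits (strip_core (h n))"
    define K where "K = exits (thin_strip (h n) - strip_core (h n))"
    have [measurable]: "C \<in> sets borel" "K \<in> sets borel" unfolding C_def K_def by auto
    have pre [measurable]: "{x. ?H i x \<in> X} \<in> sets borel" if [measurable]: "X \<in> sets borel" for i X
      by (rule Collect_measurable_borel) measurable
    have two [measurable]: "{x. ?H i x \<in> C \<and> ?H j x \<in> C} \<in> sets borel" for i j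
      by (rule Collect_measurable_borel) measurable
    define Q where "Q = (\<lambda>x. \<Sum>i<?N. \<Sum>j\<in>{..<?N} - {i}. indicator {x. ?H i x \<in> C \<and> ?H j x \<in> C} x :: ennreal)"
    have [measurable]: "Q \<in> borel_measurable borel" unfolding Q_def by measurable
    \<comment> \<open>With two or more core visits, every visit has a partner, so \<open>Q\<close>
      dominates their number. With exactly one and no corner visit, the twist is multiplied by
      \<open>\<alpha>\<close> between the two ends, so it is far from 1 at one of them.\<close>
    have pt: "(\<Sum>i<?N. indicator {x. ?H i x \<in> C} x) \<le>
        indicator (B n) x + indicator {x. ?H ?N x \<in> B n} x + Q x + (\<Sum>i<?N. indicator {x. ?H i x \<in> K} x)"
      if xs: "x \<in> suspension" for x
    proof -
      define V where "V = {i. i < ?N \<and> ?H i x \<in> C}"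
      have finV: "finite V" by (simp add: V_def)
      consider "V = {}" | "card V = 1" | "2 \<le> card V" by (metis One_nat_def Suc_1 card_0_eq finV less_one not_less_eq_eq order_le_less)
      then show ?thesis
      proof cases
        case 1
        then have "(\<Sum>i<?N. indicator {x. ?H i x \<in> C} x) = (0 :: ennreal)"
          by (intro sum.neutral) (auto simp: V_def indicator_def)
        then show ?thesis by simp
      next
        case 2
        have s1: "(\<Sum>i<?N. indicator {x. ?H i x \<in> C} x) = (1 :: ennreal)"
        proof -
          have "(\<Sum>i<?N. indicator {x. ?H i x \<in> C} x) = (\<Sum>i\<in>V. 1 :: ennreal)"
            by (intro sum.mono_neutral_cong_right) (auto simp: V_def indicator_def)
          then show ?thesis using 2 by simp
        qed
        show ?thesis
        proof (cases "\<exists>i<?N. ?H i x \<in> K")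
          case True
          then obtain i where i: "i < ?N" "?H i x \<in> K" by blast
          then have "(1 :: ennreal) \<le> (\<Sum>i<?N. indicator {x. ?H i x \<in> K} x)"
            using member_le_sum[of i "{..<?N}" "\<lambda>i. indicator {x. ?H i x \<in> K} x :: ennreal"] by simp
          then show ?thesis unfolding s1 by (simp add: add_increasing)
        next
          case False
          have "tw n (fst (?H ?N x)) = \<alpha> ^ card V * tw n (fst x)"
            unfolding tw_def V_def C_def
            by (rule twist_steps[where f = f, OF eig \<alpha> h(1,2) _ xs]) (use False in \<open>auto simp: l_def K_def\<close>)
          then have tw: "tw n (fst (?H ?N x)) = \<alpha> * tw n (fst x)" using 2 by simp
          have "x \<in> B n \<or> ?H ?N x \<in> B n"
          proof (rule ccontr)
            assume "\<not> (x \<in> B n \<or> ?H ?N x \<in> B n)"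
            then have b: "cmod (tw n (fst x) - 1) < \<delta>" "cmod (\<alpha> * tw n (fst x) - 1) < \<delta>"
              using tw by (auto simp: B_def)
            have "cmod (\<alpha> * (tw n (fst x) - 1)) < \<delta>" using b(1) \<alpha> by (simp add: norm_mult)
            then have "cmod ((\<alpha> * tw n (fst x) - 1) - \<alpha> * (tw n (fst x) - 1)) < \<delta> + \<delta>"
              using norm_triangle_ineq4[of "\<alpha> * tw n (fst x) - 1" "\<alpha> * (tw n (fst x) - 1)"] b(2) by linarith
            then show False by (simp add: \<delta>_def algebra_simps)
          qed
          then show ?thesis unfolding s1 by (auto simp: add_increasing add_increasing2)
        qed
      next
        case 3
        have "(\<Sum>i<?N. indicator {x. ?H i x \<in> C} x) \<le> Q x"
          unfolding Q_def
        proof (rule sum_mono)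
          fix i assume i: "i \<in> {..<?N}"
          show "indicator {x. ?H i x \<in> C} x \<le> (\<Sum>j\<in>{..<?N} - {i}. indicator {x. ?H i x \<in> C \<and> ?H j x \<in> C} x :: ennreal)"
          proof (cases "i \<in> V")
            case True
            have "\<not> V \<subseteq> {i}" using 3 card_mono[of "{i}" V] by auto
            then obtain j where j: "j \<in> V" "j \<noteq> i" by blast
            then show ?thesis
              using True member_le_sum[of j "{..<?N} - {i}" "\<lambda>j. indicator {x. ?H i x \<in> C \<and> ?H j x \<in> C} x :: ennreal"]
              by (auto simp: V_def)
          next
            case False
            then show ?thesis using i by (simp add: V_def)
          qed
        qed
        then show ?thesis by (simp add: add_increasing add_increasing2)
      qed
    qed
    have nuC: "ennreal (3 / 4 * h n) \<le> ?\<nu> C"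
    proof -
      have "?\<nu> C = emeasure lborel (strip_core (h n))"
        unfolding C_def by (rule emeasure_exits) (auto simp: strip_core_def thin_strip_def)
      then show ?thesis using strip_core_ge[of "h n"] h[of n] by simp
    qed
    have nuK: "?\<nu> K \<le> ennreal (1 / 4 * h n)"
    proof -
      have "?\<nu> K = emeasure lborel (thin_strip (h n) - strip_core (h n))"
        unfolding K_def by (rule emeasure_exits) (auto simp: thin_strip_def)
      then show ?thesis using strip_corner_le[of "h n"] h[of n] by simp
    qed
    have nu2: "?\<nu> {x. ?H i x \<in> C \<and> ?H j x \<in> C} \<le> ennreal (125 * (h n)\<^sup>2)" if ij: "i < j" "j < ?N" for i j
    proof -
      have "?\<nu> {x. ?H i x \<in> C \<and> ?H j x \<in> C} = ?\<nu> {x. ?H i x \<in> {y. y \<in> C \<and> ?H (j - i) y \<in> C}}"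
        using ij by (simp add: funpow_add[symmetric, unfolded o_def, THEN fun_cong])
      also have "\<dots> = ?\<nu> {y. y \<in> C \<and> ?H (j - i) y \<in> C}"
        using two[of 0 "j - i"] by (intro emeasure_unit_flow_funpow) simp
      also have "\<dots> \<le> ennreal (125 * (h n)\<^sup>2)"
        unfolding C_def
      proof (rule emeasure_two_visits)
        have "real (j - i) * h n \<le> real ?N * h n" using ij h[of n] by (intro mult_right_mono) auto
        then show "real (j - i) * h n \<le> 1 / 1000" using h(3)[of n] by linarith
      qed (use ij h[of n] in auto)
      finally show ?thesis .
    qed
    have nuQ: "(\<integral>\<^sup>+x. Q x \<partial>suspension_measure) \<le> ennreal (real ?N * (real ?N * (125 * (h n)\<^sup>2)))"
    proof -
      have "(\<integral>\<^sup>+x. Q x \<partial>suspension_measure) = (\<Sum>i<?N. \<Sum>j\<in>{..<?N} - {i}. ?\<nu> {x. ?H i x \<in> C \<and> ?H j x \<in> C})"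
        unfolding Q_def by (simp add: nn_integral_sum del: sum.lessThan_Suc)
      also have "\<dots> \<le> (\<Sum>i<?N. \<Sum>j\<in>{..<?N} - {i}. ennreal (125 * (h n)\<^sup>2))"
      proof (intro sum_mono)
        fix i j assume ij: "i \<in> {..<?N}" "j \<in> {..<?N} - {i}"
        show "?\<nu> {x. ?H i x \<in> C \<and> ?H j x \<in> C} \<le> ennreal (125 * (h n)\<^sup>2)"
        proof (cases "i < j")
          case True
          then show ?thesis using nu2[of i j] ij by simp
        next
          case False
          then show ?thesis using nu2[of j i] ij by (simp add: conj_commute)
        qed
      qed
      also have "\<dots> \<le> (\<Sum>i<?N. \<Sum>j<?N. ennreal (125 * (h n)\<^sup>2))"
        by (intro sum_mono sum_mono2) auto
      also have "\<dots> = ennreal (\<Sum>i<?N. \<Sum>j<?N. 125 * (h n)\<^sup>2)"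
        by (simp only: sum_ennreal sum_nonneg zero_le_mult_iff zero_le_power2 zero_le_numeral simp_thms)
      finally show ?thesis by simp
    qed
    have "ennreal (3 / 4000) = (\<Sum>i<?N. ennreal (3 / 4 * h n))"
    proof -
      have "(\<Sum>i<?N. ennreal (3 / 4 * h n)) = ennreal (\<Sum>i<?N. 3 / 4 * h n)"
        using h[of n] by (intro sum_ennreal) auto
      also have "(\<Sum>i<?N. 3 / 4 * h n) = 3 / 4 * (real ?N * h n)" by simp
      also have "\<dots> = 3 / 4000" unfolding h(3) by simp
      finally show ?thesis by simp
    qed
    also have "\<dots> \<le> (\<Sum>i<?N. ?\<nu> {x. ?H i x \<in> C})"
      using nuC by (intro sum_mono) (simp add: emeasure_unit_flow_funpow)
    also have "\<dots> = (\<integral>\<^sup>+x. (\<Sum>i<?N. indicator {x. ?H i x \<in> C} x) \<partial>suspension_measure)"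
      by (simp add: nn_integral_sum del: sum.lessThan_Suc)
    also have "\<dots> \<le> (\<integral>\<^sup>+x. indicator (B n) x + indicator {x. ?H ?N x \<in> B n} x + Q x + (\<Sum>i<?N. indicator {x. ?H i x \<in> K} x) \<partial>suspension_measure)"
      by (rule nn_integral_mono_AE) (use pt in \<open>auto simp: AE_suspension intro!: AE_I2\<close>)
    also have "\<dots> = ?\<nu> (B n) + ?\<nu> {x. ?H ?N x \<in> B n} + (\<integral>\<^sup>+x. Q x \<partial>suspension_measure) + (\<Sum>i<?N. ?\<nu> {x. ?H i x \<in> K})"
      by (simp add: nn_integral_add nn_integral_sum del: sum.lessThan_Suc)
    also have "\<dots> \<le> ?\<nu> (B n) + ?\<nu> (B n) + ennreal (real ?N * (real ?N * (125 * (h n)\<^sup>2))) + (\<Sum>i<?N. ennreal (1 / 4 * h n))"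
      using nuQ nuK by (intro add_mono sum_mono) (simp_all add: emeasure_unit_flow_funpow del: funpow.simps)
    also have "(\<Sum>i<?N. ennreal (1 / 4 * h n)) = ennreal (1 / 4000)"
    proof -
      have "(\<Sum>i<?N. ennreal (1 / 4 * h n)) = ennreal (\<Sum>i<?N. 1 / 4 * h n)"
        using h[of n] by (intro sum_ennreal) auto
      also have "(\<Sum>i<?N. 1 / 4 * h n) = 1 / 4 * (real ?N * h n)" by simp
      also have "\<dots> = 1 / 4000" unfolding h(3) by simp
      finally show ?thesis by simp
    qed
    also have "real ?N * (real ?N * (125 * (h n)\<^sup>2)) = 125 * (real ?N * h n)\<^sup>2" by (simp add: power2_eq_square)
    also have "\<dots> = 1 / 8000" unfolding h(3) by (simp add: power2_eq_square)
    also have "?\<nu> (B n) + ?\<nu> (B n) + ennreal (1 / 8000) + ennreal (1 / 4000) = ?\<nu> (B n) + ?\<nu> (B n) + ennreal (3 / 8000)"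
      by (simp add: add.assoc ennreal_plus[symmetric] del: ennreal_plus)
    finally show ?thesis .
  qed
  have "(\<lambda>n. ?\<nu> (B n) + ?\<nu> (B n) + ennreal (3 / 8000)) \<longlonglongrightarrow> 0 + 0 + ennreal (3 / 8000)"
    by (intro tendsto_add B0 tendsto_const)
  then have "ennreal (3 / 4000) \<le> 0 + 0 + ennreal (3 / 8000)"
    by (rule tendsto_lowerbound) (use lower in auto)
  then show False by simp
qed

section \<open>From Lebesgue measure on the domain to the normalised measure, and the
  conclusion\<close>

lemma emeasure_restrict_bcz_domain:
  "emeasure (restrict_space lborel bcz_domain) bcz_domain \<noteq> 0"
  "emeasure (restrict_space lborel bcz_domain) bcz_domain < \<top>"
proof -
  have "emeasure (restrict_space lborel bcz_domain) bcz_domain = emeasure lborel bcz_domain"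
    by (rule emeasure_restrict_space) auto
  then have *: "emeasure (restrict_space lborel bcz_domain) bcz_domain = ennreal (1 / 2)"
    unfolding emeasure_bcz_domain .
  show "emeasure (restrict_space lborel bcz_domain) bcz_domain < \<top>"
    unfolding * by (rule ennreal_less_top)
  show "emeasure (restrict_space lborel bcz_domain) bcz_domain \<noteq> 0"
    unfolding * by simp
qed

lemma AE_bcz_measure: "(AE p in bcz_measure. P p) \<longleftrightarrow> (AE p in lborel. p \<in> bcz_domain \<longrightarrow> P p)"
proof -
  have "(AE p in bcz_measure. P p) \<longleftrightarrow> (AE p in restrict_space lborel bcz_domain. p \<in> bcz_domain \<longrightarrow> P p)"
    unfolding bcz_measure_def
    by (rule AE_uniform_measure) (use emeasure_restrict_bcz_domain in auto)
  also have "\<dots> \<longleftrightarrow> (AE p in lborel. p \<in> bcz_domain \<longrightarrow> P p)"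
    by (subst AE_restrict_space_iff) auto
  finally show ?thesis .
qed

lemma space_bcz_measure: "space bcz_measure = bcz_domain"
  and sets_bcz_measure: "sets bcz_measure = sets (restrict_space borel bcz_domain)"
  by (simp_all add: bcz_measure_def space_restrict_space sets_restrict_space)

lemma borel_measurable_bcz_measure_iff:
  fixes f :: "real \<times> real \<Rightarrow> complex"
  shows "f \<in> borel_measurable bcz_measure \<longleftrightarrow> (\<lambda>p. if p \<in> bcz_domain then f p else 0) \<in> borel_measurable borel"
  using measurable_restrict_space_iff[of bcz_domain borel 0 borel f]
  by (simp add: measurable_cong_sets[OF sets_bcz_measure refl])

lemma nn_integral_bcz_measure:
  fixes g :: "real \<times> real \<Rightarrow> ennreal"
  assumes [measurable]: "g \<in> borel_measurable borel"
  shows "(\<integral>\<^sup>+p. g p \<partial>bcz_measure) = (\<integral>\<^sup>+p. g p * indicator bcz_domain p \<partial>lborel) / ennreal (1 / 2)"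
proof -
  have [measurable]: "g \<in> borel_measurable (restrict_space lborel bcz_domain)"
    by (rule measurable_restrict_space1) simp
  have "(\<integral>\<^sup>+p. g p \<partial>bcz_measure) =
      (\<integral>\<^sup>+p. g p * indicator bcz_domain p \<partial>restrict_space lborel bcz_domain) / emeasure (restrict_space lborel bcz_domain) bcz_domain"
    unfolding bcz_measure_def by (rule nn_integral_uniform_measure) (auto simp: sets_restrict_space)
  also have "(\<integral>\<^sup>+p. g p * indicator bcz_domain p \<partial>restrict_space lborel bcz_domain) = (\<integral>\<^sup>+p. g p * indicator bcz_domain p \<partial>lborel)"
    by (subst nn_integral_restrict_space) (auto intro!: nn_integral_cong simp: indicator_def)
  finally show ?thesis
    by (simp add: emeasure_restrict_space emeasure_bcz_domain)
qed

lemma prob_space_bcz_measure: "prob_space bcz_measure"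
  unfolding bcz_measure_def
  by (rule prob_space_uniform_measure) (use emeasure_restrict_bcz_domain in auto)

lemma bcz_map_measurable_bcz_measure: "bcz_map \<in> bcz_measure \<rightarrow>\<^sub>M bcz_measure"
proof -
  have "bcz_map \<in> restrict_space borel bcz_domain \<rightarrow>\<^sub>M restrict_space borel bcz_domain"
    by (rule measurable_restrict_space3) (auto intro: bcz_map_in)
  then show ?thesis by (simp add: measurable_cong_sets[OF sets_bcz_measure sets_bcz_measure])
qed

lemma measure_preserving_bcz_map: "measure_preserving bcz_measure bcz_map"
  unfolding measure_preserving_def
proof
  show "bcz_map \<in> bcz_measure \<rightarrow>\<^sub>M bcz_measure" by (rule bcz_map_measurable_bcz_measure)
  show "distr bcz_measure bcz_measure bcz_map = bcz_measure"
  proof (rule measure_eqI)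
    fix A assume "A \<in> sets (distr bcz_measure bcz_measure bcz_map)"
    then have A: "A \<in> sets bcz_measure" by simp
    then have Ab [measurable]: "A \<in> sets borel" by (auto simp: sets_bcz_measure sets_restrict_space)
    have "emeasure (distr bcz_measure bcz_measure bcz_map) A = (\<integral>\<^sup>+p. indicator A p \<partial>distr bcz_measure bcz_measure bcz_map)"
      using A by simp
    also have "\<dots> = (\<integral>\<^sup>+p. indicator A (bcz_map p) \<partial>bcz_measure)"
      using A by (intro nn_integral_distr bcz_map_measurable_bcz_measure) simp
    also have "\<dots> = (\<integral>\<^sup>+p. indicator A p \<partial>bcz_measure)"
      by (simp add: nn_integral_bcz_measure nn_integral_bcz_map)
    also have "\<dots> = emeasure bcz_measure A" using A by simp
    finally show "emeasure (distr bcz_measure bcz_measure bcz_map) A = emeasure bcz_measure A" .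
  qed simp
qed

theorem theorem1: "weak_mixing bcz_measure bcz_map"
  unfolding weak_mixing_def
proof (intro conjI allI impI prob_space_bcz_measure measure_preserving_bcz_map)
  fix \<alpha> :: complex and f :: "real \<times> real \<Rightarrow> complex"
  assume eigf: "eigenfunction bcz_measure bcz_map \<alpha> f"
  define f0 where "f0 = (\<lambda>p. if p \<in> bcz_domain then f p else 0)"
  have f0 [measurable]: "f0 \<in> borel_measurable borel"
    using eigf unfolding eigenfunction_def borel_measurable_bcz_measure_iff f0_def by blast
  have nz: "\<not> (AE p in lborel. p \<in> bcz_domain \<longrightarrow> f0 p = 0)"
    using eigf unfolding eigenfunction_def AE_bcz_measure by (auto simp: f0_def)
  have eig: "AE p in lborel. p \<in> bcz_domain \<longrightarrow> f0 (bcz_map p) = \<alpha> * f0 p"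
  proof -
    have "AE p in lborel. p \<in> bcz_domain \<longrightarrow> f (bcz_map p) = \<alpha> * f p"
      using eigf unfolding eigenfunction_def AE_bcz_measure by blast
    then show ?thesis by eventually_elim (auto simp: f0_def bcz_map_in)
  qed
  define I where "I = (\<integral>\<^sup>+p. ennreal ((cmod (f0 p))\<^sup>2) * indicator bcz_domain p \<partial>lborel)"
  have I_fin: "I < \<infinity>"
  proof -
    have "(\<integral>\<^sup>+p. ennreal ((cmod (f p))\<^sup>2) \<partial>bcz_measure) < \<infinity>"
      using eigf unfolding eigenfunction_def integrable_iff_bounded by simp
    also have "(\<integral>\<^sup>+p. ennreal ((cmod (f p))\<^sup>2) \<partial>bcz_measure) = (\<integral>\<^sup>+p. ennreal ((cmod (f0 p))\<^sup>2) \<partial>bcz_measure)"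
      by (intro nn_integral_cong) (auto simp: f0_def space_bcz_measure)
    also have "\<dots> = I / ennreal (1 / 2)"
      unfolding I_def by (rule nn_integral_bcz_measure) measurable
    finally show ?thesis by (auto simp: ennreal_divide_eq_top_iff less_top[symmetric])
  qed
  have I_pos: "I \<noteq> 0"
  proof
    assume "I = 0"
    then have "AE p in lborel. ennreal ((cmod (f0 p))\<^sup>2) * indicator bcz_domain p = 0"
      unfolding I_def by (subst (asm) nn_integral_0_iff_AE) auto
    then have "AE p in lborel. p \<in> bcz_domain \<longrightarrow> f0 p = 0"
      by eventually_elim (auto simp: indicator_def split: if_splits)
    then show False using nz by simp
  qed
  \<comment> \<open>Composition with the map preserves the squared norm \<open>I\<close>, which is
    finite and nonzero, so \<open>(cmod \<alpha>)\<^sup>2\<close> cancels to 1.\<close>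
  have \<alpha>: "cmod \<alpha> = 1"
  proof -
    have "I = (\<integral>\<^sup>+p. ennreal ((cmod (f0 (bcz_map p)))\<^sup>2) * indicator bcz_domain p \<partial>lborel)"
      unfolding I_def by (rule nn_integral_bcz_map[symmetric]) measurable
    also have "\<dots> = (\<integral>\<^sup>+p. ennreal ((cmod \<alpha>)\<^sup>2) * (ennreal ((cmod (f0 p))\<^sup>2) * indicator bcz_domain p) \<partial>lborel)"
      by (intro nn_integral_cong_AE, use eig in eventually_elim)
        (auto simp: indicator_def norm_mult power_mult_distrib ennreal_mult)
    also have "\<dots> = ennreal ((cmod \<alpha>)\<^sup>2) * I"
      unfolding I_def by (rule nn_integral_cmult) measurable
    finally have "I = ennreal ((cmod \<alpha>)\<^sup>2) * I" .
    moreover obtain r where r: "I = ennreal r" "0 \<le> r" using I_fin by (cases I rule: ennreal_cases) auto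
    ultimately have "ennreal r = ennreal ((cmod \<alpha>)\<^sup>2 * r)" by (simp add: ennreal_mult)
    then have "r = (cmod \<alpha>)\<^sup>2 * r" using r(2) by (subst (asm) ennreal_inj) auto
    then have "(cmod \<alpha>)\<^sup>2 = 1" using r I_pos by auto
    then show ?thesis using norm_ge_zero[of \<alpha>] unfolding power2_eq_1_iff by linarith
  qed
  \<comment> \<open>The modulus of an eigenfunction is invariant, hence constant by ergodicity; it
    is viewed as a complex function to fit the ergodicity statement.\<close>
  have "AE p in lborel. p \<in> bcz_domain \<longrightarrow> complex_of_real (cmod (f0 (bcz_map p))) = complex_of_real (cmod (f0 p))"
    using eig by eventually_elim (simp add: norm_mult \<alpha>)
  then obtain z where z: "AE p in lborel. p \<in> bcz_domain \<longrightarrow> complex_of_real (cmod (f0 p)) = z"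
    using bcz_invariant_const[of "\<lambda>p. complex_of_real (cmod (f0 p))"] by auto
  define c where "c = cmod z"
  have c: "AE p in lborel. p \<in> bcz_domain \<longrightarrow> cmod (f0 p) = c"
    using z by eventually_elim (auto simp: c_def)
  have "c \<noteq> 0"
  proof
    assume "c = 0"
    with c have "AE p in lborel. p \<in> bcz_domain \<longrightarrow> f0 p = 0" by simp
    then show False using nz by simp
  qed
  then have c0: "0 < c" by (simp add: c_def)
  \<comment> \<open>The normalised eigenfunction. The value 0 where the modulus deviates gives
    \<open>\<bar>g\<bar> \<le> 1\<close> everywhere, as continuity in measure demands. It does not
    disturb the eigenvalue equation, because the modulus agrees at \<open>p\<close> and
    \<open>bcz_map p\<close> for almost every \<open>p\<close>.\<close>
  define g where "g = (\<lambda>p. if cmod (f0 p) = c then f0 p / of_real c else 0)"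
  have [measurable]: "g \<in> borel_measurable borel" unfolding g_def by measurable
  have g1: "AE p in lborel. p \<in> bcz_domain \<longrightarrow> cmod (g p) = 1"
    using c by eventually_elim (use c0 in \<open>auto simp: g_def norm_divide\<close>)
  have "AE p in lborel. p \<in> bcz_domain \<longrightarrow> g (bcz_map p) = \<alpha> * g p"
    using eig by eventually_elim (auto simp: g_def norm_mult \<alpha>)
  then obtain g' where g': "g' \<in> borel_measurable borel" "\<And>p. p \<in> bcz_domain \<Longrightarrow> g' (bcz_map p) = \<alpha> * g' p"
    "AE p in lborel. g' p = g p" "\<And>p. g' p = g p \<or> g' p = 0"
    by (rule bcz_equivariant_version[OF \<open>g \<in> borel_measurable borel\<close>]) (rule that)
  have "cmod (g p) \<le> 1" for p using c0 by (simp add: g_def norm_divide)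
  then have "cmod (g' p) \<le> 1" for p using g'(4)[of p] by (metis norm_zero zero_le_one)
  moreover have "AE p in lborel. p \<in> bcz_domain \<longrightarrow> cmod (g' p) = 1"
    using g1 g'(3) by eventually_elim simp
  ultimately show "\<alpha> = 1"
    using twisted_eigenvalue_1[of g' \<alpha>] g'(1,2) \<alpha> by blast
  then have "AE p in lborel. p \<in> bcz_domain \<longrightarrow> f0 (bcz_map p) = f0 p" using eig by simp
  then obtain w where "AE p in lborel. p \<in> bcz_domain \<longrightarrow> f0 p = w"
    using bcz_invariant_const[OF f0] by blast
  then have "AE p in lborel. p \<in> bcz_domain \<longrightarrow> f p = w"
    by eventually_elim (auto simp: f0_def)
  then show "\<exists>c. AE p in bcz_measure. f p = c" unfolding AE_bcz_measure by blast
qed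

end
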